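(* Let $(X,\mathcal{A},\mu,T)$ and $(Y,\mathcal{B},\nu,S)$ be two dynamical systems, with Poisson suspensions $(X^{*},\mathcal{A}^{*},\mu^{*},T_{*})$ and $(Y^{*},\mathcal{B}^{*},\nu^{*},S_{*})$. 1. If the Poisson suspensions are ID-disjoint, then $(X,\mathcal{A},\mu,T)$ and $(Y,\mathcal{B},\nu,S)$ are strongly disjoint. 2. If $(X,\mathcal{A},\mu,T)$ and $(Y,\mathcal{B},\nu,S)$ are ergodic, then they are strongly disjoint if and only if their Poisson suspensions are ID-disjoint.
   Context: The bases are $\sigma$-finite Lebesgue spaces with continuous infinite measures, and $T,S$ are automorphisms (invertible measure preserving transformations). Poisson suspension: $X^{*}$ is the space of measures on $(X,\mathcal{A})$; $\mathcal{A}^{*}$ is generated by the maps $N(A):\xi\mapsto\xi(A)$, $A\in\mathcal{A}$; $\mu^{*}$ is the Poisson measure, under which, for disjoint $A_1,\dots,A_k$ of finite $\mu$-measure, the $N(A_i)$ are independent Poisson variables of parameter $\mu(A_i)$; $T_{*}(\xi)=\xi\circ T^{-1}$. A joining of two systems is an invariant measure (under the product transformation) on the product space whose marginals are the given measures. For $0<c_1,c_2<\infty$, a $(c_1,c_2)$-joining between $(X,\mathcal{A},\mu,T)$ and $(Y,\mathcal{B},\nu,S)$ is a joining between $(X,\mathcal{A},c_1\mu,T)$ and $(Y,\mathcal{B},c_2\nu,S)$. Two systems are strongly disjoint if no $(c_1,c_2)$-joining between them exists, for any $c_1,c_2$. A Poissonian joining of the two suspensions is a joining $\rho$ on $X^*\times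 Y^*$ that is infinitely divisible: for each $n\ge 1$ it is the $n$-th convolution power of some probability measure, convolution being with respect to coordinatewise addition of measures. The two suspensions are ID-disjoint if their only Poissonian joining is the product $\mu^*\otimes\nu^*$. *)

theory Defs
  imports "HOL-Probability.Probability"
begin

section \<open>Dynamical systems\<close>

definition iso_mod0 :: "'a measure \<Rightarrow> 'b measure \<Rightarrow> bool" where
  "iso_mod0 M N \<longleftrightarrow>
     (\<exists>X0 \<in> sets M. \<exists>Y0 \<in> sets N. \<exists>f g.
        space M - X0 \<in> null_sets M \<and> space N - Y0 \<in> null_sets N \<and>
        f \<in> measurable (restrict_space M X0) (restrict_space N Y0) \<and>
        g \<in> measurable (restrict_space N Y0) (restrict_space M X0) \<and>
        (\<forall>x \<in> X0. g (f x) = x) \<and> (\<forall>y \<in> Y0. f (g y) = y) \<and>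
        distr (restrict_space M X0) (restrict_space N Y0) f = restrict_space N Y0)"

text \<open>
  Every standard Borel space is Borel isomorphic to a Borel subset of the real line, so Borel
  measures on the line suffice as models. Passing to completions on both sides covers both usages
  of ``Lebesgue space'': a complete space in the sense of Rokhlin, and a standard Borel space.
\<close>

definition sigma_finite_lebesgue_space :: "'a measure \<Rightarrow> bool" where
  "sigma_finite_lebesgue_space M \<longleftrightarrow>
     sigma_finite_measure M \<and>
     (\<exists>m :: real measure. sets m = sets borel \<and> sigma_finite_measure m \<and>
        iso_mod0 (completion M) (completion m))"

text \<open>
  The null sets are taken in the completion because a singleton need not belong to \<open>sets M\<close>,
  in which case \<open>emeasure M {x} = 0\<close> would hold for a trivial reason.
\<close>

definition continuous_measure :: "'a measure \<Rightarrow> bool" where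
  "continuous_measure M \<longleftrightarrow> (\<forall>x \<in> space M. {x} \<in> null_sets (completion M))"

definition automorphism :: "'a measure \<Rightarrow> ('a \<Rightarrow> 'a) \<Rightarrow> bool" where
  "automorphism M T \<longleftrightarrow>
     bij_betw T (space M) (space M) \<and>
     T \<in> measurable M M \<and> inv_into (space M) T \<in> measurable M M \<and>
     distr M M T = M"

definition dynamical_system :: "'a measure \<Rightarrow> ('a \<Rightarrow> 'a) \<Rightarrow> bool" where
  "dynamical_system M T \<longleftrightarrow>
     sigma_finite_lebesgue_space M \<and> continuous_measure M \<and> emeasure M (space M) = \<infinity> \<and>
     automorphism M T"

definition ergodic :: "'a measure \<Rightarrow> ('a \<Rightarrow> 'a) \<Rightarrow> bool" where
  "ergodic M T \<longleftrightarrow>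
     (\<forall>A \<in> sets M. T -` A \<inter> space M = A \<longrightarrow>
        emeasure M A = 0 \<or> emeasure M (space M - A) = 0)"


section \<open>Joinings\<close>

definition joining ::
  "'a measure \<Rightarrow> ('a \<Rightarrow> 'a) \<Rightarrow> 'b measure \<Rightarrow> ('b \<Rightarrow> 'b) \<Rightarrow> ('a \<times> 'b) measure \<Rightarrow> bool" where
  "joining M T N S J \<longleftrightarrow>
     sets J = sets (M \<Otimes>\<^sub>M N) \<and>
     distr J M fst = M \<and> distr J N snd = N \<and>
     distr J (M \<Otimes>\<^sub>M N) (map_prod T S) = J"

definition strongly_disjoint ::
  "'a measure \<Rightarrow> ('a \<Rightarrow> 'a) \<Rightarrow> 'b measure \<Rightarrow> ('b \<Rightarrow> 'b) \<Rightarrow> bool" where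
  "strongly_disjoint M T N S \<longleftrightarrow>
     \<not> (\<exists>(c1::real) (c2::real) J. 0 < c1 \<and> 0 < c2 \<and>
          joining (scale_measure (ennreal c1) M) T (scale_measure (ennreal c2) N) S J)"


section \<open>The space of measures and Poisson suspensions\<close>

definition measure_space_star :: "'a measure \<Rightarrow> 'a measure measure" where
  "measure_space_star M =
     (SUP A \<in> sets M. vimage_algebra {\<xi>. sets \<xi> = sets M} (\<lambda>\<xi>. emeasure \<xi> A) borel)"

definition map_star :: "'a measure \<Rightarrow> ('a \<Rightarrow> 'a) \<Rightarrow> 'a measure \<Rightarrow> 'a measure" where
  "map_star M T \<xi> = distr \<xi> M T"

text \<open>
  The Poisson weights are written out because the library's \<open>poisson_pmf\<close> is only specified for
  positive rates; with \<open>0 ^ 0 = 1\<close> the formula gives the point mass at \<open>0\<close> for rate \<open>0\<close>.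
\<close>

definition poisson_measure :: "'a measure \<Rightarrow> 'a measure measure \<Rightarrow> bool" where
  "poisson_measure M P \<longleftrightarrow>
     prob_space P \<and> sets P = sets (measure_space_star M) \<and>
     (\<forall>A \<in> sets M. emeasure M A < \<infinity> \<longrightarrow>
        (\<forall>n::nat. measure P {\<xi> \<in> space P. emeasure \<xi> A = of_nat n} =
                    measure M A ^ n / fact n * exp (- measure M A))) \<and>
     (\<forall>(k::nat) A. disjoint_family_on A {..<k} \<longrightarrow>
        (\<forall>i<k. A i \<in> sets M \<and> emeasure M (A i) < \<infinity>) \<longrightarrow>
        prob_space.indep_vars P (\<lambda>_. borel) (\<lambda>i \<xi>. emeasure \<xi> (A i)) {..<k})"


section \<open>Infinite divisibility and Poissonian joinings\<close>

definition measure_add :: "'a measure \<Rightarrow> 'a measure \<Rightarrow> 'a measure \<Rightarrow> 'a measure" where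
  "measure_add M \<xi> \<eta> = measure_of (space M) (sets M) (\<lambda>A. emeasure \<xi> A + emeasure \<eta> A)"

definition pair_add :: "'a measure \<Rightarrow> 'b measure \<Rightarrow>
    ('a measure \<times> 'b measure) \<times> ('a measure \<times> 'b measure) \<Rightarrow> 'a measure \<times> 'b measure" where
  "pair_add M N = (\<lambda>((\<xi>1, \<eta>1), (\<xi>2, \<eta>2)). (measure_add M \<xi>1 \<xi>2, measure_add N \<eta>1 \<eta>2))"

definition pair_star :: "'a measure \<Rightarrow> 'b measure \<Rightarrow> ('a measure \<times> 'b measure) measure" where
  "pair_star M N = measure_space_star M \<Otimes>\<^sub>M measure_space_star N"

definition convolve :: "'a measure \<Rightarrow> 'b measure \<Rightarrow> ('a measure \<times> 'b measure) measure \<Rightarrow>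
    ('a measure \<times> 'b measure) measure \<Rightarrow> ('a measure \<times> 'b measure) measure" where
  "convolve M N \<sigma> \<tau> = distr (\<sigma> \<Otimes>\<^sub>M \<tau>) (pair_star M N) (pair_add M N)"

primrec conv_power :: "'a measure \<Rightarrow> 'b measure \<Rightarrow> ('a measure \<times> 'b measure) measure \<Rightarrow> nat \<Rightarrow>
    ('a measure \<times> 'b measure) measure" where
  "conv_power M N \<sigma> 0 = return (pair_star M N) (null_measure M, null_measure N)"
| "conv_power M N \<sigma> (Suc n) = convolve M N \<sigma> (conv_power M N \<sigma> n)"

definition infinitely_divisible ::
  "'a measure \<Rightarrow> 'b measure \<Rightarrow> ('a measure \<times> 'b measure) measure \<Rightarrow> bool" where
  "infinitely_divisible M N \<rho> \<longleftrightarrow>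
     (\<forall>n\<ge>1. \<exists>\<sigma>. prob_space \<sigma> \<and> sets \<sigma> = sets (pair_star M N) \<and> \<rho> = conv_power M N \<sigma> n)"

text \<open>
  Below, \<open>P\<close> and \<open>Q\<close> are the Poisson measures over \<open>M\<close> and \<open>N\<close>.
\<close>

definition poissonian_joining ::
  "'a measure \<Rightarrow> ('a \<Rightarrow> 'a) \<Rightarrow> 'a measure measure \<Rightarrow>
   'b measure \<Rightarrow> ('b \<Rightarrow> 'b) \<Rightarrow> 'b measure measure \<Rightarrow> ('a measure \<times> 'b measure) measure \<Rightarrow> bool" where
  "poissonian_joining M T P N S Q \<rho> \<longleftrightarrow>
     joining P (map_star M T) Q (map_star N S) \<rho> \<and> infinitely_divisible M N \<rho>"

definition ID_disjoint ::
  "'a measure \<Rightarrow> ('a \<Rightarrow> 'a) \<Rightarrow> 'a measure measure \<Rightarrow>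
   'b measure \<Rightarrow> ('b \<Rightarrow> 'b) \<Rightarrow> 'b measure measure \<Rightarrow> bool" where
  "ID_disjoint M T P N S Q \<longleftrightarrow> {\<rho>. poissonian_joining M T P N S Q \<rho>} = {P \<Otimes>\<^sub>M Q}"


section \<open>Basic facts\<close>

lemma space_measure_space_star: "space (measure_space_star M) = {\<xi>. sets \<xi> = sets M}"
  by (auto simp: measure_space_star_def space_Sup_eq_UN)

lemma measurable_emeasure_star:
  assumes "A \<in> sets M"
  shows "(\<lambda>\<xi>. emeasure \<xi> A) \<in> borel_measurable (measure_space_star M)"
  unfolding measure_space_star_def
  by (rule measurable_Sup1[OF imageI[OF assms]]) (auto intro!: measurable_vimage_algebra1)

lemma measurable_starI:
  assumes "\<And>x. x \<in> space L \<Longrightarrow> sets (K x) = sets M"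
    and "\<And>A. A \<in> sets M \<Longrightarrow> (\<lambda>x. emeasure (K x) A) \<in> borel_measurable L"
  shows "K \<in> measurable L (measure_space_star M)"
  unfolding measure_space_star_def
  by (rule measurable_Sup2) (use assms in \<open>auto intro!: measurable_vimage_algebra2\<close>)

lemma sets_measure_add [simp]: "sets (measure_add M \<xi> \<eta>) = sets M"
  by (simp add: measure_add_def)

lemma emeasure_measure_add:
  assumes "sets \<xi> = sets M" "sets \<eta> = sets M" "A \<in> sets M"
  shows "emeasure (measure_add M \<xi> \<eta>) A = emeasure \<xi> A + emeasure \<eta> A"
proof -
  have "countably_additive (sets M) (\<lambda>A. emeasure \<xi> A + emeasure \<eta> A)"
    unfolding countably_additive_def
  proof safe
    fix A :: "nat \<Rightarrow> 'a set"
    assume A: "range A \<subseteq> sets M" "disjoint_family A"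
    have "(\<Sum>i. emeasure \<xi> (A i) + emeasure \<eta> (A i))
        = (\<Sum>i. emeasure \<xi> (A i)) + (\<Sum>i. emeasure \<eta> (A i))"
      by (simp add: suminf_add)
    also have "\<dots> = emeasure \<xi> (\<Union>(range A)) + emeasure \<eta> (\<Union>(range A))"
      using A assms by (simp add: suminf_emeasure)
    finally show "(\<Sum>i. emeasure \<xi> (A i) + emeasure \<eta> (A i))
        = emeasure \<xi> (\<Union>(range A)) + emeasure \<eta> (\<Union>(range A))" .
  qed
  then show ?thesis
    using assms by (simp add: measure_add_def emeasure_measure_of_sigma sets.sigma_algebra_axioms
        positive_def)
qed

lemma measurable_map_star:
  assumes "T \<in> measurable M M"
  shows "map_star M T \<in> measurable (measure_space_star M) (measure_space_star M)"
proof (rule measurable_starI)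
  fix A assume A: "A \<in> sets M"
  have "emeasure (map_star M T \<xi>) A = emeasure \<xi> (T -` A \<inter> space M)"
    if "\<xi> \<in> space (measure_space_star M)" for \<xi>
  proof -
    have "sets \<xi> = sets M" using that by (simp add: space_measure_space_star)
    then show ?thesis
      using A assms sets_eq_imp_space_eq[of \<xi> M] measurable_cong_sets[of \<xi> M M M]
      by (simp add: map_star_def emeasure_distr)
  qed
  then show "(\<lambda>\<xi>. emeasure (map_star M T \<xi>) A) \<in> borel_measurable (measure_space_star M)"
    using measurable_emeasure_star[OF measurable_sets[OF assms A]]
    by (simp cong: measurable_cong)
qed (simp add: map_star_def)

lemma measurable_pair_add:
  "pair_add M N \<in> measurable (pair_star M N \<Otimes>\<^sub>M pair_star M N) (pair_star M N)"
proof -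
  let ?L = "pair_star M N \<Otimes>\<^sub>M pair_star M N"
  have "(\<lambda>z. measure_add M (fst (fst z)) (fst (snd z))) \<in> measurable ?L (measure_space_star M)"
  proof (rule measurable_starI)
    fix A assume A: "A \<in> sets M"
    note [measurable] = measurable_emeasure_star[OF A]
    have "(\<lambda>z. emeasure (fst (fst z)) A + emeasure (fst (snd z)) A) \<in> borel_measurable ?L"
      unfolding pair_star_def by measurable
    then show "(\<lambda>z. emeasure (measure_add M (fst (fst z)) (fst (snd z))) A) \<in> borel_measurable ?L"
      by (rule measurable_cong[THEN iffD1, rotated])
        (auto simp: emeasure_measure_add A pair_star_def space_pair_measure space_measure_space_star)
  qed simp
  moreover
  have "(\<lambda>z. measure_add N (snd (fst z)) (snd (snd z))) \<in> measurable ?L (measure_space_star N)"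
  proof (rule measurable_starI)
    fix A assume A: "A \<in> sets N"
    note [measurable] = measurable_emeasure_star[OF A]
    have "(\<lambda>z. emeasure (snd (fst z)) A + emeasure (snd (snd z)) A) \<in> borel_measurable ?L"
      unfolding pair_star_def by measurable
    then show "(\<lambda>z. emeasure (measure_add N (snd (fst z)) (snd (snd z))) A) \<in> borel_measurable ?L"
      by (rule measurable_cong[THEN iffD1, rotated])
        (auto simp: emeasure_measure_add A pair_star_def space_pair_measure space_measure_space_star)
  qed simp
  ultimately have "(\<lambda>z. (measure_add M (fst (fst z)) (fst (snd z)),
      measure_add N (snd (fst z)) (snd (snd z)))) \<in> measurable ?L (pair_star M N)"
    unfolding pair_star_def by (rule measurable_Pair)
  then show ?thesis
    by (simp add: pair_add_def split_beta')
qed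

end

theory Submission
  imports Defs
begin

text \<open>
  The link between the two notions of disjointness is the Levy measure. An infinitely divisible law
  of a pair of random measures \<open>(\<xi>, \<eta>)\<close> whose marginals are the Poisson measures over \<open>M\<close> and \<open>N\<close>
  can only have the jumps \<open>(\<delta>\<^sub>x, 0)\<close>, \<open>(0, \<delta>\<^sub>y)\<close> and \<open>(\<delta>\<^sub>x, \<delta>\<^sub>y)\<close>. The intensity of the common jumps
  \<open>(\<delta>\<^sub>x, \<delta>\<^sub>y)\<close> is a measure \<open>J\<close> on the product of the bases whose marginals are at most \<open>M\<close> and \<open>N\<close>;
  it vanishes exactly for the product law, and it is invariant as soon as the law is. So \<open>J\<close> is,
  up to its constants, a joining of the bases.

  From a joining of \<open>c1 M\<close> and \<open>c2 N\<close> to a Poissonian joining: after multiplication with a small constant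
  its marginals are \<open>a M\<close> and \<open>b N\<close> with \<open>a, b \<le> 1\<close>. Superposing independent Poisson processes of common
  jumps with intensity \<open>J\<close> and of single jumps with intensities \<open>(1 - a) M\<close> and \<open>(1 - b) N\<close> restores the
  right marginals (\<open>exists_poissonian_joining\<close>). The outcome is not the product, because its Laplace
  exponent on \<open>A \<times> B\<close> misses a positive multiple of \<open>J (A \<times> B)\<close>
  (\<open>ID_disjoint_imp_strongly_disjoint\<close>).

  From a Poissonian joining \<open>\<rho>\<close> back to the bases, the measure \<open>J\<close> is recovered without a general
  Levy-Khinchine representation as the covariance: \<open>J (A \<times> B) = Cov (\<xi> A, \<eta> B)\<close>. If \<open>\<rho>\<close> is the \<open>n\<close>-th
  convolution power of \<open>\<sigma>\<close>, then the mean of \<open>\<xi> A * \<eta> B\<close> under \<open>\<rho>\<close> is \<open>n\<close> times its mean under \<open>\<sigma>\<close> plus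
  \<open>(1 - 1 / n) M A * N B\<close>. Hence the measure with these mixed moments on rectangles dominates
  \<open>(1 - 1 / n) (M \<Otimes> N)\<close> for every \<open>n\<close>, and \<open>J\<close> is its difference with \<open>M \<Otimes> N\<close>
  (\<open>joining_covariance_measure\<close>). The counts are integers which under \<open>\<sigma>\<close> exceed \<open>1\<close> with probability
  of order \<open>1 / n\<^sup>2\<close> only, so in the limit \<open>J (A \<times> B)\<close> is at most \<open>M A\<close> and at most \<open>N B\<close>
  (\<open>covariance_bounds\<close>). By ergodicity the marginals of \<open>J\<close>, being invariant and dominated, are constant
  multiples of \<open>M\<close> and \<open>N\<close> (\<open>ergodic_dominated_invariant_measure\<close>). Strong disjointness leaves only
  \<open>J = 0\<close>, and then the Laplace transform of \<open>\<rho>\<close> factorizes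
  (\<open>uncorrelated_joining_is_product\<close>).

  All identities between laws of random measures are checked on the functionals
  \<open>exp (- \<xi> A\<^sub>1 - \<dots> - \<xi> A\<^sub>k)\<close> with sets of finite measure; these determine a law
  (\<open>laplace_determines\<close>), turn convolutions into products, and have explicit values for Poisson processes.
\<close>

section \<open>The negative exponential on the extended half-line\<close>

text \<open>
  The value \<open>0\<close> at infinity makes \<open>nexp\<close> a homomorphism from addition to multiplication on all of
  \<open>[0, \<infinity>]\<close>, so no finiteness has to be checked when a random measure is evaluated.
\<close>

definition nexp :: "ennreal \<Rightarrow> ennreal" where
  "nexp x = (if x = \<infinity> then 0 else ennreal (exp (- enn2real x)))"

lemma nexp_ennreal: "0 \<le> r \<Longrightarrow> nexp (ennreal r) = ennreal (exp (- r))"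
  by (simp add: nexp_def)

lemma nexp_0 [simp]: "nexp 0 = 1"
  by (simp add: nexp_def)

lemma nexp_top [simp]: "nexp top = 0"
  by (simp add: nexp_def)

lemma nexp_add: "nexp (x + y) = nexp x * nexp y"
  by (cases x; cases y)
    (auto simp: nexp_ennreal exp_add mult_exp_exp simp flip: ennreal_plus ennreal_mult)

lemma nexp_sum: "nexp (\<Sum>i\<in>I. f i) = (\<Prod>i\<in>I. nexp (f i))"
  by (induction I rule: infinite_finite_induct) (auto simp: nexp_add)

lemma nexp_le_1 [simp]: "nexp x \<le> 1"
  by (cases x) (auto simp: nexp_ennreal simp flip: ennreal_1)

lemma nexp_less_top [simp]: "nexp x < top"
  using nexp_le_1[of x] by (metis ennreal_one_less_top order_le_less_trans)

lemma nexp_less_iff: "nexp x < nexp y \<longleftrightarrow> y < x"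
  by (cases x; cases y) (auto simp: nexp_ennreal ennreal_less_iff)

lemma measurable_nexp [measurable]: "nexp \<in> borel_measurable borel"
  unfolding nexp_def by measurable

lemma enn2real_nexp: "ennreal (enn2real (nexp x)) = nexp x"
  by simp

lemma enn2real_nexp_le_1: "enn2real (nexp x) \<le> 1"
  using enn2real_mono[OF nexp_le_1[of x]] by simp

lemma nexp_tendsto:
  assumes "X \<longlonglongrightarrow> x" "\<And>n. X n \<le> x"
  shows "(\<lambda>n. nexp (X n)) \<longlonglongrightarrow> nexp x"
proof (cases x)
  case (real r)
  then have fin: "X n < top" for n
    using assms(2)[of n] by (auto simp: order_le_less_trans)
  have "(\<lambda>n. enn2real (X n)) \<longlonglongrightarrow> r"
    by (rule tendsto_enn2real) (use assms(1) real in simp_all)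
  then have "(\<lambda>n. ennreal (exp (- enn2real (X n)))) \<longlonglongrightarrow> ennreal (exp (- r))"
    by (intro tendsto_ennrealI tendsto_exp tendsto_minus)
  then show ?thesis
    using fin real by (simp add: nexp_def less_le)
next
  case top
  have "(\<lambda>n. nexp (X n)) \<longlonglongrightarrow> 0"
  proof (rule order_tendstoI)
    fix e :: ennreal assume "0 < e"
    then obtain y where y: "0 < y" "y < e" "y < 1"
      using dense[of 0 "min e 1"] by auto
    define d where "d = enn2real y"
    have "y < top" using y(3) ennreal_one_less_top by (rule less_trans)
    then have "y = ennreal d" "0 \<le> d" by (simp_all add: d_def)
    then have d: "0 < d" "ennreal d < e" "d < 1" using y by simp_all
    have "eventually (\<lambda>n. ennreal (- ln d) < X n) sequentially"
      using assms(1) top order_tendstoD(1) by fastforce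
    then show "eventually (\<lambda>n. nexp (X n) < e) sequentially"
    proof eventually_elim
      case (elim n)
      then have "nexp (X n) < nexp (ennreal (- ln d))" by (simp add: nexp_less_iff)
      also have "\<dots> = ennreal d" using d by (simp add: nexp_ennreal)
      finally show ?case using d by simp
    qed
  qed auto
  then show ?thesis by (simp add: top)
qed

lemma nexp_suminf: "(\<lambda>n. \<Prod>i<n. nexp (f i)) \<longlonglongrightarrow> nexp (\<Sum>i. f i)"
  using nexp_tendsto[of "\<lambda>n. \<Sum>i<n. f i" "\<Sum>i. f i"]
  by (simp add: nexp_sum summable_LIMSEQ sum_le_suminf)

section \<open>Laplace transforms determine a law\<close>

text \<open>
  By the Weierstrass theorem the moments determine the integrals of \<open>U * h (V)\<close> for all continuous
  \<open>h\<close> on \<open>[0, 1]\<close>, and the indicator of \<open>{V > t}\<close> is a bounded limit of such functions.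
\<close>

lemma moments_determine_tail:
  fixes U V :: "'w \<Rightarrow> real"
  assumes fin: "finite_measure \<mu>" "finite_measure \<nu>"
    and U [measurable]: "U \<in> borel_measurable \<mu>" "U \<in> borel_measurable \<nu>"
    and V [measurable]: "V \<in> borel_measurable \<mu>" "V \<in> borel_measurable \<nu>"
    and bU: "\<And>w. 0 \<le> U w" "\<And>w. U w \<le> 1" and bV: "\<And>w. 0 \<le> V w" "\<And>w. V w \<le> 1"
    and mom: "\<And>m::nat. (LINT w|\<mu>. U w * V w ^ m) = (LINT w|\<nu>. U w * V w ^ m)"
  shows "(LINT w|\<mu>. U w * indicator {w. t < V w} w) = (LINT w|\<nu>. U w * indicator {w. t < V w} w)"
proof -
  interpret \<mu>: finite_measure \<mu> by fact
  interpret \<nu>: finite_measure \<nu> by fact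
  have cont: "(LINT w|\<mu>. U w * h (V w)) = (LINT w|\<nu>. U w * h (V w))"
    if h: "continuous_on UNIV h" for h :: "real \<Rightarrow> real"
  proof -
    have [measurable]: "h \<in> borel_measurable borel"
      using h by (rule borel_measurable_continuous_onI)
    have "compact (h ` {0..1})"
      using h by (intro compact_continuous_image continuous_on_subset[OF h]) auto
    then obtain C where C: "\<And>x. x \<in> {0..1} \<Longrightarrow> \<bar>h x\<bar> \<le> C"
      by (metis bounded_real compact_imp_bounded imageI)
    have bnd: "\<bar>U w * y\<bar> \<le> D" if "\<bar>y\<bar> \<le> D" for w y D
      using bU[of w] that mult_left_le_one_le[of "\<bar>y\<bar>" "U w"] by (auto simp: abs_mult)
    have int: "integrable \<mu> (\<lambda>w. U w * h (V w))" "integrable \<nu> (\<lambda>w. U w * h (V w))"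
      using bV C by (auto intro!: \<mu>.integrable_const_bound[where B=C] \<nu>.integrable_const_bound[where B=C] bnd AE_I2)
    have "\<bar>(LINT w|\<mu>. U w * h (V w)) - (LINT w|\<nu>. U w * h (V w))\<bar> \<le> e * (measure \<mu> (space \<mu>) + measure \<nu> (space \<nu>))"
      if e: "0 < e" for e
    proof -
      obtain p where p: "real_polynomial_function p" "\<And>x. x \<in> {0..1} \<Longrightarrow> \<bar>h x - p x\<bar> < e"
        using Stone_Weierstrass_real_polynomial_function[OF compact_Icc[of 0 1] continuous_on_subset[OF h subset_UNIV] e]
        by auto
      then obtain a n where pa: "p = (\<lambda>x. \<Sum>i\<le>n. a i * x ^ i)"
        using real_polynomial_function_iff_sum by blast
      have [measurable]: "p \<in> borel_measurable borel" unfolding pa by measurable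
      have intm: "integrable \<mu> (\<lambda>w. U w * V w ^ i)" "integrable \<nu> (\<lambda>w. U w * V w ^ i)" for i
        using bV by (auto intro!: \<mu>.integrable_const_bound[where B=1] \<nu>.integrable_const_bound[where B=1] bnd AE_I2 simp: power_le_one)
      have Up: "U w * p (V w) = (\<Sum>i\<le>n. a i * (U w * V w ^ i))" for w
        unfolding pa by (simp add: sum_distrib_left mult.left_commute)
      have "(LINT w|\<mu>. U w * p (V w)) = (\<Sum>i\<le>n. a i * (LINT w|\<mu>. U w * V w ^ i))"
        unfolding Up using intm by simp
      moreover have "(LINT w|\<nu>. U w * p (V w)) = (\<Sum>i\<le>n. a i * (LINT w|\<nu>. U w * V w ^ i))"
        unfolding Up using intm by simp
      ultimately have eq: "(LINT w|\<mu>. U w * p (V w)) = (LINT w|\<nu>. U w * p (V w))"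
        by (simp add: mom)
      have intp: "integrable \<mu> (\<lambda>w. U w * p (V w))" "integrable \<nu> (\<lambda>w. U w * p (V w))"
        unfolding Up using intm by auto
      have "\<bar>(LINT w|\<mu>. U w * h (V w)) - (LINT w|\<mu>. U w * p (V w))\<bar> = \<bar>LINT w|\<mu>. U w * (h (V w) - p (V w))\<bar>"
        using int intp by (simp add: right_diff_distrib)
      also have "\<dots> \<le> (LINT w|\<mu>. e)"
        using bV e by (intro integral_abs_bound[THEN order_trans] integral_mono' bnd less_imp_le[OF p(2)]) auto
      finally have 1: "\<bar>(LINT w|\<mu>. U w * h (V w)) - (LINT w|\<mu>. U w * p (V w))\<bar> \<le> e * measure \<mu> (space \<mu>)"
        by (simp add: mult.commute)
      have "\<bar>(LINT w|\<nu>. U w * h (V w)) - (LINT w|\<nu>. U w * p (V w))\<bar> = \<bar>LINT w|\<nu>. U w * (h (V w) - p (V w))\<bar>"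
        using int intp by (simp add: right_diff_distrib)
      also have "\<dots> \<le> (LINT w|\<nu>. e)"
        using bV e by (intro integral_abs_bound[THEN order_trans] integral_mono' bnd less_imp_le[OF p(2)]) auto
      finally have 2: "\<bar>(LINT w|\<nu>. U w * h (V w)) - (LINT w|\<nu>. U w * p (V w))\<bar> \<le> e * measure \<nu> (space \<nu>)"
        by (simp add: mult.commute)
      show ?thesis using 1 2 eq by (simp add: distrib_left)
    qed
    note * = this
    have "((\<lambda>e. e * (measure \<mu> (space \<mu>) + measure \<nu> (space \<nu>))) \<longlongrightarrow> 0 * (measure \<mu> (space \<mu>) + measure \<nu> (space \<nu>))) (at_right 0)"
      by (intro tendsto_intros)
    then have "\<bar>(LINT w|\<mu>. U w * h (V w)) - (LINT w|\<nu>. U w * h (V w))\<bar> \<le> 0"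
      using * by (intro tendsto_lowerbound[of _ 0 "at_right 0"]) (auto simp: eventually_at_filter)
    then show ?thesis by simp
  qed
  \<comment> \<open>Ramps of slope \<open>n\<close> starting at \<open>t\<close>, increasing to the indicator of \<open>x > t\<close>.\<close>
  define h where "h = (\<lambda>(n::nat) (x::real). min 1 (real n * max 0 (x - t)))"
  have hm [measurable]: "h n \<in> borel_measurable borel" for n
    unfolding h_def by measurable
  have hlim: "(\<lambda>n. h n x) \<longlonglongrightarrow> indicator {t<..} x" for x
  proof (cases "t < x")
    case True
    have "eventually (\<lambda>n. h n x = 1) sequentially"
      using eventually_ge_at_top[of "nat \<lceil>1 / (x - t)\<rceil>"]
    proof eventually_elim
      case (elim n)
      then have "1 / (x - t) \<le> real n" by linarith
      then have "1 \<le> real n * (x - t)" using True by (simp add: field_simps)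
      then show ?case using True by (simp add: h_def)
    qed
    then show ?thesis using True by (simp add: tendsto_eventually)
  qed (simp add: h_def)
  have lim: "(\<lambda>n. LINT w|\<kappa>. U w * h n (V w)) \<longlonglongrightarrow> (LINT w|\<kappa>. U w * indicator {t<..} (V w))"
    if "finite_measure \<kappa>" and [measurable]: "U \<in> borel_measurable \<kappa>" "V \<in> borel_measurable \<kappa>" for \<kappa>
  proof -
    interpret finite_measure \<kappa> by fact
    have "\<bar>U w * h n (V w)\<bar> \<le> 1" for n w
      using bU[of w] mult_le_one[of "U w" "h n (V w)"] by (auto simp: h_def abs_mult)
    then show ?thesis
      by (intro integral_dominated_convergence[where w="\<lambda>_. 1"] AE_I2 tendsto_intros hlim) auto
  qed
  have "continuous_on UNIV (h n)" for n
    unfolding h_def by (intro continuous_intros)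
  then have "(LINT w|\<mu>. U w * indicator {t<..} (V w)) = (LINT w|\<nu>. U w * indicator {t<..} (V w))"
    using LIMSEQ_unique[OF lim[OF fin(1)]] lim[OF fin(2)] cont by simp
  then show ?thesis by (simp add: indicator_def)
qed

text \<open>
  The functionals \<open>nexp \<circ> \<Phi>\<close> are closed under multiplication because \<open>H\<close> is closed under addition. So the
  powers of one of them can be absorbed into another one, and the constraints \<open>\<Phi> < r\<close> can be inserted into
  the integrals one after the other; finite systems of constraints form an intersection-stable generator.
\<close>

lemma laplace_determines:
  fixes H :: "('w \<Rightarrow> ennreal) set"
  assumes prob: "prob_space \<mu>" "prob_space \<nu>" and sets: "sets \<mu> = sets \<nu>"
    and gen: "\<And>K. space K = space \<mu> \<Longrightarrow> (\<And>\<Phi>. \<Phi> \<in> H \<Longrightarrow> \<Phi> \<in> borel_measurable K) \<Longrightarrow> sets \<mu> \<subseteq> sets K"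
    and meas: "\<And>\<Phi>. \<Phi> \<in> H \<Longrightarrow> \<Phi> \<in> borel_measurable \<mu>"
    and zero: "(\<lambda>_. 0) \<in> H"
    and add: "\<And>\<Phi> \<Psi>. \<Phi> \<in> H \<Longrightarrow> \<Psi> \<in> H \<Longrightarrow> (\<lambda>w. \<Phi> w + \<Psi> w) \<in> H"
    and eq: "\<And>\<Phi>. \<Phi> \<in> H \<Longrightarrow> (\<integral>\<^sup>+w. nexp (\<Phi> w) \<partial>\<mu>) = (\<integral>\<^sup>+w. nexp (\<Phi> w) \<partial>\<nu>)"
  shows "\<mu> = \<nu>"
proof -
  interpret \<mu>: prob_space \<mu> by fact
  interpret \<nu>: prob_space \<nu> by fact
  have sp: "space \<nu> = space \<mu>" using sets by (metis sets_eq_imp_space_eq)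
  note [measurable_cong] = sets[symmetric]
  define v where "v = (\<lambda>(\<Phi> :: 'w \<Rightarrow> ennreal) w. enn2real (nexp (\<Phi> w)))"
  define C where "C = (\<lambda>(l :: (('w \<Rightarrow> ennreal) \<times> ennreal) list) w. \<Prod>(\<Phi>, r)\<leftarrow>l. indicator {w. \<Phi> w < r} w :: real)"
  have v01: "0 \<le> v \<Phi> w" "v \<Phi> w \<le> 1" for \<Phi> and w :: 'w
    by (auto simp: v_def enn2real_nexp_le_1)
  have vadd: "v (\<lambda>w. \<Phi> w + \<Psi> w) w = v \<Phi> w * v \<Psi> w" for \<Phi> \<Psi> and w :: 'w
    by (simp add: v_def nexp_add enn2real_mult)
  have C_Cons: "C ((\<Phi>, r) # l) w = indicator {w. \<Phi> w < r} w * C l w" for \<Phi> r l and w :: 'w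
    by (simp add: C_def)
  have C01: "0 \<le> C l w" "C l w \<le> 1" for l and w :: 'w
    by (induction l) (auto simp: C_def indicator_def)
  have mv [measurable]: "v \<Phi> \<in> borel_measurable \<mu>" "v \<Phi> \<in> borel_measurable \<nu>" if "\<Phi> \<in> H" for \<Phi>
    using meas[OF that] unfolding v_def by measurable
  have mC: "C l \<in> borel_measurable \<mu>" if "fst ` set l \<subseteq> H" for l
    using that
  proof (induction l)
    case (Cons a l)
    obtain \<Phi> r where a: "a = (\<Phi>, r)" by (cases a)
    have "\<Phi> \<in> H" using Cons.prems a by auto
    then have [measurable]: "\<Phi> \<in> borel_measurable \<mu>" by (rule meas)
    have [measurable]: "C l \<in> borel_measurable \<mu>" using Cons by auto
    show ?case unfolding a C_Cons by measurable
  qed (simp add: C_def)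
  \<comment> \<open>The factor \<open>v \<Psi>\<close> has to stay arbitrary in the induction: it is what absorbs the powers of \<open>v \<Phi>\<close>.\<close>
  have main: "(LINT w|\<mu>. v \<Psi> w * C l w) = (LINT w|\<nu>. v \<Psi> w * C l w)"
    if "\<Psi> \<in> H" "fst ` set l \<subseteq> H" for l \<Psi>
    using that
  proof (induction l arbitrary: \<Psi>)
    case Nil
    have "(LINT w|\<kappa>. v \<Psi> w) = enn2real (\<integral>\<^sup>+w. nexp (\<Psi> w) \<partial>\<kappa>)" if "v \<Psi> \<in> borel_measurable \<kappa>" for \<kappa>
      using that v01 by (subst integral_eq_nn_integral) (auto simp: v_def)
    then show ?case using eq[OF Nil(1)] mv[OF Nil(1)] by (simp add: C_def)
  next
    case (Cons a l)
    obtain \<Phi> r where a: "a = (\<Phi>, r)" by (cases a)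
    have \<Phi>: "\<Phi> \<in> H" using Cons.prems a by auto
    have l: "fst ` set l \<subseteq> H" using Cons.prems by auto
    have [measurable]: "C l \<in> borel_measurable \<mu>" "C l \<in> borel_measurable \<nu>"
      using mC[OF l] measurable_cong_sets[OF sets refl, of borel] by simp_all
    define U where "U w = v \<Psi> w * C l w" for w
    have mU [measurable]: "U \<in> borel_measurable \<mu>" "U \<in> borel_measurable \<nu>"
      unfolding U_def using mv[OF Cons.prems(1)] by measurable
    have pw: "\<exists>\<Psi>'\<in>H. \<forall>w. v \<Psi>' w = v \<Psi> w * v \<Phi> w ^ m" for m
    proof (induction m)
      case (Suc m)
      then obtain \<Psi>' where "\<Psi>' \<in> H" "\<And>w. v \<Psi>' w = v \<Psi> w * v \<Phi> w ^ m" by auto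
      then show ?case using add[OF \<open>\<Psi>' \<in> H\<close> \<Phi>]
        by (intro bexI[of _ "\<lambda>w. \<Psi>' w + \<Phi> w"]) (auto simp: vadd)
    qed (use Cons.prems in auto)
    have "(LINT w|\<mu>. U w * v \<Phi> w ^ m) = (LINT w|\<nu>. U w * v \<Phi> w ^ m)" for m
    proof -
      obtain \<Psi>' where "\<Psi>' \<in> H" "\<And>w. v \<Psi>' w = v \<Psi> w * v \<Phi> w ^ m" using pw by blast
      then show ?thesis using Cons.IH[OF \<open>\<Psi>' \<in> H\<close> l] by (simp add: U_def ac_simps)
    qed
    then have "(LINT w|\<mu>. U w * indicator {w. enn2real (nexp r) < v \<Phi> w} w)
        = (LINT w|\<nu>. U w * indicator {w. enn2real (nexp r) < v \<Phi> w} w)"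
      using v01 C01 mv[OF \<Phi>] mU[unfolded U_def[abs_def]]
      by (intro moments_determine_tail \<mu>.finite_measure_axioms \<nu>.finite_measure_axioms)
        (auto simp: U_def intro: mult_le_one)
    moreover have "enn2real (nexp r) < v \<Phi> w \<longleftrightarrow> \<Phi> w < r" for w
    proof -
      have "enn2real (nexp r) < v \<Phi> w \<longleftrightarrow> ennreal (enn2real (nexp r)) < ennreal (v \<Phi> w)"
        by (simp add: ennreal_less_iff v_def)
      then show ?thesis by (simp add: v_def enn2real_nexp nexp_less_iff)
    qed
    ultimately show ?case by (simp add: a C_Cons U_def ac_simps)
  qed
  define S where "S l = {w \<in> space \<mu>. \<forall>(\<Phi>, r)\<in>set l. \<Phi> w < (r::ennreal)}" for l
  define G where "G = {S l | l. fst ` set l \<subseteq> H}"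
  have C_ind: "C l w = indicator (S l) w" if "w \<in> space \<mu>" for l w
    using that by (induction l) (simp_all add: C_def S_def indicator_def split_beta)
  have SM: "S l \<in> sets \<mu>" if "fst ` set l \<subseteq> H" for l
  proof -
    have "S l \<subseteq> space \<mu>" by (auto simp: S_def)
    then have "S l = {w \<in> space \<mu>. C l w = 1}"
      by (auto simp: C_ind indicator_eq_1_iff)
    then show ?thesis using mC[OF that] by simp
  qed
  have eqS: "emeasure \<mu> (S l) = emeasure \<nu> (S l)" if l: "fst ` set l \<subseteq> H" for l
  proof -
    have "(LINT w|\<mu>. C l w) = measure \<mu> (S l)"
      using SM[OF l] by (simp add: C_ind cong: Bochner_Integration.integral_cong)
    moreover have "(LINT w|\<nu>. C l w) = measure \<nu> (S l)"
    proof -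
      have "S l \<in> sets \<nu>" using SM[OF l] unfolding sets .
      moreover have "(LINT w|\<nu>. C l w) = (LINT w|\<nu>. indicator (S l) w)"
        by (rule Bochner_Integration.integral_cong) (simp_all add: C_ind sp)
      ultimately show ?thesis by simp
    qed
    moreover have "(LINT w|\<mu>. C l w) = (LINT w|\<nu>. C l w)"
      using main[OF zero l] by (simp add: v_def)
    ultimately show ?thesis by (simp add: \<mu>.emeasure_eq_measure \<nu>.emeasure_eq_measure)
  qed
  have Gsub: "G \<subseteq> Pow (space \<mu>)" by (auto simp: G_def S_def)
  have "sets \<mu> \<subseteq> sets (sigma (space \<mu>) G)"
  proof (rule gen)
    fix \<Phi> assume "\<Phi> \<in> H"
    show "\<Phi> \<in> borel_measurable (sigma (space \<mu>) G)"
    proof (rule borel_measurableI_less)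
      fix r
      have "{w \<in> space \<mu>. \<Phi> w < r} \<in> G"
        using \<open>\<Phi> \<in> H\<close> unfolding G_def S_def by (auto intro!: exI[of _ "[(\<Phi>, r)]"])
      then show "{w \<in> space (sigma (space \<mu>) G). \<Phi> w < r} \<in> sets (sigma (space \<mu>) G)"
        using Gsub by (simp add: space_measure_of sets_measure_of)
    qed
  qed (simp add: space_measure_of[OF Gsub])
  moreover have "sigma_sets (space \<mu>) G \<subseteq> sets \<mu>"
    using SM by (intro sets.sigma_sets_subset) (auto simp: G_def)
  ultimately have gen_sets: "sets \<mu> = sigma_sets (space \<mu>) G"
    using Gsub by (auto simp: sets_measure_of)
  have Int: "Int_stable G"
  proof (rule Int_stableI)
    fix a b assume "a \<in> G" "b \<in> G"
    then obtain k l where "a = S k" "b = S l" "fst ` set k \<subseteq> H" "fst ` set l \<subseteq> H" by (auto simp: G_def)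
    moreover have "S k \<inter> S l = S (k @ l)" by (auto simp: S_def)
    moreover have "fst ` set (k @ l) \<subseteq> H" using calculation by (simp add: image_Un)
    ultimately show "a \<inter> b \<in> G" unfolding G_def by blast
  qed
  show ?thesis
  proof (rule measure_eqI_generator_eq[OF Int Gsub, where A="\<lambda>_. S []"])
    show "range (\<lambda>_. S []) \<subseteq> G" by (auto simp: G_def intro!: exI[of _ "[]"])
    show "emeasure \<mu> X = emeasure \<nu> X" if "X \<in> G" for X
      using that eqS by (auto simp: G_def)
  qed (use gen_sets sets sp \<mu>.emeasure_finite in \<open>auto simp: S_def\<close>)
qed

section \<open>Masses of random measures, Laplace functionals and convolution\<close>

definition finite_sets :: "'a measure \<Rightarrow> 'a set set" where
  "finite_sets M = {A \<in> sets M. emeasure M A < \<infinity>}"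

text \<open>
  Lists instead of sets allow repetitions: together with concatenation they give all nonnegative
  integer combinations of indicators, which makes the family of functionals closed under addition.
\<close>

definition mass :: "'a set list \<Rightarrow> 'a measure \<Rightarrow> ennreal" where
  "mass As \<xi> = (\<Sum>A\<leftarrow>As. emeasure \<xi> A)"

definition mass2 :: "'a set list \<Rightarrow> 'b set list \<Rightarrow> 'a measure \<times> 'b measure \<Rightarrow> ennreal" where
  "mass2 As Bs p = mass As (fst p) + mass Bs (snd p)"

definition laplace :: "'a set list \<Rightarrow> 'b set list \<Rightarrow> ('a measure \<times> 'b measure) measure \<Rightarrow> ennreal" where
  "laplace As Bs \<rho> = (\<integral>\<^sup>+p. nexp (mass2 As Bs p) \<partial>\<rho>)"

lemma mass_simps [simp]: "mass [] \<xi> = 0" "mass (A # As) \<xi> = emeasure \<xi> A + mass As \<xi>"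
  "mass (As @ As') \<xi> = mass As \<xi> + mass As' \<xi>"
  by (simp_all add: mass_def)

lemma measurable_domain_cong: "f \<in> measurable L K \<Longrightarrow> sets L' = sets L \<Longrightarrow> f \<in> measurable L' K"
  by (simp cong: measurable_cong_sets)

lemma finite_setsD: "A \<in> finite_sets M \<Longrightarrow> A \<in> sets M" "A \<in> finite_sets M \<Longrightarrow> emeasure M A < \<infinity>"
  by (simp_all add: finite_sets_def)

lemma empty_finite_sets: "{} \<in> finite_sets M"
  by (simp add: finite_sets_def)

lemma finite_sets_subset: "finite_sets M \<subseteq> sets M"
  by (auto simp: finite_sets_def)

lemma measurable_mass:
  "set As \<subseteq> sets M \<Longrightarrow> mass As \<in> borel_measurable (measure_space_star M)"
  unfolding mass_def[abs_def] by (induction As) (simp_all add: measurable_emeasure_star borel_measurable_add)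

lemma measurable_mass2:
  assumes "set As \<subseteq> sets M" "set Bs \<subseteq> sets N"
  shows "mass2 As Bs \<in> borel_measurable (pair_star M N)"
proof -
  note [measurable] = measurable_mass[OF assms(1)] measurable_mass[OF assms(2)]
  show ?thesis unfolding mass2_def[abs_def] pair_star_def by measurable
qed

lemma space_pair_star: "space (pair_star M N) = {\<xi>. sets \<xi> = sets M} \<times> {\<eta>. sets \<eta> = sets N}"
  by (simp add: pair_star_def space_pair_measure space_measure_space_star)

lemma measurable_star_finite_setsI:
  assumes M: "sigma_finite_measure M"
    and s: "\<And>x. x \<in> space K \<Longrightarrow> sets (f x) = sets M"
    and m: "\<And>A. A \<in> finite_sets M \<Longrightarrow> (\<lambda>x. emeasure (f x) A) \<in> borel_measurable K"
  shows "f \<in> measurable K (measure_space_star M)"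
proof (rule measurable_starI[OF s])
  fix A assume A: "A \<in> sets M"
  obtain X :: "nat \<Rightarrow> _" where X: "range X \<subseteq> sets M" "(\<Union>i. X i) = space M"
      "\<And>i. emeasure M (X i) \<noteq> \<infinity>" "disjoint_family X"
    using sigma_finite_measure.sigma_finite_disjoint[OF M] by metis
  have "A \<inter> X i \<in> finite_sets M" for i
  proof -
    have "emeasure M (A \<inter> X i) \<le> emeasure M (X i)" using X(1) by (intro emeasure_mono) auto
    then have "emeasure M (A \<inter> X i) < \<infinity>" using X(3)[of i] by (auto simp: less_top top.extremum_uniqueI)
    then show ?thesis using X(1) A by (auto simp: finite_sets_def)
  qed
  then have mm: "(\<lambda>x. \<Sum>i. emeasure (f x) (A \<inter> X i)) \<in> borel_measurable K"
    by (intro borel_measurable_suminf_order m)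
  have "emeasure (f x) A = (\<Sum>i. emeasure (f x) (A \<inter> X i))" if "x \<in> space K" for x
  proof -
    have "(\<Union>i. A \<inter> X i) = A" using X(2) sets.sets_into_space[OF A] by auto
    moreover have "disjoint_family (\<lambda>i. A \<inter> X i)"
      using X(4) by (auto simp: disjoint_family_on_def)
    moreover have "range (\<lambda>i. A \<inter> X i) \<subseteq> sets (f x)"
      using X(1) A s[OF that] by auto
    ultimately show ?thesis using suminf_emeasure[of "\<lambda>i. A \<inter> X i" "f x"] by simp
  qed
  then show "(\<lambda>x. emeasure (f x) A) \<in> borel_measurable K"
    using mm by (simp cong: measurable_cong)
qed

lemma sets_le_if_measurable_id:
  assumes "(\<lambda>x. x) \<in> measurable K L" "space K = space L"
  shows "sets L \<subseteq> sets K"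
proof
  fix B assume B: "B \<in> sets L"
  have "(\<lambda>x. x) -` B \<inter> space K = B" using sets.sets_into_space[OF B] assms(2) by auto
  then show "B \<in> sets K" using measurable_sets[OF assms(1) B] by simp
qed

text \<open>
  Only sets of finite measure are tested. Since \<open>M\<close> is sigma-finite, the mass of any set is a countable
  sum of masses of such sets, so these generate the sigma-algebra on the space of measures.
\<close>

lemma star_eqI:
  assumes M: "sigma_finite_measure M" and "prob_space \<mu>" "prob_space \<nu>"
    and s: "sets \<mu> = sets (measure_space_star M)" "sets \<nu> = sets (measure_space_star M)"
    and eq: "\<And>As. set As \<subseteq> finite_sets M \<Longrightarrow> (\<integral>\<^sup>+\<xi>. nexp (mass As \<xi>) \<partial>\<mu>) = (\<integral>\<^sup>+\<xi>. nexp (mass As \<xi>) \<partial>\<nu>)"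
  shows "\<mu> = \<nu>"
proof (rule laplace_determines[where H="mass ` {As. set As \<subseteq> finite_sets M}"])
  have sp: "space \<mu> = space (measure_space_star M)" using s(1) by (rule sets_eq_imp_space_eq)
  show "sets \<mu> = sets \<nu>" using s by simp
  fix \<Phi> assume "\<Phi> \<in> mass ` {As. set As \<subseteq> finite_sets M}"
  then obtain As where As: "\<Phi> = mass As" "set As \<subseteq> finite_sets M" by auto
  then show "\<Phi> \<in> borel_measurable \<mu>"
    using measurable_domain_cong[OF measurable_mass s(1)] finite_sets_subset[of M] by (metis order_trans)
  show "(\<integral>\<^sup>+w. nexp (\<Phi> w) \<partial>\<mu>) = (\<integral>\<^sup>+w. nexp (\<Phi> w) \<partial>\<nu>)"
    unfolding As using As(2) by (rule eq)
  fix \<Psi> assume "\<Psi> \<in> mass ` {As. set As \<subseteq> finite_sets M}"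
  then obtain Bs where "\<Psi> = mass Bs" "set Bs \<subseteq> finite_sets M" by auto
  then show "(\<lambda>w. \<Phi> w + \<Psi> w) \<in> mass ` {As. set As \<subseteq> finite_sets M}"
    using As by (intro image_eqI[of _ _ "As @ Bs"]) auto
next
  show "(\<lambda>_. 0) \<in> mass ` {As. set As \<subseteq> finite_sets M}"
    by (intro image_eqI[of _ _ "[]"]) auto
next
  have sp: "space \<mu> = space (measure_space_star M)" using s(1) by (rule sets_eq_imp_space_eq)
  fix K :: "'a measure measure"
  assume K: "space K = space \<mu>" "\<And>\<Phi>. \<Phi> \<in> mass ` {As. set As \<subseteq> finite_sets M} \<Longrightarrow> \<Phi> \<in> borel_measurable K"
  have "(\<lambda>x. x) \<in> measurable K (measure_space_star M)"
  proof (rule measurable_star_finite_setsI[OF M])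
    fix A assume "A \<in> finite_sets M"
    then have "mass [A] \<in> borel_measurable K" by (intro K(2)) auto
    then show "(\<lambda>x. emeasure x A) \<in> borel_measurable K"
      by (simp add: mass_def[abs_def])
  qed (simp add: K sp space_measure_space_star)
  then show "sets \<mu> \<subseteq> sets K"
    unfolding s by (rule sets_le_if_measurable_id) (simp add: K sp)
qed fact+

lemma pair_star_eqI:
  assumes M: "sigma_finite_measure M" and N: "sigma_finite_measure N" and "prob_space \<mu>" "prob_space \<nu>"
    and s: "sets \<mu> = sets (pair_star M N)" "sets \<nu> = sets (pair_star M N)"
    and eq: "\<And>As Bs. set As \<subseteq> finite_sets M \<Longrightarrow> set Bs \<subseteq> finite_sets N \<Longrightarrow> laplace As Bs \<mu> = laplace As Bs \<nu>"
  shows "\<mu> = \<nu>"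
proof (rule laplace_determines[where H="{mass2 As Bs | As Bs. set As \<subseteq> finite_sets M \<and> set Bs \<subseteq> finite_sets N}"])
  show "sets \<mu> = sets \<nu>" using s by simp
  fix \<Phi> assume "\<Phi> \<in> {mass2 As Bs | As Bs. set As \<subseteq> finite_sets M \<and> set Bs \<subseteq> finite_sets N}"
  then obtain As Bs where As: "\<Phi> = mass2 As Bs" "set As \<subseteq> finite_sets M" "set Bs \<subseteq> finite_sets N" by auto
  then show "\<Phi> \<in> borel_measurable \<mu>"
    using measurable_domain_cong[OF measurable_mass2 s(1)] finite_sets_subset[of M] finite_sets_subset[of N]
    by (metis order_trans)
  show "(\<integral>\<^sup>+w. nexp (\<Phi> w) \<partial>\<mu>) = (\<integral>\<^sup>+w. nexp (\<Phi> w) \<partial>\<nu>)"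
    unfolding As using eq[OF As(2,3)] by (simp add: laplace_def)
  fix \<Psi> assume "\<Psi> \<in> {mass2 As Bs | As Bs. set As \<subseteq> finite_sets M \<and> set Bs \<subseteq> finite_sets N}"
  then obtain As' Bs' where "\<Psi> = mass2 As' Bs'" "set As' \<subseteq> finite_sets M" "set Bs' \<subseteq> finite_sets N" by auto
  moreover from this have "(\<lambda>w. \<Phi> w + \<Psi> w) = mass2 (As @ As') (Bs @ Bs')"
    by (auto simp: As mass2_def ac_simps)
  moreover have "set (As @ As') \<subseteq> finite_sets M" "set (Bs @ Bs') \<subseteq> finite_sets N"
    unfolding set_append using As(2,3) calculation(2,3) by blast+
  ultimately show "(\<lambda>w. \<Phi> w + \<Psi> w) \<in> {mass2 As Bs | As Bs. set As \<subseteq> finite_sets M \<and> set Bs \<subseteq> finite_sets N}"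
    by blast
next
  have "(\<lambda>_. 0) = mass2 ([] :: 'a set list) ([] :: 'b set list)" by (auto simp: mass2_def)
  then show "(\<lambda>_. 0) \<in> {mass2 As Bs | As Bs. set As \<subseteq> finite_sets M \<and> set Bs \<subseteq> finite_sets N}"
    by (intro CollectI exI[of _ "[]"]) simp
next
  have sp: "space \<mu> = space (pair_star M N)" using s(1) by (rule sets_eq_imp_space_eq)
  fix K :: "('a measure \<times> 'b measure) measure"
  assume K: "space K = space \<mu>" "\<And>\<Phi>. \<Phi> \<in> {mass2 As Bs | As Bs. set As \<subseteq> finite_sets M \<and> set Bs \<subseteq> finite_sets N} \<Longrightarrow> \<Phi> \<in> borel_measurable K"
  have "fst \<in> measurable K (measure_space_star M)"
  proof (rule measurable_star_finite_setsI[OF M])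
    fix A assume "A \<in> finite_sets M"
    then have "mass2 [A] [] \<in> borel_measurable K" by (intro K(2)) force
    then show "(\<lambda>x. emeasure (fst x) A) \<in> borel_measurable K"
      by (simp add: mass2_def[abs_def])
  qed (auto simp add: K sp space_pair_star)
  moreover have "snd \<in> measurable K (measure_space_star N)"
  proof (rule measurable_star_finite_setsI[OF N])
    fix B assume "B \<in> finite_sets N"
    then have "mass2 [] [B] \<in> borel_measurable K" by (intro K(2)) force
    then show "(\<lambda>x. emeasure (snd x) B) \<in> borel_measurable K"
      by (simp add: mass2_def[abs_def])
  qed (auto simp add: K sp space_pair_star)
  ultimately have "(\<lambda>x. x) \<in> measurable K (pair_star M N)"
    unfolding pair_star_def by (simp add: measurable_pair_iff comp_def)
  then show "sets \<mu> \<subseteq> sets K"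
    unfolding s by (rule sets_le_if_measurable_id) (simp add: K sp)
qed fact+

lemma mass_measure_add:
  assumes "set As \<subseteq> sets M" "sets \<xi> = sets M" "sets \<eta> = sets M"
  shows "mass As (measure_add M \<xi> \<eta>) = mass As \<xi> + mass As \<eta>"
  using assms by (induction As) (auto simp: emeasure_measure_add ac_simps)

lemma mass2_pair_add:
  assumes "set As \<subseteq> sets M" "set Bs \<subseteq> sets N" "p \<in> space (pair_star M N)" "q \<in> space (pair_star M N)"
  shows "mass2 As Bs (pair_add M N (p, q)) = mass2 As Bs p + mass2 As Bs q"
  using assms by (auto simp: mass2_def pair_add_def split_beta space_pair_star mass_measure_add ac_simps)

lemma prob_space_convolve:
  assumes "prob_space \<sigma>" "prob_space \<tau>" "sets \<sigma> = sets (pair_star M N)" "sets \<tau> = sets (pair_star M N)"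
  shows "prob_space (convolve M N \<sigma> \<tau>)"
proof -
  interpret \<sigma>: prob_space \<sigma> by fact
  interpret \<tau>: prob_space \<tau> by fact
  interpret pair_prob_space \<sigma> \<tau> ..
  have "pair_add M N \<in> measurable (\<sigma> \<Otimes>\<^sub>M \<tau>) (pair_star M N)"
    using measurable_pair_add by (rule measurable_domain_cong) (rule sets_pair_measure_cong[OF assms(3,4)])
  then show ?thesis unfolding convolve_def by (rule prob_space_distr)
qed

lemma sets_convolve [simp]: "sets (convolve M N \<sigma> \<tau>) = sets (pair_star M N)"
  by (simp add: convolve_def)

lemma nn_integral_convolve:
  assumes "prob_space \<tau>" "sets \<sigma> = sets (pair_star M N)" "sets \<tau> = sets (pair_star M N)"
    and f: "f \<in> borel_measurable (pair_star M N)"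
  shows "(\<integral>\<^sup>+p. f p \<partial>convolve M N \<sigma> \<tau>) = (\<integral>\<^sup>+p. \<integral>\<^sup>+q. f (pair_add M N (p, q)) \<partial>\<tau> \<partial>\<sigma>)"
proof -
  interpret \<tau>: prob_space \<tau> by fact
  have m: "pair_add M N \<in> measurable (\<sigma> \<Otimes>\<^sub>M \<tau>) (pair_star M N)"
    using measurable_pair_add by (rule measurable_domain_cong) (rule sets_pair_measure_cong[OF assms(2,3)])
  have m2: "(\<lambda>z. f (pair_add M N z)) \<in> borel_measurable (\<sigma> \<Otimes>\<^sub>M \<tau>)"
    using measurable_compose[OF m f] .
  show ?thesis
    unfolding convolve_def nn_integral_distr[OF m measurable_domain_cong[OF f sets_distr]]
      \<tau>.nn_integral_fst[OF m2, symmetric] ..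
qed

text \<open>
  Masses are additive in the random measure and \<open>nexp\<close> is multiplicative.
\<close>

lemma laplace_convolve:
  assumes "prob_space \<tau>" and s: "sets \<sigma> = sets (pair_star M N)" "sets \<tau> = sets (pair_star M N)"
    and AB: "set As \<subseteq> sets M" "set Bs \<subseteq> sets N"
  shows "laplace As Bs (convolve M N \<sigma> \<tau>) = laplace As Bs \<sigma> * laplace As Bs \<tau>"
proof -
  have m: "(\<lambda>p. nexp (mass2 As Bs p)) \<in> borel_measurable (pair_star M N)"
    using measurable_compose[OF measurable_mass2[OF AB] measurable_nexp] .
  have m': "(\<lambda>p. nexp (mass2 As Bs p)) \<in> borel_measurable \<sigma>" "(\<lambda>p. nexp (mass2 As Bs p)) \<in> borel_measurable \<tau>"
    using measurable_domain_cong[OF m s(1)] measurable_domain_cong[OF m s(2)] .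
  have sp: "space \<sigma> = space (pair_star M N)" "space \<tau> = space (pair_star M N)"
    using s by (auto dest: sets_eq_imp_space_eq)
  have "laplace As Bs (convolve M N \<sigma> \<tau>) = (\<integral>\<^sup>+p. \<integral>\<^sup>+q. nexp (mass2 As Bs (pair_add M N (p, q))) \<partial>\<tau> \<partial>\<sigma>)"
    unfolding laplace_def by (rule nn_integral_convolve) (fact assms m)+
  also have "\<dots> = (\<integral>\<^sup>+p. \<integral>\<^sup>+q. nexp (mass2 As Bs p) * nexp (mass2 As Bs q) \<partial>\<tau> \<partial>\<sigma>)"
    by (intro nn_integral_cong) (simp add: mass2_pair_add[OF AB] sp nexp_add)
  also have "\<dots> = laplace As Bs \<sigma> * laplace As Bs \<tau>"
    by (simp add: laplace_def nn_integral_cmult nn_integral_multc m')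
  finally show ?thesis .
qed

lemma null_pair_in_space: "(null_measure M, null_measure N) \<in> space (pair_star M N)"
  by (simp add: space_pair_star)

lemma mass_null_measure [simp]: "mass As (null_measure M) = 0"
  by (induction As) auto

lemma conv_power_prob:
  assumes "prob_space \<sigma>" "sets \<sigma> = sets (pair_star M N)"
  shows "prob_space (conv_power M N \<sigma> n)" "sets (conv_power M N \<sigma> n) = sets (pair_star M N)"
proof -
  have "prob_space (conv_power M N \<sigma> n) \<and> sets (conv_power M N \<sigma> n) = sets (pair_star M N)"
  proof (induction n)
    case 0
    then show ?case using prob_space_return[OF null_pair_in_space] by simp
  next
    case (Suc n)
    then show ?case using prob_space_convolve assms by auto
  qed
  then show "prob_space (conv_power M N \<sigma> n)" "sets (conv_power M N \<sigma> n) = sets (pair_star M N)" by auto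
qed

lemma laplace_conv_power:
  assumes "prob_space \<sigma>" "sets \<sigma> = sets (pair_star M N)" "set As \<subseteq> sets M" "set Bs \<subseteq> sets N"
  shows "laplace As Bs (conv_power M N \<sigma> n) = laplace As Bs \<sigma> ^ n"
proof (induction n)
  case 0
  have "(\<lambda>p. nexp (mass2 As Bs p)) \<in> borel_measurable (pair_star M N)"
    using measurable_compose[OF measurable_mass2[OF assms(3,4)] measurable_nexp] .
  then show ?case
    by (simp add: laplace_def nn_integral_return[OF null_pair_in_space]) (simp add: mass2_def)
next
  case (Suc n)
  then show ?case
    by (simp add: laplace_convolve[OF conv_power_prob(1)[OF assms(1,2)] assms(2) conv_power_prob(2)[OF assms(1,2)] assms(3,4)])
qed

section \<open>Poisson measures\<close>

definition cover_count :: "'a set list \<Rightarrow> 'a \<Rightarrow> ennreal" where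
  "cover_count As x = (\<Sum>A\<leftarrow>As. indicator A x)"

lemma cover_count_simps [simp]: "cover_count [] x = 0"
  "cover_count (A # As) x = indicator A x + cover_count As x"
  by (simp_all add: cover_count_def)

lemma measurable_cover_count:
  "set As \<subseteq> sets M \<Longrightarrow> cover_count As \<in> borel_measurable M"
  unfolding cover_count_def[abs_def] by (induction As) auto

lemma mass_eq_nn_integral:
  assumes "set As \<subseteq> sets \<xi>"
  shows "mass As \<xi> = (\<integral>\<^sup>+x. cover_count As x \<partial>\<xi>)"
  using assms
proof (induction As)
  case (Cons A As)
  then have "cover_count As \<in> borel_measurable \<xi>" by (intro measurable_cover_count) auto
  then show ?case using Cons by (simp, subst nn_integral_add) auto
qed (simp add: cover_count_def[abs_def])

text \<open>
  The sets on which exactly \<open>m + 1\<close> members of the list overlap. They are disjoint, which is what the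
  independence in the definition of a Poisson measure asks for. Multiplicity \<open>0\<close> is left out: its set
  may have infinite measure and does not contribute.
\<close>

definition multiplicity_set :: "'a measure \<Rightarrow> 'a set list \<Rightarrow> nat \<Rightarrow> 'a set" where
  "multiplicity_set M As m = {x \<in> space M. cover_count As x = of_nat (Suc m)}"

lemma cover_count_nat: "\<exists>n\<le>length As. cover_count As x = of_nat n"
proof (induction As)
  case (Cons A As)
  then obtain n where n: "n \<le> length As" "cover_count As x = of_nat n" by auto
  show ?case
  proof (cases "x \<in> A")
    case True
    then show ?thesis using n by (intro exI[of _ "Suc n"]) simp
  next
    case False
    then show ?thesis using n by (intro exI[of _ n]) simp
  qed
qed simp

text \<open>
  Every function of the number of overlapping sets is a simple function over the multiplicity sets.
\<close>

lemma fun_cover_count: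
  assumes "x \<in> space M" "h 0 = (0::ennreal)"
  shows "h (cover_count As x) = (\<Sum>m<length As. h (of_nat (Suc m)) * indicator (multiplicity_set M As m) x)"
proof -
  obtain n where n: "n \<le> length As" "cover_count As x = of_nat n"
    using cover_count_nat[of As x] by (elim exE conjE)
  have "(\<Sum>m<length As. h (of_nat (Suc m)) * indicator (multiplicity_set M As m) x)
      = (\<Sum>m<length As. if Suc m = n then h (of_nat n) else 0)"
    using assms(1) n(2) by (intro sum.cong) (auto simp: multiplicity_set_def indicator_def simp del: of_nat_Suc)
  also have "\<dots> = h (of_nat n)"
  proof (cases n)
    case (Suc m)
    then show ?thesis using n(1) by (simp add: sum.delta del: of_nat_Suc)
  qed (simp add: assms)
  finally show ?thesis using n by simp
qed

lemma multiplicity_set_sets: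
  assumes "set As \<subseteq> sets M"
  shows "multiplicity_set M As m \<in> sets M"
  unfolding multiplicity_set_def using measurable_cover_count[OF assms] by measurable

lemma nn_integral_fun_cover_count:
  assumes "set As \<subseteq> sets M" "sets \<xi> = sets M" "h 0 = (0::ennreal)"
  shows "(\<integral>\<^sup>+x. h (cover_count As x) \<partial>\<xi>) = (\<Sum>m<length As. h (of_nat (Suc m)) * emeasure \<xi> (multiplicity_set M As m))"
proof -
  have s: "multiplicity_set M As m \<in> sets \<xi>" for m
    using multiplicity_set_sets[OF assms(1)] assms(2) by simp
  have "(\<integral>\<^sup>+x. h (cover_count As x) \<partial>\<xi>)
      = (\<integral>\<^sup>+x. (\<Sum>m<length As. h (of_nat (Suc m)) * indicator (multiplicity_set M As m) x) \<partial>\<xi>)"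
    using sets_eq_imp_space_eq[OF assms(2)] assms(3) by (intro nn_integral_cong fun_cover_count) auto
  also have "\<dots> = (\<Sum>m<length As. h (of_nat (Suc m)) * emeasure \<xi> (multiplicity_set M As m))"
    using s by (subst nn_integral_sum) (auto simp: nn_integral_cmult_indicator)
  finally show ?thesis .
qed

lemma multiplicity_set_finite:
  assumes "set As \<subseteq> finite_sets M"
  shows "multiplicity_set M As m \<in> finite_sets M"
proof -
  have As: "set As \<subseteq> sets M" using assms finite_sets_subset by blast
  have "emeasure M (multiplicity_set M As m) \<le> emeasure M (\<Union>(set As))"
  proof (rule emeasure_mono)
    show "multiplicity_set M As m \<subseteq> \<Union>(set As)"
    proof
      fix x assume "x \<in> multiplicity_set M As m"
      then have "cover_count As x \<noteq> 0" by (auto simp: multiplicity_set_def)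
      then show "x \<in> \<Union>(set As)" by (induction As) (auto simp: indicator_def split: if_splits)
    qed
    show "\<Union>(set As) \<in> sets M" using As by (intro sets.finite_Union) auto
  qed
  also have "\<dots> \<le> (\<Sum>A\<in>set As. emeasure M A)"
    using emeasure_subadditive_finite[of "set As" "\<lambda>A. A" M] As by auto
  also have "\<dots> < \<infinity>"
    using assms by (auto simp: finite_sets_def)
  finally show ?thesis
    using multiplicity_set_sets[OF As] by (simp add: finite_sets_def)
qed

context
  fixes M :: "'a measure" and P :: "'a measure measure"
  assumes P: "poisson_measure M P"
begin

lemma poisson_prob: "prob_space P"
  and poisson_sets: "sets P = sets (measure_space_star M)"
  using P by (auto simp: poisson_measure_def)

lemma poisson_measurable_mass: "set As \<subseteq> sets M \<Longrightarrow> mass As \<in> borel_measurable P"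
  by (rule measurable_domain_cong[OF measurable_mass poisson_sets])

lemma poisson_measurable_emeasure: "A \<in> sets M \<Longrightarrow> (\<lambda>\<xi>. emeasure \<xi> A) \<in> borel_measurable P"
  by (rule measurable_domain_cong[OF measurable_emeasure_star poisson_sets])

lemma poisson_space: "\<xi> \<in> space P \<Longrightarrow> sets \<xi> = sets M"
  using sets_eq_imp_space_eq[OF poisson_sets] by (simp add: space_measure_space_star)

text \<open>
  The Poisson weights sum to \<open>1\<close>, so the prescribed atoms exhaust the distribution of the count: it is an
  integer almost surely, and integrals against its law are series.
\<close>

lemma
  assumes A: "A \<in> finite_sets M"
  shows poisson_nn_integral: "h \<in> borel_measurable borel \<Longrightarrow> (\<integral>\<^sup>+\<xi>. h (emeasure \<xi> A) \<partial>P) =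
      (\<Sum>n. h (of_nat n) * ennreal (measure M A ^ n / fact n * exp (- measure M A)))"
    and poisson_AE_nat: "AE \<xi> in P. \<exists>n. emeasure \<xi> A = of_nat n"
proof -
  interpret prob_space P by (rule poisson_prob)
  let ?l = "measure M A"
  have AM: "A \<in> sets M" using A by (rule finite_setsD)
  note [measurable] = poisson_measurable_emeasure[OF AM]
  define E where "E n = {\<xi> \<in> space P. emeasure \<xi> A = of_nat n}" for n
  have E [measurable]: "E n \<in> sets P" for n unfolding E_def by measurable
  have pE: "prob (E n) = ?l ^ n / fact n * exp (- ?l)" for n
    using P A by (auto simp: poisson_measure_def E_def finite_sets_def)
  have dis: "disjoint_family E" by (auto simp: disjoint_family_on_def E_def)
  have "(\<lambda>n. ?l ^ n / fact n * exp (- ?l)) sums (exp ?l * exp (- ?l))"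
    using exp_converges[of ?l] by (intro sums_mult2) (simp add: divide_inverse mult.commute)
  then have "(\<lambda>n. prob (E n)) sums 1" by (simp add: pE mult_exp_exp)
  moreover have "(\<lambda>n. prob (E n)) sums prob (\<Union>n. E n)"
    using E dis by (intro finite_measure_UNION) auto
  ultimately have "prob (\<Union>n. E n) = 1" using sums_unique2 by blast
  then have AE: "AE \<xi> in P. \<xi> \<in> (\<Union>n. E n)"
    using E by (subst AE_in_set_eq_1) auto
  then show "AE \<xi> in P. \<exists>n. emeasure \<xi> A = of_nat n"
    by eventually_elim (auto simp: E_def)
  assume [measurable]: "h \<in> borel_measurable borel"
  have "(\<integral>\<^sup>+\<xi>. h (emeasure \<xi> A) \<partial>P) = (\<integral>\<^sup>+\<xi>. (\<Sum>n. h (of_nat n) * indicator (E n) \<xi>) \<partial>P)"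
  proof (rule nn_integral_cong_AE)
    show "AE \<xi> in P. h (emeasure \<xi> A) = (\<Sum>n. h (of_nat n) * indicator (E n) \<xi>)"
      using AE
    proof eventually_elim
      case (elim \<xi>)
      then obtain m where m: "\<xi> \<in> E m" by auto
      have "(\<Sum>n. h (of_nat n) * indicator (E n) \<xi>) = (\<Sum>n\<in>{m}. h (of_nat n) * indicator (E n) \<xi>)"
        using m by (intro suminf_finite) (auto simp: E_def)
      moreover have "emeasure \<xi> A = of_nat m" using m by (simp add: E_def)
      ultimately show ?case using m by simp
    qed
  qed
  also have "\<dots> = (\<Sum>n. h (of_nat n) * ennreal (?l ^ n / fact n * exp (- ?l)))"
    by (simp add: nn_integral_suminf nn_integral_cmult_indicator emeasure_eq_measure pE)
  finally show "(\<integral>\<^sup>+\<xi>. h (emeasure \<xi> A) \<partial>P) = (\<Sum>n. h (of_nat n) * ennreal (?l ^ n / fact n * exp (- ?l)))" .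
qed

lemma poisson_nn_integral_sums:
  assumes "A \<in> finite_sets M" "h \<in> borel_measurable borel"
    and "\<And>n. 0 \<le> f n" "\<And>n. h (of_nat n) = ennreal (f n)"
    and s: "(\<lambda>n. f n * (measure M A ^ n / fact n * exp (- measure M A))) sums s"
  shows "(\<integral>\<^sup>+\<xi>. h (emeasure \<xi> A) \<partial>P) = ennreal s"
proof -
  have "(\<integral>\<^sup>+\<xi>. h (emeasure \<xi> A) \<partial>P)
      = (\<Sum>n. ennreal (f n * (measure M A ^ n / fact n * exp (- measure M A))))"
    unfolding poisson_nn_integral[OF assms(1,2)] assms(4)
    using assms(3) by (intro suminf_cong ennreal_mult[symmetric]) auto
  also have "\<dots> = ennreal s"
    using assms(3) by (intro suminf_ennreal_eq[OF _ s]) auto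
  finally show ?thesis .
qed

lemma poisson_laplace1:
  assumes A: "A \<in> finite_sets M"
  shows "(\<integral>\<^sup>+\<xi>. nexp (r * emeasure \<xi> A) \<partial>P) = nexp ((1 - nexp r) * emeasure M A)"
proof -
  let ?l = "measure M A"
  define u where "u = enn2real (nexp r)"
  have u: "nexp r = ennreal u" "0 \<le> u" "u \<le> 1" by (simp_all add: u_def enn2real_nexp_le_1)
  have l: "emeasure M A = ennreal ?l"
    using A by (simp add: finite_sets_def emeasure_eq_ennreal_measure less_top[symmetric])
  have pow: "nexp (r * of_nat n) = ennreal (u ^ n)" for n
  proof (induction n)
    case (Suc n)
    then show ?case using u by (simp add: distrib_left nexp_add ennreal_mult ac_simps)
  qed simp
  have "(\<lambda>n. (u * ?l) ^ n / fact n * exp (- ?l)) sums (exp (u * ?l) * exp (- ?l))"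
    using exp_converges[of "u * ?l"] by (intro sums_mult2) (simp add: divide_inverse mult.commute)
  then have s: "(\<lambda>n. u ^ n * (?l ^ n / fact n * exp (- ?l))) sums exp (- ((1 - u) * ?l))"
    by (simp add: power_mult_distrib mult_exp_exp algebra_simps)
  have "(\<integral>\<^sup>+\<xi>. nexp (r * emeasure \<xi> A) \<partial>P) = ennreal (exp (- ((1 - u) * ?l)))"
    using u by (intro poisson_nn_integral_sums[OF A _ _ pow s]) auto
  also have "\<dots> = nexp (ennreal ((1 - u) * ?l))"
    using u by (intro nexp_ennreal[symmetric]) simp
  also have "ennreal ((1 - u) * ?l) = (1 - nexp r) * emeasure M A"
    using u by (simp add: l ennreal_mult' ennreal_minus flip: ennreal_1)
  finally show ?thesis .
qed

lemma poisson_mean: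
  assumes A: "A \<in> finite_sets M"
  shows "(\<integral>\<^sup>+\<xi>. emeasure \<xi> A \<partial>P) = emeasure M A"
proof -
  let ?l = "measure M A"
  have "(\<lambda>n. ?l ^ n / fact n * exp (- ?l)) sums (exp ?l * exp (- ?l))"
    using exp_converges[of ?l] by (intro sums_mult2) (simp add: divide_inverse mult.commute)
  then have "(\<lambda>n. ?l ^ n / fact n * exp (- ?l)) sums 1" by (simp add: mult_exp_exp)
  from sums_mult[OF this, of ?l] have "(\<lambda>n. real (Suc n) * (?l ^ Suc n / fact (Suc n) * exp (- ?l))) sums ?l"
    by (simp add: ac_simps)
  then have s: "(\<lambda>n. real n * (?l ^ n / fact n * exp (- ?l))) sums ?l"
    by (subst (asm) sums_Suc_iff) simp
  have "(\<integral>\<^sup>+\<xi>. emeasure \<xi> A \<partial>P) = ennreal ?l"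
    by (rule poisson_nn_integral_sums[OF A _ _ _ s]) (auto simp: ennreal_of_nat_eq_real_of_nat)
  then show ?thesis
    using A by (simp add: finite_sets_def emeasure_eq_ennreal_measure less_top[symmetric])
qed

lemma poisson_second_moment:
  assumes A: "A \<in> finite_sets M"
  shows "(\<integral>\<^sup>+\<xi>. emeasure \<xi> A * emeasure \<xi> A \<partial>P) = emeasure M A + emeasure M A * emeasure M A"
proof -
  let ?l = "measure M A"
  have "(\<lambda>n. ?l ^ n / fact n * exp (- ?l)) sums (exp ?l * exp (- ?l))"
    using exp_converges[of ?l] by (intro sums_mult2) (simp add: divide_inverse mult.commute)
  then have s0: "(\<lambda>n. ?l ^ n / fact n * exp (- ?l)) sums 1" by (simp add: mult_exp_exp)
  from sums_mult[OF this, of ?l] have "(\<lambda>n. real (Suc n) * (?l ^ Suc n / fact (Suc n) * exp (- ?l))) sums ?l"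
    by (simp add: ac_simps)
  then have s1: "(\<lambda>n. real n * (?l ^ n / fact n * exp (- ?l))) sums ?l"
    by (subst (asm) sums_Suc_iff) simp
  have "(\<lambda>n. real (Suc n) * real (Suc n) * (?l ^ Suc n / fact (Suc n) * exp (- ?l))) sums (?l * (?l + 1))"
  proof -
    have "real (Suc n) * real (Suc n) * (?l ^ Suc n / fact (Suc n) * exp (- ?l))
      = ?l * (real n * (?l ^ n / fact n * exp (- ?l)) + ?l ^ n / fact n * exp (- ?l))" for n
    proof -
      have "real (Suc n) * (?l ^ Suc n / fact (Suc n) * exp (- ?l)) = ?l * (?l ^ n / fact n * exp (- ?l))"
        by (simp add: ac_simps)
      then have "real (Suc n) * (real (Suc n) * (?l ^ Suc n / fact (Suc n) * exp (- ?l)))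
          = (real n + 1) * (?l * (?l ^ n / fact n * exp (- ?l)))"
        by (metis of_nat_Suc add.commute)
      also have "\<dots> = ?l * (real n * (?l ^ n / fact n * exp (- ?l)) + ?l ^ n / fact n * exp (- ?l))"
        by (simp only: distrib_left distrib_right mult_1_left mult.left_commute)
      finally show ?thesis by (simp only: mult.assoc)
    qed
    then show ?thesis using sums_mult[OF sums_add[OF s1 s0], of ?l] by simp
  qed
  then have s: "(\<lambda>n. real n * real n * (?l ^ n / fact n * exp (- ?l))) sums (?l + ?l * ?l)"
    by (subst (asm) sums_Suc_iff) (simp add: algebra_simps)
  have "(\<integral>\<^sup>+\<xi>. emeasure \<xi> A * emeasure \<xi> A \<partial>P) = ennreal (?l + ?l * ?l)"
    by (rule poisson_nn_integral_sums[OF A _ _ _ s]) (auto simp: ennreal_of_nat_eq_real_of_nat ennreal_mult)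
  then show ?thesis
    using A by (simp add: finite_sets_def emeasure_eq_ennreal_measure less_top[symmetric] ennreal_mult)
qed

text \<open>
  The exponential formula \<open>E exp (- \<integral> f d\<xi>) = exp (- \<integral> (1 - exp (- f)) dM)\<close> for \<open>f = cover_count As\<close>: the integral
  of \<open>f\<close> is a linear combination of the independent counts of the multiplicity sets.
\<close>

lemma poisson_laplace:
  assumes As: "set As \<subseteq> finite_sets M"
  shows "(\<integral>\<^sup>+\<xi>. nexp (mass As \<xi>) \<partial>P) = nexp (\<integral>\<^sup>+x. 1 - nexp (cover_count As x) \<partial>M)"
proof -
  interpret prob_space P by (rule poisson_prob)
  have AsM: "set As \<subseteq> sets M" using As finite_sets_subset by blast
  let ?C = "multiplicity_set M As" and ?k = "length As"
  have C: "?C m \<in> finite_sets M" for m by (rule multiplicity_set_finite[OF As])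
  have ind: "indep_vars (\<lambda>_. borel) (\<lambda>i \<xi>. emeasure \<xi> (?C i)) {..<?k}"
  proof -
    have "disjoint_family_on ?C {..<?k}" by (auto simp: disjoint_family_on_def multiplicity_set_def)
    moreover have "\<forall>i<?k. ?C i \<in> sets M \<and> emeasure M (?C i) < \<infinity>"
      using C by (auto simp: finite_sets_def)
    ultimately show ?thesis using P unfolding poisson_measure_def by blast
  qed
  have "(\<integral>\<^sup>+\<xi>. nexp (mass As \<xi>) \<partial>P) = (\<integral>\<^sup>+\<xi>. (\<Prod>m<?k. nexp (of_nat (Suc m) * emeasure \<xi> (?C m))) \<partial>P)"
  proof (rule nn_integral_cong)
    fix \<xi> assume "\<xi> \<in> space P"
    then have s: "sets \<xi> = sets M" by (rule poisson_space)
    then have "mass As \<xi> = (\<Sum>m<?k. of_nat (Suc m) * emeasure \<xi> (?C m))"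
      using nn_integral_fun_cover_count[OF AsM s, of "\<lambda>x. x"] AsM by (simp add: mass_eq_nn_integral)
    then show "nexp (mass As \<xi>) = (\<Prod>m<?k. nexp (of_nat (Suc m) * emeasure \<xi> (?C m)))"
      by (simp add: nexp_sum)
  qed
  also have "\<dots> = (\<Prod>m<?k. \<integral>\<^sup>+\<xi>. nexp (of_nat (Suc m) * emeasure \<xi> (?C m)) \<partial>P)"
    by (intro indep_vars_nn_integral indep_vars_compose2[OF ind]) auto
  also have "\<dots> = (\<Prod>m<?k. nexp ((1 - nexp (of_nat (Suc m))) * emeasure M (?C m)))"
    by (intro prod.cong refl poisson_laplace1 C)
  also have "\<dots> = nexp (\<integral>\<^sup>+x. 1 - nexp (cover_count As x) \<partial>M)"
    using nn_integral_fun_cover_count[OF AsM refl, of "\<lambda>x. 1 - nexp x"] by (simp add: nexp_sum)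
  finally show ?thesis .
qed

end

section \<open>Compound Poisson laws\<close>

definition measure_suminf :: "'a measure \<Rightarrow> (nat \<Rightarrow> 'a measure) \<Rightarrow> 'a measure" where
  "measure_suminf M \<xi> = measure_of (space M) (sets M) (\<lambda>A. \<Sum>i. emeasure (\<xi> i) A)"

lemma sets_measure_suminf [simp]: "sets (measure_suminf M \<xi>) = sets M"
  by (simp add: measure_suminf_def)

lemma emeasure_measure_suminf:
  assumes s: "\<And>i. sets (\<xi> i) = sets M" and A: "A \<in> sets M"
  shows "emeasure (measure_suminf M \<xi>) A = (\<Sum>i. emeasure (\<xi> i) A)"
proof -
  have "countably_additive (sets M) (\<lambda>A. \<Sum>i. emeasure (\<xi> i) A)"
    unfolding countably_additive_def
  proof safe
    fix A :: "nat \<Rightarrow> 'a set"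
    assume A: "range A \<subseteq> sets M" "disjoint_family A"
    have "(\<Sum>j. \<Sum>i. emeasure (\<xi> i) (A j))
        = (\<Sum>j. \<integral>\<^sup>+i. emeasure (\<xi> i) (A j) \<partial>count_space UNIV)"
      by (simp add: nn_integral_count_space_nat)
    also have "\<dots> = (\<integral>\<^sup>+i. (\<Sum>j. emeasure (\<xi> i) (A j)) \<partial>count_space UNIV)"
      by (rule nn_integral_suminf[symmetric]) simp
    also have "\<dots> = (\<Sum>i. emeasure (\<xi> i) (\<Union>(range A)))"
      unfolding nn_integral_count_space_nat using A s by (simp add: suminf_emeasure)
    finally show "(\<Sum>j. \<Sum>i. emeasure (\<xi> i) (A j)) = (\<Sum>i. emeasure (\<xi> i) (\<Union>(range A)))" .
  qed
  then show ?thesis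
    using A by (simp add: measure_suminf_def emeasure_measure_of_sigma sets.sigma_algebra_axioms positive_def)
qed

lemma mass_measure_suminf:
  assumes "\<And>i. sets (\<xi> i) = sets M" "set As \<subseteq> sets M"
  shows "mass As (measure_suminf M \<xi>) = (\<Sum>i. mass As (\<xi> i))"
  using assms(2)
proof (induction As)
  case (Cons A As)
  then show ?case by (simp add: emeasure_measure_suminf[OF assms(1)] suminf_add)
qed simp

text \<open>
  Draw a Poisson number of independent points \<open>z\<close> with law \<open>L / L (space L)\<close> and add the jumps \<open>e z\<close>: the law is
  a Poisson mixture of convolution powers, and the exponential series gives its Laplace functional.
\<close>

lemma exists_compound_poisson_finite:
  assumes L: "finite_measure L" and e: "e \<in> measurable L (pair_star M N)"
  shows "\<exists>R. prob_space R \<and> sets R = sets (pair_star M N) \<and>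
    (\<forall>As Bs. set As \<subseteq> sets M \<longrightarrow> set Bs \<subseteq> sets N \<longrightarrow>
       laplace As Bs R = nexp (\<integral>\<^sup>+z. 1 - nexp (mass2 As Bs (e z)) \<partial>L))"
proof (cases "emeasure L (space L) = 0")
  case True
  have "laplace As Bs (return (pair_star M N) (null_measure M, null_measure N))
      = nexp (\<integral>\<^sup>+z. 1 - nexp (mass2 As Bs (e z)) \<partial>L)"
    if AB: "set As \<subseteq> sets M" "set Bs \<subseteq> sets N" for As Bs
  proof -
    have "AE z in L. 1 - nexp (mass2 As Bs (e z)) = 0"
      using True by (intro AE_I[of _ _ "space L"]) auto
    then have "(\<integral>\<^sup>+z. 1 - nexp (mass2 As Bs (e z)) \<partial>L) = 0"
      using nn_integral_cong_AE[of "\<lambda>z. 1 - nexp (mass2 As Bs (e z))" "\<lambda>_. 0" L] by simp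
    moreover have "(\<lambda>p. nexp (mass2 As Bs p)) \<in> borel_measurable (pair_star M N)"
      using measurable_compose[OF measurable_mass2[OF AB] measurable_nexp] .
    ultimately show ?thesis
      by (simp add: laplace_def nn_integral_return[OF null_pair_in_space]) (simp add: mass2_def)
  qed
  then show ?thesis
    by (intro exI[of _ "return (pair_star M N) (null_measure M, null_measure N)"])
      (simp add: prob_space_return[OF null_pair_in_space])
next
  case False
  interpret finite_measure L by fact
  define l where "l = measure L (space L)"
  have Ll: "emeasure L (space L) = ennreal l" by (simp add: l_def emeasure_eq_measure)
  have l: "0 < l" using False Ll by (simp add: ennreal_eq_0_iff)
  define \<sigma> where "\<sigma> = distr (scale_measure (ennreal (1 / l)) L) (pair_star M N) e"
  have eS: "e \<in> measurable (scale_measure (ennreal (1 / l)) L) (pair_star M N)"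
    using e by (rule measurable_domain_cong) simp
  have "prob_space (scale_measure (ennreal (1 / l)) L)"
    by (rule prob_spaceI) (use l in \<open>simp add: space_scale_measure Ll flip: ennreal_mult\<close>)
  then have \<sigma>: "prob_space \<sigma>" "sets \<sigma> = sets (pair_star M N)"
    using eS by (auto simp: \<sigma>_def prob_space.prob_space_distr)
  define p where "p = poisson_pmf l"
  define R where "R = measure_pmf p \<bind> conv_power M N \<sigma>"
  have k: "conv_power M N \<sigma> \<in> measurable (measure_pmf p) (subprob_algebra (pair_star M N))"
    using conv_power_prob[OF \<sigma>] by (auto simp: space_subprob_algebra prob_space_imp_subprob_space)
  have "prob_space R"
    unfolding R_def using k conv_power_prob[OF \<sigma>] by (intro prob_space.prob_space_bind measure_pmf.prob_space_axioms) auto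
  moreover have "sets R = sets (pair_star M N)"
    unfolding R_def using conv_power_prob[OF \<sigma>] by (intro sets_bind) auto
  moreover have "laplace As Bs R = nexp (\<integral>\<^sup>+z. 1 - nexp (mass2 As Bs (e z)) \<partial>L)"
    if AB: "set As \<subseteq> sets M" "set Bs \<subseteq> sets N" for As Bs
  proof -
    have m: "(\<lambda>p. nexp (mass2 As Bs p)) \<in> borel_measurable (pair_star M N)"
      using measurable_compose[OF measurable_mass2[OF AB] measurable_nexp] .
    note me = measurable_compose[OF e m]
    define I where "I = (\<integral>\<^sup>+z. nexp (mass2 As Bs (e z)) \<partial>L)"
    have "I \<le> (\<integral>\<^sup>+z. 1 \<partial>L)" unfolding I_def by (intro nn_integral_mono) simp
    then have Il: "I \<le> ennreal l" by (simp add: Ll)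
    then have "I < top" using order_le_less_trans ennreal_less_top by blast
    define u where "u = enn2real I / l"
    have u0: "0 \<le> u" using l by (simp add: u_def)
    have Iu: "I = ennreal (l * u)" using \<open>I < top\<close> l by (simp add: u_def)
    have u1: "u \<le> 1" using Il l by (simp add: Iu ennreal_le_iff)
    have \<sigma>u: "laplace As Bs \<sigma> = ennreal u"
    proof -
      have "laplace As Bs \<sigma> = (\<integral>\<^sup>+z. nexp (mass2 As Bs (e z)) \<partial>scale_measure (ennreal (1 / l)) L)"
        unfolding laplace_def \<sigma>_def by (subst nn_integral_distr[OF eS]) (simp_all add: m)
      also have "\<dots> = ennreal (1 / l) * I"
        unfolding I_def by (rule nn_integral_scale_measure[OF me])
      finally show ?thesis using l u0 by (simp add: Iu flip: ennreal_mult)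
    qed
    have "laplace As Bs R = (\<integral>\<^sup>+n. laplace As Bs (conv_power M N \<sigma> n) \<partial>p)"
      unfolding laplace_def R_def by (rule nn_integral_bind[OF m k])
    also have "\<dots> = (\<integral>\<^sup>+n. ennreal (u ^ n) \<partial>p)"
      using u0 by (simp add: laplace_conv_power[OF \<sigma> AB] \<sigma>u ennreal_power)
    also have "\<dots> = (\<Sum>n. ennreal (pmf p n) * ennreal (u ^ n))"
      by (simp add: nn_integral_measure_pmf nn_integral_count_space_nat)
    also have "\<dots> = (\<Sum>n. ennreal (pmf p n * u ^ n))"
      using u0 by (intro suminf_cong ennreal_mult[symmetric]) auto
    also have "\<dots> = ennreal (exp (- (l * (1 - u))))"
    proof (rule suminf_ennreal_eq)
      have "(\<lambda>n. (u * l) ^ n / fact n * exp (- l)) sums (exp (u * l) * exp (- l))"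
        using exp_converges[of "u * l"] by (intro sums_mult2) (simp add: divide_inverse mult.commute)
      then show "(\<lambda>n. pmf p n * u ^ n) sums exp (- (l * (1 - u)))"
        using l by (simp add: p_def power_mult_distrib mult_exp_exp algebra_simps)
    qed (use u0 in auto)
    also have "\<dots> = nexp (ennreal (l * (1 - u)))"
      using l u1 by (intro nexp_ennreal[symmetric]) simp
    also have "ennreal (l * (1 - u)) = (\<integral>\<^sup>+z. 1 - nexp (mass2 As Bs (e z)) \<partial>L)"
    proof -
      have "(\<integral>\<^sup>+z. 1 - nexp (mass2 As Bs (e z)) \<partial>L) = (\<integral>\<^sup>+z. 1 \<partial>L) - I"
        unfolding I_def using me \<open>I < top\<close> by (intro nn_integral_diff) (auto simp: I_def)
      then show ?thesis using u0 l by (simp add: Ll Iu ennreal_minus right_diff_distrib)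
    qed
    finally show ?thesis .
  qed
  ultimately show ?thesis by blast
qed

lemma nn_integral_PiM_prod_coordinates:
  fixes R :: "nat \<Rightarrow> 'w measure"
  assumes "\<And>i. prob_space (R i)" and m: "\<And>i. f i \<in> borel_measurable (R i)"
  shows "(\<integral>\<^sup>+\<omega>. (\<Prod>i<n. f i (\<omega> i)) \<partial>PiM UNIV R) = (\<Prod>i<n. \<integral>\<^sup>+p. (f i p :: ennreal) \<partial>R i)"
proof -
  interpret prob_space "R i" for i by fact
  interpret product_prob_space R UNIV ..
  note [measurable] = m
  have "(\<integral>\<^sup>+\<omega>. (\<Prod>i<n. f i (\<omega> i)) \<partial>PiM UNIV R) = (\<integral>\<^sup>+\<omega>. (\<Prod>i<n. f i (restrict \<omega> {..<n} i)) \<partial>PiM UNIV R)"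
    by simp
  also have "\<dots> = (\<integral>\<^sup>+\<omega>. (\<Prod>i<n. f i (\<omega> i)) \<partial>distr (PiM UNIV R) (PiM {..<n} R) (\<lambda>\<omega>. restrict \<omega> {..<n}))"
    by (subst nn_integral_distr) (auto intro!: measurable_restrict_subset)
  also have "\<dots> = (\<integral>\<^sup>+\<omega>. (\<Prod>i<n. f i (\<omega> i)) \<partial>PiM {..<n} R)"
    by (subst distr_PiM_restrict_finite) auto
  also have "\<dots> = (\<Prod>i<n. \<integral>\<^sup>+p. f i p \<partial>R i)"
    by (rule product_nn_integral_prod) (auto intro: m)
  finally show ?thesis .
qed

text \<open>
  An infinite intensity is cut into finite pieces, and the independent contributions of the pieces are
  superposed. The sum of countably many measures is always a measure, so no convergence is at stake.
\<close>

lemma exists_compound_poisson: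
  assumes L: "sigma_finite_measure L" and e: "e \<in> measurable L (pair_star M N)"
  shows "\<exists>R. prob_space R \<and> sets R = sets (pair_star M N) \<and>
    (\<forall>As Bs. set As \<subseteq> sets M \<longrightarrow> set Bs \<subseteq> sets N \<longrightarrow>
       laplace As Bs R = nexp (\<integral>\<^sup>+z. 1 - nexp (mass2 As Bs (e z)) \<partial>L))"
proof -
  obtain X :: "nat \<Rightarrow> _" where X: "range X \<subseteq> sets L" "(\<Union>i. X i) = space L"
      "\<And>i. emeasure L (X i) \<noteq> \<infinity>" "disjoint_family X"
    using sigma_finite_measure.sigma_finite_disjoint[OF L] by metis
  have XL [measurable]: "X i \<in> sets L" for i using X(1) by auto
  \<comment> \<open>The intensity restricted to the piece \<open>X i\<close>, kept on the whole space so that \<open>e\<close> stays measurable.\<close>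
  define D where "D i = density L (indicator (X i))" for i
  have "finite_measure (D i)" for i
    using X(3)[of i] sets.sets_into_space[OF XL[of i]]
    by (intro finite_measureI) (simp add: D_def emeasure_density Int_absorb1)
  moreover have "e \<in> measurable (D i) (pair_star M N)" for i
    using e by (rule measurable_domain_cong) (simp add: D_def)
  ultimately have "\<forall>i. \<exists>R. prob_space R \<and> sets R = sets (pair_star M N) \<and>
    (\<forall>As Bs. set As \<subseteq> sets M \<longrightarrow> set Bs \<subseteq> sets N \<longrightarrow>
       laplace As Bs R = nexp (\<integral>\<^sup>+z. 1 - nexp (mass2 As Bs (e z)) \<partial>D i))"
    by (intro allI exists_compound_poisson_finite)
  then obtain R where R: "\<And>i. prob_space (R i)" "\<And>i. sets (R i) = sets (pair_star M N)"
    "\<And>i As Bs. set As \<subseteq> sets M \<Longrightarrow> set Bs \<subseteq> sets N \<Longrightarrow>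
       laplace As Bs (R i) = nexp (\<integral>\<^sup>+z. 1 - nexp (mass2 As Bs (e z)) \<partial>D i)"
    by metis
  define Om where "Om = PiM UNIV R"
  interpret Om: prob_space Om unfolding Om_def by (intro prob_space_PiM R)
  have coord: "(\<lambda>\<omega>. \<omega> i) \<in> measurable Om (pair_star M N)" for i
    unfolding Om_def using measurable_component_singleton[of i UNIV R] measurable_cong_sets[OF refl R(2)[of i]]
    by (metis UNIV_I)
  define S where "S \<omega> = (measure_suminf M (\<lambda>i. fst (\<omega> i)), measure_suminf N (\<lambda>i. snd (\<omega> i)))"
    for \<omega> :: "nat \<Rightarrow> 'b measure \<times> 'c measure"
  have Om_s: "sets (fst (\<omega> i)) = sets M" "sets (snd (\<omega> i)) = sets N" if "\<omega> \<in> space Om" for \<omega> i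
    using measurable_space[OF coord[of i] that] by (auto simp: space_pair_star)
  have SL: "S \<in> measurable Om (pair_star M N)"
    unfolding S_def pair_star_def
  proof (intro measurable_Pair measurable_starI)
    fix A assume A: "A \<in> sets M"
    have "(\<lambda>\<omega>. \<Sum>i. mass2 [A] [] (\<omega> i)) \<in> borel_measurable Om"
      using A by (intro borel_measurable_suminf_order measurable_compose[OF coord] measurable_mass2) auto
    then show "(\<lambda>\<omega>. emeasure (measure_suminf M (\<lambda>i. fst (\<omega> i))) A) \<in> borel_measurable Om"
      by (rule measurable_cong[THEN iffD1, rotated]) (simp add: mass2_def emeasure_measure_suminf A Om_s)
  next
    fix B assume B: "B \<in> sets N"
    have "(\<lambda>\<omega>. \<Sum>i. mass2 [] [B] (\<omega> i)) \<in> borel_measurable Om"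
      using B by (intro borel_measurable_suminf_order measurable_compose[OF coord] measurable_mass2) auto
    then show "(\<lambda>\<omega>. emeasure (measure_suminf N (\<lambda>i. snd (\<omega> i))) B) \<in> borel_measurable Om"
      by (rule measurable_cong[THEN iffD1, rotated]) (simp add: mass2_def emeasure_measure_suminf B Om_s)
  qed auto
  have "laplace As Bs (distr Om (pair_star M N) S) = nexp (\<integral>\<^sup>+z. 1 - nexp (mass2 As Bs (e z)) \<partial>L)"
    if AB: "set As \<subseteq> sets M" "set Bs \<subseteq> sets N" for As Bs
  proof -
    have m [measurable]: "(\<lambda>p. nexp (mass2 As Bs p)) \<in> borel_measurable (pair_star M N)"
      using measurable_compose[OF measurable_mass2[OF AB] measurable_nexp] .
    note me [measurable] = measurable_compose[OF e m]
    note mc [measurable] = measurable_compose[OF coord m]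
    define a where "a i = (\<integral>\<^sup>+z. 1 - nexp (mass2 As Bs (e z)) \<partial>D i)" for i
    have "(\<Sum>i. a i) = (\<Sum>i. \<integral>\<^sup>+z. indicator (X i) z * (1 - nexp (mass2 As Bs (e z))) \<partial>L)"
      unfolding a_def D_def by (intro suminf_cong nn_integral_density) auto
    also have "\<dots> = (\<integral>\<^sup>+z. (\<Sum>i. indicator (X i) z * (1 - nexp (mass2 As Bs (e z)))) \<partial>L)"
      by (rule nn_integral_suminf[symmetric]) measurable
    also have "\<dots> = (\<integral>\<^sup>+z. 1 - nexp (mass2 As Bs (e z)) \<partial>L)"
    proof (rule nn_integral_cong)
      fix z assume "z \<in> space L"
      then have "(\<Sum>i. indicator (X i) z) = (1 :: ennreal)"
        using suminf_indicator[OF X(4), of z] X(2) by (simp add: indicator_def)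
      then show "(\<Sum>i. indicator (X i) z * (1 - nexp (mass2 As Bs (e z)))) = 1 - nexp (mass2 As Bs (e z))"
        by (simp add: ennreal_suminf_multc)
    qed
    finally have suma: "(\<Sum>i. a i) = (\<integral>\<^sup>+z. 1 - nexp (mass2 As Bs (e z)) \<partial>L)" .
    have lapS: "laplace As Bs (distr Om (pair_star M N) S) = (\<integral>\<^sup>+\<omega>. nexp (\<Sum>i. mass2 As Bs (\<omega> i)) \<partial>Om)"
    proof -
      have "laplace As Bs (distr Om (pair_star M N) S) = (\<integral>\<^sup>+\<omega>. nexp (mass2 As Bs (S \<omega>)) \<partial>Om)"
        unfolding laplace_def by (rule nn_integral_distr[OF SL]) (simp add: m)
      also have "\<dots> = (\<integral>\<^sup>+\<omega>. nexp (\<Sum>i. mass2 As Bs (\<omega> i)) \<partial>Om)"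
        using AB by (intro nn_integral_cong)
          (simp add: mass2_def S_def mass_measure_suminf Om_s suminf_add)
      finally show ?thesis .
    qed
    have "(\<lambda>n. \<integral>\<^sup>+\<omega>. (\<Prod>i<n. nexp (mass2 As Bs (\<omega> i))) \<partial>Om) \<longlonglongrightarrow> (\<integral>\<^sup>+\<omega>. nexp (\<Sum>i. mass2 As Bs (\<omega> i)) \<partial>Om)"
    proof (rule nn_integral_dominated_convergence[where w="\<lambda>_. 1"])
      show "(\<lambda>\<omega>. nexp (\<Sum>i. mass2 As Bs (\<omega> i))) \<in> borel_measurable Om"
        by (intro measurable_compose[OF _ measurable_nexp] borel_measurable_suminf_order
            measurable_compose[OF coord measurable_mass2[OF AB]])
      show "AE \<omega> in Om. (\<lambda>n. \<Prod>i<n. nexp (mass2 As Bs (\<omega> i))) \<longlonglongrightarrow> nexp (\<Sum>i. mass2 As Bs (\<omega> i))"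
        by (intro AE_I2 nexp_suminf)
      show "AE \<omega> in Om. (\<Prod>i<n. nexp (mass2 As Bs (\<omega> i))) \<le> 1" for n
        by (simp flip: nexp_sum)
    qed (auto simp: Om.emeasure_space_1)
    moreover have "(\<integral>\<^sup>+\<omega>. (\<Prod>i<n. nexp (mass2 As Bs (\<omega> i))) \<partial>Om) = (\<Prod>i<n. nexp (a i))" for n
    proof -
      have "(\<integral>\<^sup>+\<omega>. (\<Prod>i<n. nexp (mass2 As Bs (\<omega> i))) \<partial>Om) = (\<Prod>i<n. \<integral>\<^sup>+p. nexp (mass2 As Bs p) \<partial>R i)"
        unfolding Om_def
        by (rule nn_integral_PiM_prod_coordinates[OF R(1)]) (rule measurable_domain_cong[OF m R(2)])
      then show ?thesis using R(3)[OF AB] by (simp add: laplace_def a_def)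
    qed
    ultimately have "(\<lambda>n. \<Prod>i<n. nexp (a i)) \<longlonglongrightarrow> laplace As Bs (distr Om (pair_star M N) S)"
      by (simp add: lapS)
    then show ?thesis using LIMSEQ_unique[OF _ nexp_suminf[of a]] suma by simp
  qed
  moreover have "prob_space (distr Om (pair_star M N) S)" using SL by (rule Om.prob_space_distr)
  ultimately show ?thesis by (intro exI[of _ "distr Om (pair_star M N) S"]) auto
qed

section \<open>Poissonian joinings from joinings of the bases\<close>

lemma sigma_finite_scale_measure:
  assumes "sigma_finite_measure M" "r < top"
  shows "sigma_finite_measure (scale_measure r M)"
proof -
  obtain A where "countable A" "A \<subseteq> sets M" "\<Union>A = space M" "\<And>a. a \<in> A \<Longrightarrow> emeasure M a \<noteq> \<infinity>"
    using assms(1) unfolding sigma_finite_measure_def by blast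
  then show ?thesis
    using assms(2) unfolding sigma_finite_measure_def
    by (intro exI[of _ A]) (auto simp: space_scale_measure ennreal_mult_eq_top_iff)
qed

lemma distr_scale_measure:
  assumes "f \<in> measurable M N"
  shows "distr (scale_measure r M) N f = scale_measure r (distr M N f)"
proof (rule measure_eqI)
  fix A assume "A \<in> sets (distr (scale_measure r M) N f)"
  then have A: "A \<in> sets N" by simp
  have "f \<in> measurable (scale_measure r M) N" using assms by (rule measurable_domain_cong) simp
  then show "emeasure (distr (scale_measure r M) N f) A = emeasure (scale_measure r (distr M N f)) A"
    using A assms by (simp add: emeasure_distr space_scale_measure)
qed simp

lemma nexp_power: "nexp x ^ n = nexp (of_nat n * x)"
  by (induction n) (auto simp: nexp_add distrib_right)

lemma nexp_inject: "nexp x = nexp y \<Longrightarrow> x = y"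
  by (metis nexp_less_iff less_irrefl linorder_less_linear)

lemma mass_return:
  assumes "set As \<subseteq> sets M"
  shows "mass As (return M x) = cover_count As x"
  using assms by (induction As) auto

text \<open>
  The negative logarithm of the Laplace functional of the superposition of common jumps with intensity
  \<open>L\<close> and of single jumps with intensities \<open>M\<close> and \<open>N\<close>.
\<close>

definition exponent :: "('a \<times> 'b) measure \<Rightarrow> 'a measure \<Rightarrow> 'b measure \<Rightarrow> 'a set list \<Rightarrow> 'b set list \<Rightarrow> ennreal" where
  "exponent L M N As Bs =
    (\<integral>\<^sup>+z. 1 - nexp (cover_count As (fst z) + cover_count Bs (snd z)) \<partial>L) +
    ((\<integral>\<^sup>+x. 1 - nexp (cover_count As x) \<partial>M) + (\<integral>\<^sup>+y. 1 - nexp (cover_count Bs y) \<partial>N))"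

lemma measurable_jump:
  assumes "set As \<subseteq> sets M"
  shows "(\<lambda>x. 1 - nexp (cover_count As x)) \<in> borel_measurable M"
proof -
  note [measurable] = measurable_cover_count[OF assms]
  show ?thesis by measurable
qed

lemma measurable_joint_jump:
  assumes "set As \<subseteq> sets M" "set Bs \<subseteq> sets N"
  shows "(\<lambda>z. 1 - nexp (cover_count As (fst z) + cover_count Bs (snd z))) \<in> borel_measurable (M \<Otimes>\<^sub>M N)"
proof -
  note [measurable] = measurable_cover_count[OF assms(1)] measurable_cover_count[OF assms(2)]
  show ?thesis by measurable
qed

text \<open>
  The convolution of three compound Poisson laws, with the jumps \<open>(\<delta>\<^sub>x, \<delta>\<^sub>y)\<close>, \<open>(\<delta>\<^sub>x, 0)\<close> and \<open>(0, \<delta>\<^sub>y)\<close>.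
\<close>

lemma exists_poissonian_law:
  assumes s: "sigma_finite_measure L" "sigma_finite_measure M'" "sigma_finite_measure N'"
    and L: "sets L = sets (M \<Otimes>\<^sub>M N)" and M': "sets M' = sets M" and N': "sets N' = sets N"
  shows "\<exists>R. prob_space R \<and> sets R = sets (pair_star M N) \<and>
    (\<forall>As Bs. set As \<subseteq> sets M \<longrightarrow> set Bs \<subseteq> sets N \<longrightarrow> laplace As Bs R = nexp (exponent L M' N' As Bs))"
proof -
  have sp: "space L = space M \<times> space N" "space M' = space M" "space N' = space N"
    using L M' N' by (auto dest!: sets_eq_imp_space_eq simp: space_pair_measure)
  have rM: "(\<lambda>x. return M x) \<in> measurable M (measure_space_star M)" for M :: "'c measure"
    by (rule measurable_starI) auto
  have nM: "(\<lambda>x. null_measure M) \<in> measurable K (measure_space_star M)" for M :: "'c measure" and K :: "'d measure"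
    by (rule measurable_const) (simp add: space_measure_space_star)
  have e1: "(\<lambda>z. (return M (fst z), return N (snd z))) \<in> measurable L (pair_star M N)"
  proof -
    note [measurable] = rM[of M] rM[of N]
    have "(\<lambda>z. (return M (fst z), return N (snd z))) \<in> measurable (M \<Otimes>\<^sub>M N) (pair_star M N)"
      unfolding pair_star_def by measurable
    then show ?thesis using L by (rule measurable_domain_cong)
  qed
  have e2: "(\<lambda>x. (return M x, null_measure N)) \<in> measurable M' (pair_star M N)"
    unfolding pair_star_def using measurable_domain_cong[OF rM M'] nM by (intro measurable_Pair)
  have e3: "(\<lambda>x. (null_measure M, return N x)) \<in> measurable N' (pair_star M N)"
    unfolding pair_star_def using measurable_domain_cong[OF rM N'] nM by (intro measurable_Pair)
  obtain R1 where R1: "prob_space R1" "sets R1 = sets (pair_star M N)"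
    and lap1: "\<forall>As Bs. set As \<subseteq> sets M \<longrightarrow> set Bs \<subseteq> sets N \<longrightarrow>
       laplace As Bs R1 = nexp (\<integral>\<^sup>+z. 1 - nexp (mass2 As Bs (return M (fst z), return N (snd z))) \<partial>L)"
    using exists_compound_poisson[OF s(1) e1] by (elim exE conjE)
  obtain R2 where R2: "prob_space R2" "sets R2 = sets (pair_star M N)"
    and lap2: "\<forall>As Bs. set As \<subseteq> sets M \<longrightarrow> set Bs \<subseteq> sets N \<longrightarrow>
       laplace As Bs R2 = nexp (\<integral>\<^sup>+z. 1 - nexp (mass2 As Bs (return M z, null_measure N)) \<partial>M')"
    using exists_compound_poisson[OF s(2) e2] by (elim exE conjE)
  obtain R3 where R3: "prob_space R3" "sets R3 = sets (pair_star M N)"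
    and lap3: "\<forall>As Bs. set As \<subseteq> sets M \<longrightarrow> set Bs \<subseteq> sets N \<longrightarrow>
       laplace As Bs R3 = nexp (\<integral>\<^sup>+z. 1 - nexp (mass2 As Bs (null_measure M, return N z)) \<partial>N')"
    using exists_compound_poisson[OF s(3) e3] by (elim exE conjE)
  define R where "R = convolve M N R1 (convolve M N R2 R3)"
  have R23: "prob_space (convolve M N R2 R3)" by (intro prob_space_convolve R2 R3)
  have "prob_space R" unfolding R_def by (intro prob_space_convolve R1 R23 sets_convolve)
  moreover have "sets R = sets (pair_star M N)" by (simp add: R_def)
  moreover have "laplace As Bs R = nexp (exponent L M' N' As Bs)"
    if AB: "set As \<subseteq> sets M" "set Bs \<subseteq> sets N" for As Bs
    using AB unfolding R_def exponent_def
    by (simp add: nexp_add laplace_convolve[OF R23 R1(2) sets_convolve AB] laplace_convolve[OF R3(1) R2(2) R3(2) AB] lap1 lap2 lap3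
        mass2_def mass_return)
  ultimately show ?thesis by blast
qed

lemma exponent_scale:
  assumes "sets L = sets (M \<Otimes>\<^sub>M N)" "sets M' = sets M" "sets N' = sets N"
    and AB: "set As \<subseteq> sets M" "set Bs \<subseteq> sets N"
  shows "exponent (scale_measure r L) (scale_measure r M') (scale_measure r N') As Bs = r * exponent L M' N' As Bs"
  using measurable_domain_cong[OF measurable_joint_jump[OF AB] assms(1)]
    measurable_domain_cong[OF measurable_jump[OF AB(1)] assms(2)]
    measurable_domain_cong[OF measurable_jump[OF AB(2)] assms(3)]
  by (simp add: exponent_def nn_integral_scale_measure distrib_left)

lemma laplace_pair_measure:
  assumes Q: "prob_space Q" and s: "sets P = sets (measure_space_star M)" "sets Q = sets (measure_space_star N)"
    and AB: "set As \<subseteq> sets M" "set Bs \<subseteq> sets N"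
  shows "laplace As Bs (P \<Otimes>\<^sub>M Q) = (\<integral>\<^sup>+\<xi>. nexp (mass As \<xi>) \<partial>P) * (\<integral>\<^sup>+\<eta>. nexp (mass Bs \<eta>) \<partial>Q)"
proof -
  interpret prob_space Q by fact
  note [measurable] = measurable_domain_cong[OF measurable_mass[OF AB(1)] s(1)]
    measurable_domain_cong[OF measurable_mass[OF AB(2)] s(2)]
  have "laplace As Bs (P \<Otimes>\<^sub>M Q) = (\<integral>\<^sup>+\<xi>. \<integral>\<^sup>+\<eta>. nexp (mass As \<xi>) * nexp (mass Bs \<eta>) \<partial>Q \<partial>P)"
    unfolding laplace_def mass2_def nexp_add by (subst nn_integral_fst[symmetric]) auto
  then show ?thesis by (simp add: nn_integral_cmult nn_integral_multc)
qed

definition preimages :: "'a measure \<Rightarrow> ('a \<Rightarrow> 'a) \<Rightarrow> 'a set list \<Rightarrow> 'a set list" where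
  "preimages M T As = map (\<lambda>A. T -` A \<inter> space M) As"

lemma set_preimages: "T \<in> measurable M M \<Longrightarrow> set As \<subseteq> sets M \<Longrightarrow> set (preimages M T As) \<subseteq> sets M"
  by (auto simp: preimages_def)

lemma mass_map_star:
  assumes "T \<in> measurable M M" "set As \<subseteq> sets M" "sets \<xi> = sets M"
  shows "mass As (map_star M T \<xi>) = mass (preimages M T As) \<xi>"
  using assms(2)
proof (induction As)
  case (Cons A As)
  have "T \<in> measurable \<xi> M" using assms(1,3) by (rule measurable_domain_cong)
  then show ?case using Cons sets_eq_imp_space_eq[OF assms(3)]
    by (simp add: preimages_def map_star_def emeasure_distr)
qed (simp add: preimages_def)

lemma cover_count_preimages:
  assumes "x \<in> space M"
  shows "cover_count (preimages M T As) x = cover_count As (T x)"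
  using assms by (induction As) (auto simp: preimages_def indicator_def)

lemma nn_integral_jump_invariant:
  assumes T: "T \<in> measurable M M" "distr M M T = M" "set As \<subseteq> sets M"
  shows "(\<integral>\<^sup>+x. 1 - nexp (cover_count (preimages M T As) x) \<partial>M) = (\<integral>\<^sup>+x. 1 - nexp (cover_count As x) \<partial>M)"
proof -
  have "(\<integral>\<^sup>+x. 1 - nexp (cover_count (preimages M T As) x) \<partial>M) = (\<integral>\<^sup>+x. 1 - nexp (cover_count As (T x)) \<partial>M)"
    by (intro nn_integral_cong) (simp add: cover_count_preimages)
  also have "\<dots> = (\<integral>\<^sup>+x. 1 - nexp (cover_count As x) \<partial>distr M M T)"
    using T(1) measurable_jump[OF T(3)] by (subst nn_integral_distr) auto
  finally show ?thesis by (simp add: T)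
qed

text \<open>
  Moving the random measures by \<open>T\<close> and \<open>S\<close> amounts to pulling back the test sets; the exponent does not
  notice this because all three intensities are invariant.
\<close>

lemma exponent_preimages:
  assumes T: "T \<in> measurable M M" "distr M M T = M" and S: "S \<in> measurable N N" "distr N N S = N"
    and L: "sets L = sets (M \<Otimes>\<^sub>M N)" "distr L (M \<Otimes>\<^sub>M N) (map_prod T S) = L"
    and AB: "set As \<subseteq> sets M" "set Bs \<subseteq> sets N"
  shows "exponent L (scale_measure a M) (scale_measure b N) (preimages M T As) (preimages N S Bs)
    = exponent L (scale_measure a M) (scale_measure b N) As Bs"
proof -
  have sp: "space L = space M \<times> space N" using sets_eq_imp_space_eq[OF L(1)] by (simp add: space_pair_measure)
  have TS: "map_prod T S \<in> measurable L (M \<Otimes>\<^sub>M N)"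
    using T S L(1) by (intro measurable_domain_cong[OF _ L(1)]) (simp add: map_prod_def split_beta')
  have "(\<integral>\<^sup>+z. 1 - nexp (cover_count (preimages M T As) (fst z) + cover_count (preimages N S Bs) (snd z)) \<partial>L)
      = (\<integral>\<^sup>+z. 1 - nexp (cover_count As (fst (map_prod T S z)) + cover_count Bs (snd (map_prod T S z))) \<partial>L)"
    by (intro nn_integral_cong) (auto simp add: cover_count_preimages sp)
  also have "\<dots> = (\<integral>\<^sup>+z. 1 - nexp (cover_count As (fst z) + cover_count Bs (snd z)) \<partial>distr L (M \<Otimes>\<^sub>M N) (map_prod T S))"
    using TS measurable_joint_jump[OF AB] by (subst nn_integral_distr) auto
  finally show ?thesis
    using measurable_jump[OF AB(1)] measurable_jump[OF AB(2)]
      measurable_jump[OF set_preimages[OF T(1) AB(1)]] measurable_jump[OF set_preimages[OF S(1) AB(2)]]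
    by (simp add: exponent_def L(2) nn_integral_scale_measure nn_integral_jump_invariant[OF T AB(1)]
        nn_integral_jump_invariant[OF S AB(2)])
qed

lemma laplace_distr_map_star:
  assumes T: "T \<in> measurable M M" and S: "S \<in> measurable N N"
    and \<rho>: "sets \<rho> = sets (pair_star M N)" "sets R = sets (pair_star M N)"
    and AB: "set As \<subseteq> sets M" "set Bs \<subseteq> sets N"
  shows "laplace As Bs (distr \<rho> R (map_prod (map_star M T) (map_star N S))) = laplace (preimages M T As) (preimages N S Bs) \<rho>"
proof -
  note [measurable] = measurable_map_star[OF T] measurable_map_star[OF S]
  have "map_prod (map_star M T) (map_star N S) \<in> measurable (pair_star M N) (pair_star M N)"
    unfolding map_prod_def split_beta' pair_star_def by measurable
  then have m: "map_prod (map_star M T) (map_star N S) \<in> measurable \<rho> R"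
    using measurable_cong_sets[OF \<rho>] by simp
  have "(\<lambda>p. nexp (mass2 As Bs p)) \<in> borel_measurable (pair_star M N)"
    using measurable_compose[OF measurable_mass2[OF AB] measurable_nexp] .
  then have f: "(\<lambda>p. nexp (mass2 As Bs p)) \<in> borel_measurable (distr \<rho> R (map_prod (map_star M T) (map_star N S)))"
    by (rule measurable_domain_cong) (simp add: \<rho>)
  have sp: "space \<rho> = {\<xi>. sets \<xi> = sets M} \<times> {\<eta>. sets \<eta> = sets N}"
    using sets_eq_imp_space_eq[OF \<rho>(1)] by (simp add: space_pair_star)
  show ?thesis
    unfolding laplace_def nn_integral_distr[OF m f]
    by (intro nn_integral_cong) (auto simp: sp mass2_def mass_map_star[OF T AB(1)] mass_map_star[OF S AB(2)])
qed

text \<open>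
  The single jumps fill up the marginals of \<open>J\<close>: on the first coordinate the total intensity is
  \<open>a M + (1 - a) M = M\<close>. Dividing the three intensities by \<open>n\<close> gives an \<open>n\<close>-th convolution root.
\<close>

theorem exists_poissonian_joining:
  fixes M :: "'a measure" and N :: "'b measure" and a b :: real
  assumes M: "sigma_finite_measure M" and N: "sigma_finite_measure N"
    and T: "T \<in> measurable M M" "distr M M T = M" and S: "S \<in> measurable N N" "distr N N S = N"
    and P: "poisson_measure M P" and Q: "poisson_measure N Q"
    and J: "sigma_finite_measure J" "sets J = sets (M \<Otimes>\<^sub>M N)"
      "distr J M fst = scale_measure (ennreal a) M" "distr J N snd = scale_measure (ennreal b) N"
      "distr J (M \<Otimes>\<^sub>M N) (map_prod T S) = J"
    and ab: "0 \<le> a" "a \<le> 1" "0 \<le> b" "b \<le> 1"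
  shows "\<exists>\<rho>. poissonian_joining M T P N S Q \<rho> \<and> sets \<rho> = sets (pair_star M N) \<and> prob_space \<rho> \<and>
    (\<forall>As Bs. set As \<subseteq> sets M \<longrightarrow> set Bs \<subseteq> sets N \<longrightarrow>
      laplace As Bs \<rho> = nexp (exponent J (scale_measure (ennreal (1 - a)) M) (scale_measure (ennreal (1 - b)) N) As Bs))"
proof -
  let ?M' = "scale_measure (ennreal (1 - a)) M" and ?N' = "scale_measure (ennreal (1 - b)) N"
  note P' = poisson_prob[OF P] poisson_sets[OF P] and Q' = poisson_prob[OF Q] poisson_sets[OF Q]
  have sf: "sigma_finite_measure ?M'" "sigma_finite_measure ?N'"
    using M N by (auto intro!: sigma_finite_scale_measure)
  obtain \<rho> where \<rho>: "prob_space \<rho>" "sets \<rho> = sets (pair_star M N)"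
    and lap: "\<And>As Bs. set As \<subseteq> sets M \<Longrightarrow> set Bs \<subseteq> sets N \<Longrightarrow> laplace As Bs \<rho> = nexp (exponent J ?M' ?N' As Bs)"
    using exists_poissonian_law[OF J(1) sf J(2)] by auto
  have f: "fst \<in> measurable \<rho> P" "snd \<in> measurable \<rho> Q"
  proof -
    have "fst \<in> measurable (pair_star M N) P" "snd \<in> measurable (pair_star M N) Q"
      using P'(2) Q'(2) by (auto simp: pair_star_def intro: measurable_fst'' measurable_snd'' cong: measurable_cong_sets)
    then show "fst \<in> measurable \<rho> P" "snd \<in> measurable \<rho> Q" using \<rho>(2) by (auto intro: measurable_domain_cong)
  qed
  have fJ: "fst \<in> measurable J M" "snd \<in> measurable J N"
    by (auto intro: measurable_domain_cong[OF _ J(2)])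
  have spl: "ennreal c * x + ennreal (1 - c) * x = x" if "0 \<le> c" "c \<le> 1" for c x
    using that by (simp flip: distrib_right ennreal_plus)
  have margin: "exponent J ?M' ?N' As [] = (\<integral>\<^sup>+x. 1 - nexp (cover_count As x) \<partial>M)" if As: "set As \<subseteq> sets M" for As
  proof -
    have "(\<integral>\<^sup>+z. 1 - nexp (cover_count As (fst z)) \<partial>J) = (\<integral>\<^sup>+x. 1 - nexp (cover_count As x) \<partial>distr J M fst)"
      using fJ measurable_jump[OF As] by (subst nn_integral_distr) auto
    then show ?thesis
      using measurable_jump[OF As] ab by (simp add: exponent_def J nn_integral_scale_measure spl)
  qed
  have margin': "exponent J ?M' ?N' [] Bs = (\<integral>\<^sup>+x. 1 - nexp (cover_count Bs x) \<partial>N)" if Bs: "set Bs \<subseteq> sets N" for Bs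
  proof -
    have "(\<integral>\<^sup>+z. 1 - nexp (cover_count Bs (snd z)) \<partial>J) = (\<integral>\<^sup>+x. 1 - nexp (cover_count Bs x) \<partial>distr J N snd)"
      using fJ measurable_jump[OF Bs] by (subst nn_integral_distr) auto
    then show ?thesis
      using measurable_jump[OF Bs] ab by (simp add: exponent_def J nn_integral_scale_measure spl)
  qed
  have "distr \<rho> P fst = P"
  proof (rule star_eqI[OF M])
    fix As assume As: "set As \<subseteq> finite_sets M"
    then have AsM: "set As \<subseteq> sets M" using finite_sets_subset by blast
    have "(\<integral>\<^sup>+\<xi>. nexp (mass As \<xi>) \<partial>distr \<rho> P fst) = laplace As [] \<rho>"
      using f(1) poisson_measurable_mass[OF P AsM] by (subst nn_integral_distr) (auto simp: laplace_def mass2_def)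
    also have "\<dots> = (\<integral>\<^sup>+\<xi>. nexp (mass As \<xi>) \<partial>P)"
      using AsM by (simp add: lap margin poisson_laplace[OF P As])
    finally show "(\<integral>\<^sup>+\<xi>. nexp (mass As \<xi>) \<partial>distr \<rho> P fst) = (\<integral>\<^sup>+\<xi>. nexp (mass As \<xi>) \<partial>P)" .
  qed (use P' prob_space.prob_space_distr[OF \<rho>(1) f(1)] in auto)
  moreover have "distr \<rho> Q snd = Q"
  proof (rule star_eqI[OF N])
    fix Bs assume Bs: "set Bs \<subseteq> finite_sets N"
    then have BsN: "set Bs \<subseteq> sets N" using finite_sets_subset by blast
    have "(\<integral>\<^sup>+\<xi>. nexp (mass Bs \<xi>) \<partial>distr \<rho> Q snd) = laplace [] Bs \<rho>"
      using f(2) poisson_measurable_mass[OF Q BsN] by (subst nn_integral_distr) (auto simp: laplace_def mass2_def)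
    also have "\<dots> = (\<integral>\<^sup>+\<xi>. nexp (mass Bs \<xi>) \<partial>Q)"
      using BsN by (simp add: lap margin' poisson_laplace[OF Q Bs])
    finally show "(\<integral>\<^sup>+\<xi>. nexp (mass Bs \<xi>) \<partial>distr \<rho> Q snd) = (\<integral>\<^sup>+\<xi>. nexp (mass Bs \<xi>) \<partial>Q)" .
  qed (use Q' prob_space.prob_space_distr[OF \<rho>(1) f(2)] in auto)
  moreover have PQ: "sets (P \<Otimes>\<^sub>M Q) = sets (pair_star M N)"
    unfolding pair_star_def using P'(2) Q'(2) by (rule sets_pair_measure_cong)
  moreover have "distr \<rho> (P \<Otimes>\<^sub>M Q) (map_prod (map_star M T) (map_star N S)) = \<rho>"
  proof (rule pair_star_eqI[OF M N])
    fix As Bs assume "set As \<subseteq> finite_sets M" "set Bs \<subseteq> finite_sets N"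
    then have AB: "set As \<subseteq> sets M" "set Bs \<subseteq> sets N" using finite_sets_subset by blast+
    show "laplace As Bs (distr \<rho> (P \<Otimes>\<^sub>M Q) (map_prod (map_star M T) (map_star N S))) = laplace As Bs \<rho>"
      unfolding laplace_distr_map_star[OF T(1) S(1) \<rho>(2) PQ AB]
      using AB by (simp add: lap set_preimages T(1) S(1) exponent_preimages[OF T S J(2,5) AB])
  next
    note [measurable] = measurable_map_star[OF T(1)] measurable_map_star[OF S(1)]
    have "map_prod (map_star M T) (map_star N S) \<in> measurable (pair_star M N) (pair_star M N)"
      unfolding map_prod_def split_beta' pair_star_def by measurable
    then have "map_prod (map_star M T) (map_star N S) \<in> measurable \<rho> (P \<Otimes>\<^sub>M Q)"
      using measurable_cong_sets[OF \<rho>(2) PQ] by simp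
    then show "prob_space (distr \<rho> (P \<Otimes>\<^sub>M Q) (map_prod (map_star M T) (map_star N S)))"
      by (rule prob_space.prob_space_distr[OF \<rho>(1)])
  qed (use \<rho> PQ in auto)
  moreover have "infinitely_divisible M N \<rho>"
    unfolding infinitely_divisible_def
  proof (intro allI impI)
    fix n :: nat assume n: "1 \<le> n"
    let ?r = "ennreal (1 / real n)"
    obtain \<sigma> where \<sigma>: "prob_space \<sigma>" "sets \<sigma> = sets (pair_star M N)"
      and lap': "\<And>As Bs. set As \<subseteq> sets M \<Longrightarrow> set Bs \<subseteq> sets N \<Longrightarrow>
        laplace As Bs \<sigma> = nexp (exponent (scale_measure ?r J) (scale_measure ?r ?M') (scale_measure ?r ?N') As Bs)"
      using exists_poissonian_law[of "scale_measure ?r J" "scale_measure ?r ?M'" "scale_measure ?r ?N'" M N]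
        sigma_finite_scale_measure[OF J(1), of ?r] sigma_finite_scale_measure[OF sf(1), of ?r]
        sigma_finite_scale_measure[OF sf(2), of ?r] J(2) by auto
    have nr: "of_nat n * ?r = 1"
      using n by (simp add: ennreal_of_nat_eq_real_of_nat flip: ennreal_mult)
    have "\<rho> = conv_power M N \<sigma> n"
    proof (rule pair_star_eqI[OF M N \<rho>(1) conv_power_prob(1)[OF \<sigma>] \<rho>(2) conv_power_prob(2)[OF \<sigma>]])
      fix As Bs assume "set As \<subseteq> finite_sets M" "set Bs \<subseteq> finite_sets N"
      then have AB: "set As \<subseteq> sets M" "set Bs \<subseteq> sets N" using finite_sets_subset by blast+
      have "laplace As Bs (conv_power M N \<sigma> n) = nexp (of_nat n * (?r * exponent J ?M' ?N' As Bs))"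
        unfolding laplace_conv_power[OF \<sigma> AB] lap'[OF AB] nexp_power
          exponent_scale[OF J(2) sets_scale_measure sets_scale_measure AB] ..
      then show "laplace As Bs \<rho> = laplace As Bs (conv_power M N \<sigma> n)"
        by (simp add: lap[OF AB] nr flip: mult.assoc)
    qed
    then show "\<exists>\<sigma>. prob_space \<sigma> \<and> sets \<sigma> = sets (pair_star M N) \<and> \<rho> = conv_power M N \<sigma> n"
      using \<sigma> by blast
  qed
  ultimately have "poissonian_joining M T P N S Q \<rho>"
    unfolding poissonian_joining_def joining_def using \<rho>(2) by simp
  then show ?thesis using \<rho> lap by blast
qed

lemma dynamical_systemD:
  assumes "dynamical_system M T"
  shows "sigma_finite_measure M" "T \<in> measurable M M" "distr M M T = M" "emeasure M (space M) = \<infinity>"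
  using assms by (auto simp: dynamical_system_def sigma_finite_lebesgue_space_def automorphism_def)

lemma laplace_product_poisson:
  assumes P: "poisson_measure M P" and Q: "poisson_measure N Q"
    and AB: "set As \<subseteq> finite_sets M" "set Bs \<subseteq> finite_sets N"
  shows "laplace As Bs (P \<Otimes>\<^sub>M Q) = nexp ((\<integral>\<^sup>+x. 1 - nexp (cover_count As x) \<partial>M) + (\<integral>\<^sup>+y. 1 - nexp (cover_count Bs y) \<partial>N))"
proof -
  have "set As \<subseteq> sets M" "set Bs \<subseteq> sets N" using AB finite_sets_subset by blast+
  then show ?thesis
    by (simp add: laplace_pair_measure[OF poisson_prob[OF Q] poisson_sets[OF P] poisson_sets[OF Q]]
        poisson_laplace[OF P AB(1)] poisson_laplace[OF Q AB(2)] nexp_add)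
qed

lemma poisson_product_sets:
  assumes P: "poisson_measure M P" and Q: "poisson_measure N Q"
  shows "sets (P \<Otimes>\<^sub>M Q) = sets (pair_star M N)"
  unfolding pair_star_def using poisson_sets[OF P] poisson_sets[OF Q] by (rule sets_pair_measure_cong)

lemma poisson_product_prob:
  assumes P: "poisson_measure M P" and Q: "poisson_measure N Q"
  shows "prob_space (P \<Otimes>\<^sub>M Q)"
  using poisson_prob[OF P] poisson_prob[OF Q] by (rule prob_space_pair)

text \<open>
  The product is the case without common jumps.
\<close>

lemma product_poissonian_joining:
  assumes "dynamical_system M T" "dynamical_system N S"
    and P: "poisson_measure M P" and Q: "poisson_measure N Q"
  shows "poissonian_joining M T P N S Q (P \<Otimes>\<^sub>M Q)"
proof -
  note M = dynamical_systemD[OF assms(1)] and N = dynamical_systemD[OF assms(2)]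
  define J where "J = null_measure (M \<Otimes>\<^sub>M N)"
  have Js: "sets J = sets (M \<Otimes>\<^sub>M N)" by (simp add: J_def)
  have d: "distr J K f = null_measure K" if "f \<in> measurable (M \<Otimes>\<^sub>M N) K" for K :: "'c measure" and f
    by (rule measure_eqI) (use measurable_domain_cong[OF that Js] in \<open>auto simp: J_def emeasure_distr\<close>)
  have "sigma_finite_measure J"
    by (rule finite_measure.axioms(1), rule finite_measureI) (simp add: J_def)
  moreover have "distr J M fst = scale_measure (ennreal 0) M" "distr J N snd = scale_measure (ennreal 0) N"
    by (simp_all add: d)
  moreover have "map_prod T S \<in> measurable (M \<Otimes>\<^sub>M N) (M \<Otimes>\<^sub>M N)"
    using M(2) N(2) by (simp add: map_prod_def split_beta')
  then have "distr J (M \<Otimes>\<^sub>M N) (map_prod T S) = J" using d by (simp add: J_def)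
  ultimately obtain \<rho> where \<rho>: "poissonian_joining M T P N S Q \<rho>" "sets \<rho> = sets (pair_star M N)" "prob_space \<rho>"
    and lap: "\<And>As Bs. set As \<subseteq> sets M \<Longrightarrow> set Bs \<subseteq> sets N \<Longrightarrow>
      laplace As Bs \<rho> = nexp (exponent J (scale_measure (ennreal (1 - 0)) M) (scale_measure (ennreal (1 - 0)) N) As Bs)"
    using exists_poissonian_joining[OF M(1) N(1) M(2,3) N(2,3) P Q _ Js, of 0 0] by auto
  have "\<rho> = P \<Otimes>\<^sub>M Q"
  proof (rule pair_star_eqI[OF M(1) N(1) \<rho>(3) poisson_product_prob[OF P Q] \<rho>(2) poisson_product_sets[OF P Q]])
    fix As Bs assume AB: "set As \<subseteq> finite_sets M" "set Bs \<subseteq> finite_sets N"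
    then have "set As \<subseteq> sets M" "set Bs \<subseteq> sets N" using finite_sets_subset by blast+
    then show "laplace As Bs \<rho> = laplace As Bs (P \<Otimes>\<^sub>M Q)"
      by (simp add: lap laplace_product_poisson[OF P Q AB] exponent_def J_def)
  qed
  then show ?thesis using \<rho>(1) by simp
qed

lemma finite_exhaustion:
  assumes "sigma_finite_measure M"
  obtains X :: "nat \<Rightarrow> 'a set" where "range X \<subseteq> finite_sets M" "incseq X" "(\<Union>i. X i) = space M"
proof -
  obtain X :: "nat \<Rightarrow> _" where "range X \<subseteq> sets M" "(\<Union>i. X i) = space M"
      "\<And>i. emeasure M (X i) \<noteq> \<infinity>" "incseq X"
    using sigma_finite_measure.sigma_finite_incseq[OF assms] by metis
  then show ?thesis using that[of X] by (auto simp: finite_sets_def less_top[symmetric])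
qed

lemma null_if_null_on_finite_rectangles:
  assumes M: "sigma_finite_measure M" and N: "sigma_finite_measure N" and J: "sets J = sets (M \<Otimes>\<^sub>M N)"
    and z: "\<And>A B. A \<in> finite_sets M \<Longrightarrow> B \<in> finite_sets N \<Longrightarrow> emeasure J (A \<times> B) = 0"
  shows "emeasure J (space J) = 0"
proof -
  obtain X :: "nat \<Rightarrow> _" where X: "range X \<subseteq> finite_sets M" "(\<Union>i. X i) = space M"
    using finite_exhaustion[OF M] by metis
  obtain Y :: "nat \<Rightarrow> _" where Y: "range Y \<subseteq> finite_sets N" "(\<Union>i. Y i) = space N"
    using finite_exhaustion[OF N] by metis
  have "X i \<times> Y j \<in> sets J" for i j
  proof -
    have "X i \<in> sets M" using X(1) by (auto intro: finite_setsD(1))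
    moreover have "Y j \<in> sets N" using Y(1) by (auto intro: finite_setsD(1))
    ultimately show ?thesis using J by simp
  qed
  then have "X i \<times> Y j \<in> null_sets J" for i j
    using X Y by (intro null_setsI z) auto
  then have "(\<Union>i. \<Union>j. X i \<times> Y j) \<in> null_sets J" by (intro null_sets_UN') auto
  moreover have "(\<Union>i. \<Union>j. X i \<times> Y j) = space J"
    using sets_eq_imp_space_eq[OF J] by (auto simp: space_pair_measure simp flip: X(2) Y(2))
  ultimately show ?thesis by auto
qed

text \<open>
  This is \<open>(1 - u) (1 - v) = (1 - u) + (1 - v) - (1 - u v)\<close> for \<open>u = nexp (indicator A x)\<close> and
  \<open>v = nexp (indicator B y)\<close>, written without subtracting. Integrated against \<open>J\<close>, it measures by how
  much common jumps lower the exponent.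
\<close>

lemma jump_identity:
  "(1 - nexp (indicator A x + indicator B y)) + (1 - nexp 1) * (1 - nexp 1) * (indicator A x * indicator B y)
    = (1 - nexp (indicator A x)) + (1 - nexp (indicator B y :: ennreal))"
proof -
  define u where "u = exp (- 1 :: real)"
  have "nexp 1 = ennreal u" using nexp_ennreal[of 1] by (simp add: u_def)
  moreover have "0 \<le> u" "u \<le> 1" by (auto simp: u_def)
  moreover have "1 - u * u + (1 - u) * (1 - u) = 1 - u + (1 - u)" "0 \<le> 1 - u * u"
    using \<open>0 \<le> u\<close> \<open>u \<le> 1\<close> mult_le_one[of u u] by (auto simp: algebra_simps)
  ultimately show ?thesis
    by (auto simp: indicator_def nexp_add ennreal_minus simp flip: ennreal_1 ennreal_mult ennreal_plus)
qed

text \<open>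
  If the Poissonian joining built from \<open>J\<close> were the product, both would have the same finite exponent at
  every pair of sets of finite measure, and the correction term in \<open>jump_identity\<close> would force
  \<open>J (A \<times> B) = 0\<close>. But \<open>J\<close> has infinite total mass.
\<close>

theorem ID_disjoint_imp_strongly_disjoint:
  assumes "dynamical_system M T" "dynamical_system N S"
    and P: "poisson_measure M P" and Q: "poisson_measure N Q"
    and disj: "ID_disjoint M T P N S Q"
  shows "strongly_disjoint M T N S"
  unfolding strongly_disjoint_def
proof (intro notI, elim exE conjE)
  note M = dynamical_systemD[OF assms(1)] and N = dynamical_systemD[OF assms(2)]
  fix c1 c2 :: real and J0
  assume c: "0 < c1" "0 < c2"
    and "joining (scale_measure (ennreal c1) M) T (scale_measure (ennreal c2) N) S J0"
  then have J0: "sets J0 = sets (M \<Otimes>\<^sub>M N)" "distr J0 M fst = scale_measure (ennreal c1) M"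
      "distr J0 N snd = scale_measure (ennreal c2) N" "distr J0 (M \<Otimes>\<^sub>M N) (map_prod T S) = J0"
    by (auto simp: joining_def cong: distr_cong sets_pair_measure_cong)
  \<comment> \<open>Any positive constant with \<open>c * c1 \<le> 1\<close> and \<open>c * c2 \<le> 1\<close> would do.\<close>
  define c where "c = 1 / (c1 + c2)"
  define a where "a = c * c1"
  define b where "b = c * c2"
  have c0: "0 < c" using c by (simp add: c_def)
  have ab: "0 \<le> a" "a \<le> 1" "0 \<le> b" "b \<le> 1" using c by (auto simp: a_def b_def c_def)
  have a0: "0 < a" using c c0 by (simp add: a_def)
  define J where "J = scale_measure (ennreal c) J0"
  have Js: "sets J = sets (M \<Otimes>\<^sub>M N)" by (simp add: J_def J0)
  have fst: "fst \<in> measurable J0 M" "snd \<in> measurable J0 N" "map_prod T S \<in> measurable J0 (M \<Otimes>\<^sub>M N)"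
    using M(2) N(2) by (auto intro!: measurable_domain_cong[OF _ J0(1)] simp: map_prod_def split_beta')
  have JM: "distr J M fst = scale_measure (ennreal a) M"
    using c c0 by (simp add: J_def distr_scale_measure[OF fst(1)] J0 a_def ennreal_mult)
  have JN: "distr J N snd = scale_measure (ennreal b) N"
    using c c0 by (simp add: J_def distr_scale_measure[OF fst(2)] J0 b_def ennreal_mult)
  have JT: "distr J (M \<Otimes>\<^sub>M N) (map_prod T S) = J"
    by (simp add: J_def distr_scale_measure[OF fst(3)] J0)
  have fJ: "fst \<in> measurable J M" "snd \<in> measurable J N"
    by (auto intro: measurable_domain_cong[OF _ Js])
  have "sigma_finite_measure (distr J M fst)"
    unfolding JM using M(1) by (rule sigma_finite_scale_measure) simp
  then have Jf: "sigma_finite_measure J" by (rule sigma_finite_measure_distr[OF _ fJ(1)])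
  let ?M' = "scale_measure (ennreal (1 - a)) M" and ?N' = "scale_measure (ennreal (1 - b)) N"
  obtain \<rho> where \<rho>: "poissonian_joining M T P N S Q \<rho>"
    and lap: "\<And>As Bs. set As \<subseteq> sets M \<Longrightarrow> set Bs \<subseteq> sets N \<Longrightarrow> laplace As Bs \<rho> = nexp (exponent J ?M' ?N' As Bs)"
    using exists_poissonian_joining[OF M(1) N(1) M(2,3) N(2,3) P Q Jf Js JM JN JT ab] by auto
  have \<rho>PQ: "\<rho> = P \<Otimes>\<^sub>M Q" using \<rho> disj by (auto simp: ID_disjoint_def)
  have "emeasure J (A \<times> B) = 0" if AB: "A \<in> finite_sets M" "B \<in> finite_sets N" for A B
  proof -
    have ABs [measurable]: "A \<in> sets M" "B \<in> sets N" using AB by (auto dest: finite_setsD)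
    have ABJ: "A \<times> B \<in> sets J" using Js by simp
    let ?k = "1 - nexp 1"
    let ?i = "\<integral>\<^sup>+x. 1 - nexp (indicator A x) \<partial>M" and ?j = "\<integral>\<^sup>+y. 1 - nexp (indicator B y) \<partial>N"
    have iM: "?i \<le> emeasure M A"
      by (subst nn_integral_indicator[symmetric, OF ABs(1)], intro nn_integral_mono) (auto simp: indicator_def)
    have jN: "?j \<le> emeasure N B"
      by (subst nn_integral_indicator[symmetric, OF ABs(2)], intro nn_integral_mono) (auto simp: indicator_def)
    have "nexp (exponent J ?M' ?N' [A] [B]) = nexp (?i + ?j)"
      using lap[of "[A]" "[B]"] laplace_product_poisson[OF P Q, of "[A]" "[B]"] AB by (simp add: \<rho>PQ)
    then have e: "exponent J ?M' ?N' [A] [B] = ?i + ?j" by (rule nexp_inject)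
    note [measurable] = fJ
    have iJ: "(\<integral>\<^sup>+z. 1 - nexp (indicator A (fst z)) \<partial>J) = ennreal a * ?i"
    proof -
      have "(\<integral>\<^sup>+z. 1 - nexp (indicator A (fst z)) \<partial>J) = (\<integral>\<^sup>+x. 1 - nexp (indicator A x) \<partial>distr J M fst)"
        by (subst nn_integral_distr) auto
      then show ?thesis by (simp add: JM nn_integral_scale_measure)
    qed
    have jJ: "(\<integral>\<^sup>+z. 1 - nexp (indicator B (snd z)) \<partial>J) = ennreal b * ?j"
    proof -
      have "(\<integral>\<^sup>+z. 1 - nexp (indicator B (snd z)) \<partial>J) = (\<integral>\<^sup>+x. 1 - nexp (indicator B x) \<partial>distr J N snd)"
        by (subst nn_integral_distr) auto
      then show ?thesis by (simp add: JN nn_integral_scale_measure)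
    qed
    have "(\<integral>\<^sup>+z. 1 - nexp (indicator A (fst z) + indicator B (snd z)) \<partial>J) + ?k * ?k * emeasure J (A \<times> B)
        = (\<integral>\<^sup>+z. (1 - nexp (indicator A (fst z) + indicator B (snd z)))
            + ?k * ?k * (indicator A (fst z) * indicator B (snd z)) \<partial>J)"
    proof -
      have "emeasure J (A \<times> B) = (\<integral>\<^sup>+z. indicator A (fst z) * indicator B (snd z) \<partial>J)"
        by (subst nn_integral_indicator[symmetric, OF ABJ], intro nn_integral_cong) (auto simp: indicator_def)
      then show ?thesis by (simp add: nn_integral_add nn_integral_cmult)
    qed
    also have "\<dots> = ennreal a * ?i + ennreal b * ?j"
      unfolding jump_identity iJ[symmetric] jJ[symmetric] by (rule nn_integral_add) auto
    finally have J1: "(\<integral>\<^sup>+z. 1 - nexp (indicator A (fst z) + indicator B (snd z)) \<partial>J) + ?k * ?k * emeasure J (A \<times> B)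
        = ennreal a * ?i + ennreal b * ?j" .
    have "exponent J ?M' ?N' [A] [B] + ?k * ?k * emeasure J (A \<times> B)
        = ((\<integral>\<^sup>+z. 1 - nexp (indicator A (fst z) + indicator B (snd z)) \<partial>J) + ?k * ?k * emeasure J (A \<times> B))
          + (ennreal (1 - a) * ?i + ennreal (1 - b) * ?j)"
      by (simp add: exponent_def nn_integral_scale_measure ac_simps)
    also have "\<dots> = (ennreal a * ?i + ennreal (1 - a) * ?i) + (ennreal b * ?j + ennreal (1 - b) * ?j)"
      unfolding J1 by (simp add: ac_simps)
    also have "\<dots> = ?i + ?j"
      using ab by (simp flip: distrib_right ennreal_plus)
    finally have "(?i + ?j) + ?k * ?k * emeasure J (A \<times> B) = (?i + ?j) + 0" by (simp add: e)
    moreover have "?i + ?j \<noteq> top"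
      using iM jN AB by (auto simp: finite_sets_def top_unique dest: order_le_less_trans)
    ultimately have "?k * ?k * emeasure J (A \<times> B) = 0"
      unfolding ennreal_add_left_cancel by simp
    moreover have "?k \<noteq> 0"
    proof -
      have "nexp 1 < nexp 0" unfolding nexp_less_iff by simp
      then show ?thesis by (simp add: diff_eq_0_iff_ennreal not_le)
    qed
    ultimately show "emeasure J (A \<times> B) = 0" by simp
  qed
  then have "emeasure J (space J) = 0"
    by (rule null_if_null_on_finite_rectangles[OF M(1) N(1) Js])
  moreover have "emeasure (distr J M fst) (space M) = emeasure J (space J)"
  proof -
    have "fst -` space M \<inter> space J = space J" using measurable_space[OF fJ(1)] by auto
    then show ?thesis by (simp add: emeasure_distr[OF fJ(1)])
  qed
  ultimately show False
    using M(4) a0 by (simp add: JM ennreal_mult_top ennreal_top_mult)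
qed

section \<open>Moments of convolution powers and roots\<close>

lemma mass2_null [simp]: "mass2 As Bs (null_measure M, null_measure N) = 0"
  by (simp add: mass2_def)

lemma moments_convolve:
  assumes \<sigma>: "prob_space \<sigma>" "sets \<sigma> = sets (pair_star M N)" and \<tau>: "prob_space \<tau>" "sets \<tau> = sets (pair_star M N)"
    and AB: "set As \<subseteq> sets M" "set Bs \<subseteq> sets N" and AB': "set As' \<subseteq> sets M" "set Bs' \<subseteq> sets N"
  shows "nn_integral (convolve M N \<sigma> \<tau>) (mass2 As Bs) = nn_integral \<sigma> (mass2 As Bs) + nn_integral \<tau> (mass2 As Bs)"
    and "(\<integral>\<^sup>+p. mass2 As Bs p * mass2 As' Bs' p \<partial>convolve M N \<sigma> \<tau>) =
      (\<integral>\<^sup>+p. mass2 As Bs p * mass2 As' Bs' p \<partial>\<sigma>) +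
      nn_integral \<sigma> (mass2 As Bs) * nn_integral \<tau> (mass2 As' Bs') +
      (nn_integral \<sigma> (mass2 As' Bs') * nn_integral \<tau> (mass2 As Bs) +
      (\<integral>\<^sup>+p. mass2 As Bs p * mass2 As' Bs' p \<partial>\<tau>))"
proof -
  interpret \<sigma>: prob_space \<sigma> by fact
  interpret \<tau>: prob_space \<tau> by fact
  let ?F = "mass2 As Bs" and ?G = "mass2 As' Bs'"
  note m = measurable_mass2[OF AB] measurable_mass2[OF AB']
  note [measurable] = m[THEN measurable_domain_cong, OF \<sigma>(2)] m[THEN measurable_domain_cong, OF \<tau>(2)]
  have sp: "space \<sigma> = space (pair_star M N)" "space \<tau> = space (pair_star M N)"
    using \<sigma> \<tau> by (auto dest: sets_eq_imp_space_eq)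
  have "(\<integral>\<^sup>+p. ?F p \<partial>convolve M N \<sigma> \<tau>) = (\<integral>\<^sup>+p. \<integral>\<^sup>+q. ?F p + ?F q \<partial>\<tau> \<partial>\<sigma>)"
    unfolding nn_integral_convolve[OF \<tau>(1) \<sigma>(2) \<tau>(2) m(1)]
    by (intro nn_integral_cong) (simp add: mass2_pair_add[OF AB] sp)
  then show "(\<integral>\<^sup>+p. ?F p \<partial>convolve M N \<sigma> \<tau>) = (\<integral>\<^sup>+p. ?F p \<partial>\<sigma>) + (\<integral>\<^sup>+p. ?F p \<partial>\<tau>)"
    by (simp add: nn_integral_add \<sigma>.emeasure_space_1 \<tau>.emeasure_space_1)
  have "(\<integral>\<^sup>+p. ?F p * ?G p \<partial>convolve M N \<sigma> \<tau>)
      = (\<integral>\<^sup>+p. \<integral>\<^sup>+q. (?F p * ?G p + ?F p * ?G q) + (?G p * ?F q + ?F q * ?G q) \<partial>\<tau> \<partial>\<sigma>)"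
    unfolding nn_integral_convolve[OF \<tau>(1) \<sigma>(2) \<tau>(2) borel_measurable_times_ennreal[OF m]]
    by (intro nn_integral_cong) (simp add: mass2_pair_add[OF AB] mass2_pair_add[OF AB'] sp algebra_simps)
  then show "(\<integral>\<^sup>+p. ?F p * ?G p \<partial>convolve M N \<sigma> \<tau>) = (\<integral>\<^sup>+p. ?F p * ?G p \<partial>\<sigma>) +
      (\<integral>\<^sup>+p. ?F p \<partial>\<sigma>) * (\<integral>\<^sup>+p. ?G p \<partial>\<tau>) +
      ((\<integral>\<^sup>+p. ?G p \<partial>\<sigma>) * (\<integral>\<^sup>+p. ?F p \<partial>\<tau>) + (\<integral>\<^sup>+p. ?F p * ?G p \<partial>\<tau>))"
    by (simp add: nn_integral_add nn_integral_cmult nn_integral_multc \<sigma>.emeasure_space_1 \<tau>.emeasure_space_1)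
qed

text \<open>
  The product of two sums of \<open>n\<close> independent terms has \<open>n\<close> diagonal and \<open>n (n - 1)\<close> off-diagonal products.
\<close>

lemma moments_conv_power:
  assumes \<sigma>: "prob_space \<sigma>" "sets \<sigma> = sets (pair_star M N)"
    and AB: "set As \<subseteq> sets M" "set Bs \<subseteq> sets N" and AB': "set As' \<subseteq> sets M" "set Bs' \<subseteq> sets N"
  shows mean_conv_power: "nn_integral (conv_power M N \<sigma> n) (mass2 As Bs) = of_nat n * nn_integral \<sigma> (mass2 As Bs)"
    and "(\<integral>\<^sup>+p. mass2 As Bs p * mass2 As' Bs' p \<partial>conv_power M N \<sigma> n) =
      of_nat n * (\<integral>\<^sup>+p. mass2 As Bs p * mass2 As' Bs' p \<partial>\<sigma>) +
      of_nat (n * (n - 1)) * (nn_integral \<sigma> (mass2 As Bs) * nn_integral \<sigma> (mass2 As' Bs'))"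
proof -
  have mean: "nn_integral (conv_power M N \<sigma> n) (mass2 As Bs) = of_nat n * nn_integral \<sigma> (mass2 As Bs)"
    if AB: "set As \<subseteq> sets M" "set Bs \<subseteq> sets N" for As Bs n
  proof (induction n)
    case 0
    show ?case by (simp add: nn_integral_return[OF null_pair_in_space measurable_mass2[OF AB]])
  next
    case (Suc n)
    then show ?case
      by (simp add: moments_convolve(1)[OF \<sigma> conv_power_prob[OF \<sigma>] AB AB] distrib_right)
  qed
  then show "nn_integral (conv_power M N \<sigma> n) (mass2 As Bs) = of_nat n * nn_integral \<sigma> (mass2 As Bs)"
    using AB by blast
  show "(\<integral>\<^sup>+p. mass2 As Bs p * mass2 As' Bs' p \<partial>conv_power M N \<sigma> n) =
      of_nat n * (\<integral>\<^sup>+p. mass2 As Bs p * mass2 As' Bs' p \<partial>\<sigma>) +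
      of_nat (n * (n - 1)) * (nn_integral \<sigma> (mass2 As Bs) * nn_integral \<sigma> (mass2 As' Bs'))"
  proof (induction n)
    case 0
    show ?case
      by (simp add: nn_integral_return[OF null_pair_in_space borel_measurable_times_ennreal[OF measurable_mass2[OF AB] measurable_mass2[OF AB']]])
  next
    case (Suc n)
    let ?f = "nn_integral \<sigma> (mass2 As Bs)" and ?g = "nn_integral \<sigma> (mass2 As' Bs')"
      and ?h = "\<integral>\<^sup>+p. mass2 As Bs p * mass2 As' Bs' p \<partial>\<sigma>"
    have "(\<integral>\<^sup>+p. mass2 As Bs p * mass2 As' Bs' p \<partial>conv_power M N \<sigma> (Suc n))
      = ?h + ?f * (of_nat n * ?g) + (?g * (of_nat n * ?f) + (of_nat n * ?h + of_nat (n * (n - 1)) * (?f * ?g)))"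
      by (simp only: conv_power.simps moments_convolve(2)[OF \<sigma> conv_power_prob[OF \<sigma>] AB AB'] mean[OF AB] mean[OF AB'] Suc)
    also have "\<dots> = (1 + of_nat n) * ?h + (of_nat n + of_nat n + of_nat (n * (n - 1))) * (?f * ?g)"
      by (simp only: distrib_left distrib_right mult_1_left ac_simps)
    also have "of_nat n + of_nat n + of_nat (n * (n - 1)) = (of_nat (Suc n * (Suc n - 1)) :: ennreal)"
      by (cases n) (simp_all only: of_nat_add[symmetric], simp_all add: algebra_simps)
    finally show ?case by simp
  qed
qed

text \<open>
  Adding an independent copy that vanishes with positive probability cannot repair a non-integral value.
\<close>

lemma convolution_root_AE_nat:
  assumes \<sigma>: "prob_space \<sigma>" "sets \<sigma> = sets (pair_star M N)" and n: "1 \<le> n"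
    and AB: "set As \<subseteq> sets M" "set Bs \<subseteq> sets N"
    and nat: "AE p in conv_power M N \<sigma> n. \<exists>k. mass2 As Bs p = of_nat k"
    and pos: "\<not> (AE p in conv_power M N \<sigma> n. mass2 As Bs p \<noteq> 0)"
  shows "AE p in \<sigma>. \<exists>k. mass2 As Bs p = of_nat k"
proof -
  obtain k where k: "n = Suc k" using n by (cases n) auto
  define \<tau> where "\<tau> = conv_power M N \<sigma> k"
  have \<tau>: "prob_space \<tau>" "sets \<tau> = sets (pair_star M N)"
    unfolding \<tau>_def by (rule conv_power_prob[OF \<sigma>])+
  let ?F = "mass2 As Bs"
  define D :: "ennreal \<Rightarrow> ennreal" where "D = indicator (- range of_nat)"
  define Z :: "ennreal \<Rightarrow> ennreal" where "Z = indicator {0}"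
  have "range of_nat \<in> sets (borel :: ennreal measure)" by (rule sets.countable) auto
  then have D [measurable]: "D \<in> borel_measurable borel" unfolding D_def by (intro borel_measurable_indicator) auto
  have Z [measurable]: "Z \<in> borel_measurable borel" unfolding Z_def by measurable
  have sp: "space \<sigma> = space (pair_star M N)" "space \<tau> = space (pair_star M N)"
    using \<sigma> \<tau> by (auto dest: sets_eq_imp_space_eq)
  note m [measurable] = measurable_mass2[OF AB]
  note [measurable] = m[THEN measurable_domain_cong, OF \<sigma>(2)] m[THEN measurable_domain_cong, OF \<tau>(2)]
  let ?\<rho> = "convolve M N \<sigma> \<tau>"
  have m\<rho> [measurable]: "?F \<in> borel_measurable ?\<rho>" by (rule measurable_domain_cong[OF m]) simp
  have int: "(\<integral>\<^sup>+p. h (?F p) \<partial>?\<rho>) = (\<integral>\<^sup>+p. \<integral>\<^sup>+q. h (?F p + ?F q) \<partial>\<tau> \<partial>\<sigma>)"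
    if [measurable]: "h \<in> borel_measurable borel" for h :: "ennreal \<Rightarrow> ennreal"
  proof -
    have "(\<lambda>p. h (?F p)) \<in> borel_measurable (pair_star M N)" by measurable
    then show ?thesis
      unfolding nn_integral_convolve[OF \<tau>(1) \<sigma>(2) \<tau>(2) \<open>(\<lambda>p. h (?F p)) \<in> _\<close>]
      by (intro nn_integral_cong) (simp add: mass2_pair_add[OF AB] sp)
  qed
  \<comment> \<open>The sum of the two summands vanishes only if both do, so each vanishes with positive probability.\<close>
  have "(\<integral>\<^sup>+p. Z (?F p) \<partial>?\<rho>) \<noteq> 0"
  proof
    assume "(\<integral>\<^sup>+p. Z (?F p) \<partial>?\<rho>) = 0"
    then have "AE p in ?\<rho>. Z (?F p) = 0" by (subst (asm) nn_integral_0_iff_AE) auto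
    then have "AE p in ?\<rho>. ?F p \<noteq> 0" by eventually_elim (auto simp: Z_def)
    then have "AE p in conv_power M N \<sigma> n. ?F p \<noteq> 0" by (simp only: k \<tau>_def conv_power.simps)
    then show False by (rule notE[OF pos])
  qed
  moreover have "(\<integral>\<^sup>+p. Z (?F p) \<partial>?\<rho>) = (\<integral>\<^sup>+p. Z (?F p) \<partial>\<sigma>) * (\<integral>\<^sup>+p. Z (?F p) \<partial>\<tau>)"
  proof -
    have "Z (x + y) = Z x * Z y" for x y by (auto simp: Z_def indicator_def)
    then show ?thesis unfolding int[OF Z] by (simp add: nn_integral_cmult nn_integral_multc)
  qed
  ultimately have pos': "(\<integral>\<^sup>+p. Z (?F p) \<partial>\<tau>) \<noteq> 0" by auto
  have "(\<integral>\<^sup>+p. D (?F p) \<partial>\<sigma>) * (\<integral>\<^sup>+p. Z (?F p) \<partial>\<tau>) = (\<integral>\<^sup>+p. \<integral>\<^sup>+q. D (?F p) * Z (?F q) \<partial>\<tau> \<partial>\<sigma>)"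
    by (simp add: nn_integral_cmult nn_integral_multc)
  also have "\<dots> \<le> (\<integral>\<^sup>+p. \<integral>\<^sup>+q. D (?F p + ?F q) \<partial>\<tau> \<partial>\<sigma>)"
    by (intro nn_integral_mono) (auto simp: D_def Z_def indicator_def)
  also have "\<dots> = (\<integral>\<^sup>+p. D (?F p) \<partial>?\<rho>)" by (simp add: int)
  also have "\<dots> = 0"
  proof -
    have "AE p in ?\<rho>. \<exists>j. ?F p = of_nat j" using nat by (simp only: k \<tau>_def conv_power.simps)
    then have "AE p in ?\<rho>. D (?F p) = 0" by eventually_elim (auto simp: D_def)
    moreover have "(\<lambda>p. D (?F p)) \<in> borel_measurable ?\<rho>" by measurable
    ultimately show ?thesis by (simp add: nn_integral_0_iff_AE)
  qed
  finally have "(\<integral>\<^sup>+p. D (?F p) \<partial>\<sigma>) = 0" using pos' by simp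
  then have "AE p in \<sigma>. D (?F p) = 0" by (subst (asm) nn_integral_0_iff_AE) auto
  then show ?thesis by eventually_elim (auto simp: D_def indicator_def split: if_splits)
qed

lemma convolution_root_mean:
  assumes \<sigma>: "prob_space \<sigma>" "sets \<sigma> = sets (pair_star M N)" and n: "1 \<le> n"
    and AB: "set As \<subseteq> sets M" "set Bs \<subseteq> sets N"
    and x: "0 \<le> x" "nn_integral (conv_power M N \<sigma> n) (mass2 As Bs) = ennreal x"
  shows "nn_integral \<sigma> (mass2 As Bs) = ennreal (x / n)"
proof -
  have "of_nat n * nn_integral \<sigma> (mass2 As Bs) = ennreal x"
    using x(2) mean_conv_power[OF \<sigma> AB AB, of n] by simp
  then show ?thesis using n \<open>0 \<le> x\<close>
    by (cases "nn_integral \<sigma> (mass2 As Bs)")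
      (auto simp: ennreal_of_nat_eq_real_of_nat ennreal_mult_top field_simps simp flip: ennreal_mult)
qed

lemma convolution_root_mixed_moment:
  fixes x x' y :: real
  assumes \<sigma>: "prob_space \<sigma>" "sets \<sigma> = sets (pair_star M N)" and n: "1 \<le> n"
    and AB: "set As \<subseteq> sets M" "set Bs \<subseteq> sets N" and AB': "set As' \<subseteq> sets M" "set Bs' \<subseteq> sets N"
    and x: "0 \<le> x" "nn_integral (conv_power M N \<sigma> n) (mass2 As Bs) = ennreal x"
    and x': "0 \<le> x'" "nn_integral (conv_power M N \<sigma> n) (mass2 As' Bs') = ennreal x'"
    and y: "0 \<le> y" "(\<integral>\<^sup>+p. mass2 As Bs p * mass2 As' Bs' p \<partial>conv_power M N \<sigma> n) = ennreal y"
  obtains z :: real where "0 \<le> z" "(\<integral>\<^sup>+p. mass2 As Bs p * mass2 As' Bs' p \<partial>\<sigma>) = ennreal z"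
    "real n * z = y - real (n - 1) / real n * (x * x')"
proof -
  let ?I = "\<integral>\<^sup>+p. mass2 As Bs p * mass2 As' Bs' p \<partial>\<sigma>"
  have "of_nat n * ?I + of_nat (n * (n - 1)) * (ennreal (x / n) * ennreal (x' / n)) = ennreal y"
    using y(2) moments_conv_power(2)[OF \<sigma> AB AB', of n]
    by (simp add: convolution_root_mean[OF \<sigma> n AB x] convolution_root_mean[OF \<sigma> n AB' x'])
  moreover have "of_nat (n * (n - 1)) * (ennreal (x / n) * ennreal (x' / n)) = ennreal (real (n - 1) / real n * (x * x'))"
    using x x' n by (simp add: ennreal_of_nat_eq_real_of_nat flip: ennreal_mult)
  ultimately have e: "of_nat n * ?I + ennreal (real (n - 1) / real n * (x * x')) = ennreal y"
    by simp
  then have "?I \<noteq> top" using n by (auto simp: ennreal_mult_top)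
  then obtain z where z: "0 \<le> z" "?I = ennreal z" by (cases ?I) auto
  have "0 \<le> real (n - 1) / real n * (x * x')" using x x' n by simp
  then have "real n * z + real (n - 1) / real n * (x * x') = y"
    using e z y(1) by (simp add: ennreal_of_nat_eq_real_of_nat flip: ennreal_mult ennreal_plus)
  then show ?thesis using z by (intro that[of z]) auto
qed

text \<open>
  For \<open>j \<ge> 1\<close> this is the arithmetic-geometric inequality for \<open>2 x (j - 1)\<close>, followed by
  \<open>(j - 1)\<^sup>2 \<le> j\<^sup>2 - j\<close>, with the negative terms moved to the other side. It compares \<open>x j\<close> with \<open>x\<close>, at a
  price that involves only the factorial moment \<open>j\<^sup>2 - j\<close>.
\<close>

lemma integer_product_bound:
  fixes x :: ennreal and j k :: nat
  assumes "0 < k"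
  shows "2 * (x * of_nat j) + of_nat k * of_nat j
    \<le> 2 * x + ennreal (1 / real k) * (x * x) + of_nat k * (of_nat j * of_nat j)"
proof (cases "x = top")
  case False
  then obtain r where r: "x = ennreal r" "0 \<le> r" by (cases x) auto
  have "2 * (r * real j) + real k * real j \<le> 2 * r + (1 / real k) * (r * r) + real k * (real j * real j)"
  proof (cases j)
    case (Suc i)
    have "0 \<le> (r - real k * real i)\<^sup>2 / real k + real k * real i" by simp
    also have "\<dots> = (1 / real k) * (r * r) - 2 * r * real i + real k * (real i * real i) + real k * real i"
      using assms by (simp add: power2_eq_square field_simps)
    finally show ?thesis by (simp add: Suc algebra_simps)
  qed (use r in auto)
  then have "ennreal (2 * (r * real j) + real k * real j) \<le> ennreal (2 * r + (1 / real k) * (r * r) + real k * (real j * real j))"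
    by (rule ennreal_leI)
  moreover have "(2 :: ennreal) = ennreal 2" by simp
  ultimately show ?thesis
    by (simp only: r ennreal_of_nat_eq_real_of_nat ennreal_mult[symmetric] ennreal_plus[symmetric]
       of_nat_0_le_iff add_nonneg_nonneg mult_nonneg_nonneg divide_nonneg_nonneg zero_le_one zero_le_numeral)
qed (use assms in \<open>simp add: ennreal_mult_top\<close>)

text \<open>
  Under an \<open>n\<close>-th root both functionals have mean of order \<open>1 / n\<close>, but the factorial second moment of the
  integer-valued one is of order \<open>1 / n\<^sup>2\<close>. So \<open>integer_product_bound\<close> with \<open>k = sqrt n\<close> shows that \<open>n\<close> times the
  mixed moment, which tends to the covariance, is at most \<open>a\<close> up to errors of order \<open>1 / k\<close>.
\<close>

lemma covariance_bounds:
  fixes a b \<kappa> :: real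
  assumes \<rho>: "infinitely_divisible M N \<rho>"
    and AB: "set As \<subseteq> sets M" "set Bs \<subseteq> sets N" and AB': "set As' \<subseteq> sets M" "set Bs' \<subseteq> sets N"
    and nn: "0 \<le> a" "0 \<le> b" "0 \<le> \<kappa>"
    and F: "nn_integral \<rho> (mass2 As Bs) = ennreal a" "(\<integral>\<^sup>+p. mass2 As Bs p * mass2 As Bs p \<partial>\<rho>) = ennreal (a + a * a)"
    and G: "nn_integral \<rho> (mass2 As' Bs') = ennreal b" "(\<integral>\<^sup>+p. mass2 As' Bs' p * mass2 As' Bs' p \<partial>\<rho>) = ennreal (b + b * b)"
    and nat: "AE p in \<rho>. \<exists>k. mass2 As' Bs' p = of_nat k" "\<not> (AE p in \<rho>. mass2 As' Bs' p \<noteq> 0)"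
    and FG: "(\<integral>\<^sup>+p. mass2 As Bs p * mass2 As' Bs' p \<partial>\<rho>) = ennreal \<kappa>"
  shows "\<kappa> - a * b \<le> a"
proof -
  let ?F = "mass2 As Bs" and ?G = "mass2 As' Bs'"
  have bound: "2 * (\<kappa> - a * b) \<le> 2 * a + (a + a * a) / real k + b * b / real k" if k: "0 < k" for k :: nat
  proof -
    define n where "n = k * k"
    have n: "1 \<le> n" using k by (simp add: n_def)
    obtain \<sigma> where \<sigma>: "prob_space \<sigma>" "sets \<sigma> = sets (pair_star M N)" and \<rho>\<sigma>: "\<rho> = conv_power M N \<sigma> n"
      using \<rho> n unfolding infinitely_divisible_def by blast
    note [measurable] = measurable_domain_cong[OF measurable_mass2[OF AB] \<sigma>(2)] measurable_domain_cong[OF measurable_mass2[OF AB'] \<sigma>(2)]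
    note root = \<sigma> n and mom = F[unfolded \<rho>\<sigma>] G[unfolded \<rho>\<sigma>] FG[unfolded \<rho>\<sigma>]
    note fg = convolution_root_mean[OF root AB nn(1) mom(1)] convolution_root_mean[OF root AB' nn(2) mom(3)]
    have nn': "0 \<le> a + a * a" "0 \<le> b + b * b" using nn by auto
    obtain z :: real where z: "0 \<le> z" "(\<integral>\<^sup>+p. ?F p * ?G p \<partial>\<sigma>) = ennreal z" "real n * z = \<kappa> - real (n - 1) / real n * (a * b)"
      by (rule convolution_root_mixed_moment[OF root AB AB' nn(1) mom(1) nn(2) mom(3) nn(3) mom(5)])
    obtain u :: real where u: "0 \<le> u" "(\<integral>\<^sup>+p. ?F p * ?F p \<partial>\<sigma>) = ennreal u" "real n * u = a + a * a - real (n - 1) / real n * (a * a)"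
      by (rule convolution_root_mixed_moment[OF root AB AB nn(1) mom(1) nn(1) mom(1) nn'(1) mom(2)])
    obtain v :: real where v: "0 \<le> v" "(\<integral>\<^sup>+p. ?G p * ?G p \<partial>\<sigma>) = ennreal v" "real n * v = b + b * b - real (n - 1) / real n * (b * b)"
      by (rule convolution_root_mixed_moment[OF root AB' AB' nn(2) mom(3) nn(2) mom(3) nn'(2) mom(4)])
    have natG: "AE p in \<sigma>. \<exists>k. ?G p = of_nat k"
      by (rule convolution_root_AE_nat[OF \<sigma> n AB' nat[unfolded \<rho>\<sigma>]])
    have "(\<integral>\<^sup>+p. 2 * (?F p * ?G p) + of_nat k * ?G p \<partial>\<sigma>)
        \<le> (\<integral>\<^sup>+p. 2 * ?F p + ennreal (1 / real k) * (?F p * ?F p) + of_nat k * (?G p * ?G p) \<partial>\<sigma>)"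
      using natG by (intro nn_integral_mono_AE, eventually_elim) (auto intro!: integer_product_bound k)
    then have "2 * ennreal z + of_nat k * ennreal (b / n) \<le> 2 * ennreal (a / n) + ennreal (1 / real k) * ennreal u + of_nat k * ennreal v"
      by (simp add: nn_integral_add nn_integral_cmult z u v fg)
    moreover have "(2 :: ennreal) = ennreal 2" by simp
    ultimately have "ennreal (2 * z + k * (b / n)) \<le> ennreal (2 * (a / n) + 1 / k * u + k * v)"
      using z u v nn by (simp only: ennreal_of_nat_eq_real_of_nat ennreal_mult[symmetric] ennreal_plus[symmetric]
       of_nat_0_le_iff add_nonneg_nonneg mult_nonneg_nonneg divide_nonneg_nonneg zero_le_one zero_le_numeral)
    then have "2 * z + k * (b / n) \<le> 2 * (a / n) + 1 / k * u + k * v"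
      using z u v nn by (subst (asm) ennreal_le_iff) auto
    then have "n * (2 * z + k * (b / n)) \<le> n * (2 * (a / n) + 1 / k * u + k * v)"
      by (rule mult_left_mono) simp
    then have "2 * (n * z) + k * b \<le> 2 * a + 1 / k * (n * u) + k * (n * v)"
      using n by (simp add: algebra_simps)
    then have "2 * (\<kappa> - (n - 1) / n * (a * b)) + k * b \<le> 2 * a + 1 / k * (a + a * a - (n - 1) / n * (a * a)) + k * (b + b * b - (n - 1) / n * (b * b))"
      unfolding z(3) u(3) v(3) .
    moreover have "(n - 1) / n * (a * b) \<le> a * b" "0 \<le> (n - 1) / n * (a * a)"
      using n nn mult_right_mono[of "(n - 1) / n" 1 "a * b"] by auto
    moreover have "k * (b + b * b - (n - 1) / n * (b * b)) = k * b + b * b / k"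
      using k by (simp add: n_def of_nat_diff field_simps)
    moreover have "1 / k * (a + a * a - (n - 1) / n * (a * a)) \<le> (a + a * a) / k"
      using calculation(3) k by (simp add: divide_right_mono)
    moreover have arith: "2 * (\<kappa> - c) \<le> d + y + x"
      if "2 * (\<kappa> - q) + kb \<le> d + e + f" "q \<le> c" "f = kb + x" "e \<le> y" for q kb c d e f x y :: real
      using that by (simp add: algebra_simps)
    ultimately show ?thesis by blast
  qed
  have "((\<lambda>k. 2 * a + (a + a * a) / real k + b * b / real k) \<longlonglongrightarrow> 2 * a + 0 + 0)"
    by (intro tendsto_intros lim_const_over_n)
  then have "2 * (\<kappa> - a * b) \<le> 2 * a + 0 + 0"
  proof (rule tendsto_lowerbound)
    show "eventually (\<lambda>k. 2 * (\<kappa> - a * b) \<le> 2 * a + (a + a * a) / real k + b * b / real k) sequentially"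
      by (rule eventually_sequentiallyI[of 1], rule bound) simp
  qed simp
  then show ?thesis by simp
qed

section \<open>Nearly independent functionals\<close>

lemma enn2real_power: "enn2real (x ^ n) = enn2real x ^ n"
  by (induction n) (simp_all add: enn2real_mult)

lemma laplace_le_1:
  assumes "prob_space \<sigma>"
  shows "laplace As Bs \<sigma> \<le> 1"
proof -
  have "laplace As Bs \<sigma> \<le> (\<integral>\<^sup>+p. 1 \<partial>\<sigma>)" unfolding laplace_def by (intro nn_integral_mono) simp
  then show ?thesis using prob_space.emeasure_space_1[OF assms] by simp
qed

lemma one_minus_nexp_le: "ennreal (1 - enn2real (nexp x)) \<le> x"
proof (cases x)
  case (real r)
  then show ?thesis using exp_ge_add_one_self[of "- r"] by (simp add: nexp_ennreal ennreal_leI)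
qed simp

text \<open>
  With \<open>u = exp (- F)\<close> and \<open>v = exp (- G)\<close>, the covariance of \<open>u\<close> and \<open>v\<close> is that of \<open>1 - u\<close> and \<open>1 - v\<close>, and
  \<open>1 - exp (- x) \<le> x\<close> bounds both the mean of \<open>(1 - u) (1 - v)\<close> and the product of the means.
\<close>

lemma laplace_defect_le:
  fixes F G :: "'w \<Rightarrow> ennreal"
  assumes "prob_space \<sigma>" and [measurable]: "F \<in> borel_measurable \<sigma>" "G \<in> borel_measurable \<sigma>"
    and fg: "0 \<le> f" "0 \<le> g"
    and F: "nn_integral \<sigma> F = ennreal f" and G: "nn_integral \<sigma> G = ennreal g"
    and FG: "(\<integral>\<^sup>+p. F p * G p \<partial>\<sigma>) = ennreal (f * g)"
  shows "\<bar>enn2real (\<integral>\<^sup>+p. nexp (F p + G p) \<partial>\<sigma>)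
    - enn2real (\<integral>\<^sup>+p. nexp (F p) \<partial>\<sigma>) * enn2real (\<integral>\<^sup>+p. nexp (G p) \<partial>\<sigma>)\<bar> \<le> f * g"
proof -
  interpret prob_space \<sigma> by fact
  define u where "u p = enn2real (nexp (F p))" for p
  define v where "v p = enn2real (nexp (G p))" for p
  have [measurable]: "u \<in> borel_measurable \<sigma>" "v \<in> borel_measurable \<sigma>"
    unfolding u_def[abs_def] v_def[abs_def] by measurable
  have u01: "0 \<le> u p" "u p \<le> 1" and v01: "0 \<le> v p" "v p \<le> 1" for p
    by (auto simp: u_def v_def enn2real_nexp_le_1)
  have iu: "integrable \<sigma> u" and iv: "integrable \<sigma> v" and iuv: "integrable \<sigma> (\<lambda>p. u p * v p)"
    using u01 v01 by (auto intro!: integrable_const_bound[where B=1] simp: mult_le_one)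
  let ?a = "expectation u" and ?b = "expectation v" and ?c = "expectation (\<lambda>p. u p * v p)"
  have lap: "enn2real (\<integral>\<^sup>+p. nexp (F p) \<partial>\<sigma>) = ?a" "enn2real (\<integral>\<^sup>+p. nexp (G p) \<partial>\<sigma>) = ?b"
      "enn2real (\<integral>\<^sup>+p. nexp (F p + G p) \<partial>\<sigma>) = ?c"
    using u01 v01 by (subst integral_eq_nn_integral; auto simp: u_def v_def nexp_add ennreal_mult)+
  have one: "1 - expectation w \<le> x"
    if w: "integrable \<sigma> w" "\<And>p. w p \<le> 1" "\<And>p. ennreal (1 - w p) \<le> H p" and H: "nn_integral \<sigma> H = ennreal x" "0 \<le> x"
    for w H x
  proof -
    have "ennreal (1 - expectation w) = (\<integral>\<^sup>+p. ennreal (1 - w p) \<partial>\<sigma>)"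
      using w by (subst nn_integral_eq_integral) (auto simp: prob_space)
    also have "\<dots> \<le> ennreal x" unfolding H(1)[symmetric] by (intro nn_integral_mono w)
    finally show ?thesis using H(2) by (simp add: ennreal_le_iff)
  qed
  have "1 - ?a \<le> f" by (rule one[OF iu u01(2) _ F fg(1)]) (simp add: u_def one_minus_nexp_le)
  moreover have "1 - ?b \<le> g" by (rule one[OF iv v01(2) _ G fg(2)]) (simp add: v_def one_minus_nexp_le)
  moreover have "?a \<le> 1" "?b \<le> 1"
    using u01 v01 iu iv by (auto intro!: integral_le_const AE_I2)
  ultimately have ab: "0 \<le> 1 - ?a" "1 - ?a \<le> f" "0 \<le> 1 - ?b" "1 - ?b \<le> g" by auto
  define D where "D = expectation (\<lambda>p. (1 - u p) * (1 - v p))"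
  have D0: "0 \<le> D" unfolding D_def using u01 v01 by (intro Bochner_Integration.integral_nonneg) auto
  have "ennreal D = (\<integral>\<^sup>+p. ennreal ((1 - u p) * (1 - v p)) \<partial>\<sigma>)"
    unfolding D_def using u01 v01
    by (intro nn_integral_eq_integral[symmetric] integrable_const_bound[where B=1])
      (auto simp: mult_le_one abs_mult)
  also have "\<dots> \<le> ennreal (f * g)"
    unfolding FG[symmetric] using u01 v01
    by (intro nn_integral_mono) (auto simp: u_def v_def ennreal_mult enn2real_nexp_le_1 intro!: mult_mono one_minus_nexp_le)
  finally have D1: "D \<le> f * g" using fg by (simp add: ennreal_le_iff)
  have "D = expectation (\<lambda>p. (1 - u p - v p) + u p * v p)"
    unfolding D_def by (intro Bochner_Integration.integral_cong) (auto simp: algebra_simps)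
  then have "D = 1 - ?a - ?b + ?c" using iu iv iuv by (simp add: prob_space)
  then have "?c - ?a * ?b = D - (1 - ?a) * (1 - ?b)" by (simp add: algebra_simps)
  moreover have "0 \<le> (1 - ?a) * (1 - ?b)" "(1 - ?a) * (1 - ?b) \<le> f * g"
    using ab fg by (auto intro!: mult_mono mult_nonneg_nonneg simp del: diff_ge_0_iff_ge)
  ultimately show ?thesis unfolding lap using D0 D1 by linarith
qed

section \<open>Measures on the product space given by their values on rectangles\<close>

abbreviation mean_fst :: "('a measure \<times> 'b measure) measure \<Rightarrow> 'a set \<Rightarrow> ennreal" where
  "mean_fst \<rho> A \<equiv> \<integral>\<^sup>+p. emeasure (fst p) A \<partial>\<rho>"

abbreviation mean_snd :: "('a measure \<times> 'b measure) measure \<Rightarrow> 'b set \<Rightarrow> ennreal" where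
  "mean_snd \<rho> B \<equiv> \<integral>\<^sup>+p. emeasure (snd p) B \<partial>\<rho>"

abbreviation mixed_moment :: "('a measure \<times> 'b measure) measure \<Rightarrow> 'a set \<Rightarrow> 'b set \<Rightarrow> ennreal" where
  "mixed_moment \<rho> A B \<equiv> \<integral>\<^sup>+p. emeasure (fst p) A * emeasure (snd p) B \<partial>\<rho>"

lemma finite_rectangle_exhaustion:
  fixes M :: "'a measure" and N :: "'b measure"
  assumes M: "sigma_finite_measure M" and N: "sigma_finite_measure N"
  obtains X :: "nat \<Rightarrow> 'a set" and Y :: "nat \<Rightarrow> 'b set" where "\<And>i. X i \<in> finite_sets M" "\<And>i. Y i \<in> finite_sets N"
    "(\<Union>i. Y i) = space N" "incseq (\<lambda>i. X i \<times> Y i)" "(\<Union>i. X i \<times> Y i) = space M \<times> space N"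
proof -
  obtain X :: "nat \<Rightarrow> _" where X: "range X \<subseteq> finite_sets M" "(\<Union>i. X i) = space M" "incseq X"
    using finite_exhaustion[OF M] by metis
  obtain Y :: "nat \<Rightarrow> _" where Y: "range Y \<subseteq> finite_sets N" "(\<Union>i. Y i) = space N" "incseq Y"
    using finite_exhaustion[OF N] by metis
  define R where "R i = X i \<times> Y i" for i
  have Rinc: "incseq R" using X(3) Y(3) unfolding R_def incseq_def by blast
  have RU: "(\<Union>i. R i) = space M \<times> space N"
  proof
    show "space M \<times> space N \<subseteq> (\<Union>i. R i)"
    proof safe
      fix x y assume "x \<in> space M" "y \<in> space N"
      then obtain i j where "x \<in> X i" "y \<in> Y j" using X(2) Y(2) by blast
      then have "(x, y) \<in> R (max i j)"
        using incseqD[OF X(3), of i "max i j"] incseqD[OF Y(3), of j "max i j"] by (auto simp: R_def)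
      then show "(x, y) \<in> (\<Union>i. R i)" by blast
    qed
    show "(\<Union>i. R i) \<subseteq> space M \<times> space N" using X(2) Y(2) by (auto simp: R_def)
  qed
  show ?thesis
    using X(1) Y(1,2) Rinc RU by (intro that[of X Y]) (auto simp: R_def[abs_def])
qed

lemma sets_eq_sigma_finite_sets:
  assumes M: "sigma_finite_measure M"
  shows "sets M = sigma_sets (space M) (finite_sets M)"
proof
  obtain X :: "nat \<Rightarrow> _" where X: "range X \<subseteq> finite_sets M" "(\<Union>i. X i) = space M"
    using finite_exhaustion[OF M] by metis
  show "sets M \<subseteq> sigma_sets (space M) (finite_sets M)"
  proof
    fix A assume A: "A \<in> sets M"
    have "A \<inter> X i \<in> finite_sets M" for i
      using emeasure_mono[of "A \<inter> X i" "X i" M] X(1) A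
      by (auto simp: finite_sets_def intro: order_le_less_trans)
    then have "(\<Union>i. A \<inter> X i) \<in> sigma_sets (space M) (finite_sets M)"
      by (intro sigma_sets.Union sigma_sets.Basic)
    moreover have "(\<Union>i. A \<inter> X i) = A" using X(2) sets.sets_into_space[OF A] by auto
    ultimately show "A \<in> sigma_sets (space M) (finite_sets M)" by simp
  qed
  show "sigma_sets (space M) (finite_sets M) \<subseteq> sets M"
    by (intro sets.sigma_sets_subset finite_sets_subset)
qed

lemma measure_eqI_finite_rectangles:
  assumes M: "sigma_finite_measure M" and N: "sigma_finite_measure N"
    and s: "sets K = sets (M \<Otimes>\<^sub>M N)" "sets L = sets (M \<Otimes>\<^sub>M N)"
    and eq: "\<And>A B. A \<in> finite_sets M \<Longrightarrow> B \<in> finite_sets N \<Longrightarrow> emeasure K (A \<times> B) = emeasure L (A \<times> B)"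
    and fin: "\<And>A B. A \<in> finite_sets M \<Longrightarrow> B \<in> finite_sets N \<Longrightarrow> emeasure K (A \<times> B) \<noteq> \<infinity>"
  shows "K = L"
proof -
  obtain X :: "nat \<Rightarrow> _" where X: "range X \<subseteq> finite_sets M" "(\<Union>i. X i) = space M"
    using finite_exhaustion[OF M] by metis
  obtain Y :: "nat \<Rightarrow> _" where Y: "range Y \<subseteq> finite_sets N" "(\<Union>i. Y i) = space N"
    using finite_exhaustion[OF N] by metis
  obtain X' :: "nat \<Rightarrow> _" and Y' :: "nat \<Rightarrow> _" where XY: "\<And>i. X' i \<in> finite_sets M" "\<And>i. Y' i \<in> finite_sets N"
    and RU: "(\<Union>i. X' i \<times> Y' i) = space M \<times> space N"
    by (rule finite_rectangle_exhaustion[OF M N], rule that)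
  let ?E = "{A \<times> B | A B. A \<in> finite_sets M \<and> B \<in> finite_sets N}"
  have Pow: "finite_sets M \<subseteq> Pow (space M)" "finite_sets N \<subseteq> Pow (space N)"
    using sets.sets_into_space by (auto simp: finite_sets_def)
  have "sets (M \<Otimes>\<^sub>M N) = sets (sigma (space M \<times> space N) ?E)"
    using X Y by (intro sets_pair_eq[OF Pow(1) sets_eq_sigma_finite_sets[OF M] _ _ _ Pow(2) sets_eq_sigma_finite_sets[OF N],
          where Ca="range X" and Cb="range Y"]) auto
  also have "\<dots> = sigma_sets (space M \<times> space N) ?E"
    using Pow by (intro sets_measure_of) auto
  finally have gen: "sets (M \<Otimes>\<^sub>M N) = sigma_sets (space M \<times> space N) ?E" .
  show ?thesis
  proof (rule measure_eqI_generator_eq[where E="?E" and A="\<lambda>i. X' i \<times> Y' i"])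
    show "Int_stable ?E"
    proof (rule Int_stableI)
      fix a b assume "a \<in> ?E" "b \<in> ?E"
      then obtain A B A' B' where ab: "a = A \<times> B" "b = A' \<times> B'" and f: "A \<in> finite_sets M" "B \<in> finite_sets N"
          "A' \<in> finite_sets M" "B' \<in> finite_sets N"
        by auto
      have "A \<inter> A' \<in> finite_sets M" "B \<inter> B' \<in> finite_sets N"
        using f emeasure_mono[of "A \<inter> A'" A M] emeasure_mono[of "B \<inter> B'" B N]
        by (auto simp: finite_sets_def intro: order_le_less_trans)
      then show "a \<inter> b \<in> ?E" unfolding ab Times_Int_Times by blast
    qed
    show "?E \<subseteq> Pow (space M \<times> space N)" using Pow by blast
    show "range (\<lambda>i. X' i \<times> Y' i) \<subseteq> ?E" using XY by blast
    show "emeasure K (X' i \<times> Y' i) \<noteq> \<infinity>" for i using fin XY by blast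
  qed (use gen s RU eq in auto)
qed

text \<open>
  The measure is the mean of the random product measure \<open>\<xi> \<Otimes> \<eta>\<close>. The random measures are sigma-finite only almost
  surely, so the product is replaced by \<open>0\<close> off the event \<open>G\<close> on which the exhausting sets have finite mass. For
  the measurability of \<open>(\<xi> \<Otimes> \<eta>) C\<close> in \<open>(\<xi>, \<eta>)\<close> one starts from rectangles; complements are taken inside
  the rectangles \<open>R i\<close>, where the mass is finite and may be subtracted.
\<close>

lemma exists_mean_product_measure:
  assumes M: "sigma_finite_measure M" and N: "sigma_finite_measure N"
    and \<sigma>: "prob_space \<sigma>" "sets \<sigma> = sets (pair_star M N)"
    and fin: "\<forall>A\<in>finite_sets M. AE p in \<sigma>. emeasure (fst p) A < \<infinity>"
      "\<forall>B\<in>finite_sets N. AE p in \<sigma>. emeasure (snd p) B < \<infinity>"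
  obtains K where "sets K = sets (M \<Otimes>\<^sub>M N)"
    "\<And>A B. A \<in> sets M \<Longrightarrow> B \<in> sets N \<Longrightarrow> emeasure K (A \<times> B) = mixed_moment \<sigma> A B"
proof -
  obtain X :: "nat \<Rightarrow> _" and Y :: "nat \<Rightarrow> _" where XY: "\<And>i. X i \<in> finite_sets M" "\<And>i. Y i \<in> finite_sets N"
    and Y: "(\<Union>i. Y i) = space N" and Rinc: "incseq (\<lambda>i. X i \<times> Y i)" and RU: "(\<Union>i. X i \<times> Y i) = space M \<times> space N"
    by (rule finite_rectangle_exhaustion[OF M N], rule that)
  have XYs [measurable]: "X i \<in> sets M" "Y i \<in> sets N" for i
    using XY by (auto dest: finite_setsD)
  have sp: "space \<sigma> = {\<xi>. sets \<xi> = sets M} \<times> {\<eta>. sets \<eta> = sets N}"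
    using sets_eq_imp_space_eq[OF \<sigma>(2)] by (simp add: space_pair_star)
  have mf: "(\<lambda>p. emeasure (fst p) A) \<in> borel_measurable \<sigma>" if "A \<in> sets M" for A
  proof (rule measurable_domain_cong[OF _ \<sigma>(2)])
    show "(\<lambda>p. emeasure (fst p) A) \<in> borel_measurable (pair_star M N)"
      using measurable_mass2[of "[A]" M "[]" N] that by (simp add: mass2_def[abs_def])
  qed
  have ms: "(\<lambda>p. emeasure (snd p) B) \<in> borel_measurable \<sigma>" if "B \<in> sets N" for B
  proof (rule measurable_domain_cong[OF _ \<sigma>(2)])
    show "(\<lambda>p. emeasure (snd p) B) \<in> borel_measurable (pair_star M N)"
      using measurable_mass2[of "[]" M "[B]" N] that by (simp add: mass2_def[abs_def])
  qed
  define G where "G = {p \<in> space \<sigma>. \<forall>i. emeasure (fst p) (X i) < \<infinity> \<and> emeasure (snd p) (Y i) < \<infinity>}"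
  have G: "G \<in> sets \<sigma>"
  proof -
    have [measurable]: "(\<lambda>p. emeasure (fst p) (X i)) \<in> borel_measurable \<sigma>" "(\<lambda>p. emeasure (snd p) (Y i)) \<in> borel_measurable \<sigma>" for i
      using mf ms XYs by auto
    show ?thesis unfolding G_def by measurable
  qed
  have AEG: "AE p in \<sigma>. p \<in> G"
  proof -
    have "AE p in \<sigma>. \<forall>i. emeasure (fst p) (X i) < \<infinity>" "AE p in \<sigma>. \<forall>i. emeasure (snd p) (Y i) < \<infinity>"
      using fin XY by (auto simp: AE_all_countable)
    then show ?thesis using AE_space by eventually_elim (auto simp: G_def)
  qed
  define R where "R i = X i \<times> Y i" for i
  have Rs: "R i \<in> sets (M \<Otimes>\<^sub>M N)" for i
    unfolding R_def by measurable
  note Rinc = Rinc[folded R_def] and RU = RU[folded R_def]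
  have Gs: "sets (fst p \<Otimes>\<^sub>M snd p) = sets (M \<Otimes>\<^sub>M N)" "sets (fst p) = sets M" "sets (snd p) = sets N" if "p \<in> G" for p
    using that by (auto simp: G_def sp intro: sets_pair_measure_cong)
  have sf: "sigma_finite_measure (snd p)" if "p \<in> G" for p
  proof -
    have "space (snd p) = space N" using sets_eq_imp_space_eq[OF Gs(3)[OF that]] .
    then show ?thesis unfolding sigma_finite_measure_def
      using that Y XYs(2) Gs(3)[OF that] by (intro exI[of _ "range Y"]) (auto simp: G_def less_top)
  qed
  have rect: "emeasure (fst p \<Otimes>\<^sub>M snd p) (A \<times> B) = emeasure (fst p) A * emeasure (snd p) B"
    if "p \<in> G" "A \<in> sets M" "B \<in> sets N" for p A B
    using that Gs[OF that(1)] sigma_finite_measure.emeasure_pair_measure_Times[OF sf[OF that(1)], of A "fst p" B] by simp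
  define h where "h C p = indicator G p * emeasure (fst p \<Otimes>\<^sub>M snd p) C" for C p
  have h_rect: "h (A \<times> B) \<in> borel_measurable \<sigma>" if "A \<in> sets M" "B \<in> sets N" for A B
  proof -
    have "h (A \<times> B) = (\<lambda>p. indicator G p * (emeasure (fst p) A * emeasure (snd p) B))"
      using rect[OF _ that] by (auto simp: h_def indicator_def)
    then show ?thesis using G mf[OF that(1)] ms[OF that(2)] by simp
  qed
  have hm_R: "h (C \<inter> R i) \<in> borel_measurable \<sigma>" if "C \<in> sets (M \<Otimes>\<^sub>M N)" for C i
  proof -
    have "C \<in> sigma_sets (space M \<times> space N) {A \<times> B | A B. A \<in> sets M \<and> B \<in> sets N}"
      using that by (simp add: sets_pair_measure)
    then show ?thesis
    proof (induction rule: sigma_sets_induct_disjoint[OF Int_stable_pair_measure_generator pair_measure_closed, consumes 1, case_names basic empty compl union])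
      case (basic C)
      then obtain A B where "C = A \<times> B" "A \<in> sets M" "B \<in> sets N" by auto
      moreover from this have "C \<inter> R i = (A \<inter> X i) \<times> (B \<inter> Y i)" by (auto simp: R_def)
      ultimately show ?case using h_rect by simp
    next
      case empty
      show ?case by (simp add: h_def[abs_def])
    next
      case (compl C)
      then have C: "C \<in> sets (M \<Otimes>\<^sub>M N)" by (simp add: sets_pair_measure)
      have "h ((space M \<times> space N - C) \<inter> R i) p = h (R i) p - h (C \<inter> R i) p" for p
      proof (cases "p \<in> G")
        case True
        have "(space M \<times> space N - C) \<inter> R i = R i - C \<inter> R i"
          using RU by auto
        moreover have "emeasure (fst p \<Otimes>\<^sub>M snd p) (R i) < top"
          unfolding R_def rect[OF True XYs] using True by (auto simp: G_def ennreal_mult_less_top)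
        then have "emeasure (fst p \<Otimes>\<^sub>M snd p) (C \<inter> R i) \<noteq> \<infinity>"
          using emeasure_mono[of "C \<inter> R i" "R i" "fst p \<Otimes>\<^sub>M snd p"] Rs Gs(1)[OF True]
          by (auto simp: top_unique)
        ultimately show ?thesis
          using True Rs C Gs(1)[OF True] by (simp add: h_def emeasure_Diff)
      qed (simp add: h_def)
      then have "h ((space M \<times> space N - C) \<inter> R i) = (\<lambda>p. h (R i) p - h (C \<inter> R i) p)" by auto
      moreover have "h (R i) \<in> borel_measurable \<sigma>" unfolding R_def by (rule h_rect) measurable
      ultimately show ?case using compl by simp
    next
      case (union C)
      have C: "C j \<in> sets (M \<Otimes>\<^sub>M N)" for j using union by (simp add: sets_pair_measure range_subsetD)
      have "h (\<Union>(range C) \<inter> R i) p = (\<Sum>j. h (C j \<inter> R i) p)" for p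
      proof (cases "p \<in> G")
        case True
        have "(\<Sum>j. emeasure (fst p \<Otimes>\<^sub>M snd p) (C j \<inter> R i)) = emeasure (fst p \<Otimes>\<^sub>M snd p) (\<Union>j. C j \<inter> R i)"
          using union(1) C Rs Gs(1)[OF True] by (intro suminf_emeasure) (auto simp: disjoint_family_on_def)
        moreover have "(\<Union>j. C j \<inter> R i) = \<Union>(range C) \<inter> R i" by auto
        ultimately show ?thesis using True by (simp add: h_def)
      qed (simp add: h_def)
      then have "h (\<Union>(range C) \<inter> R i) = (\<lambda>p. \<Sum>j. h (C j \<inter> R i) p)" by auto
      then show ?case using union by simp
    qed
  qed
  have hm: "h C \<in> borel_measurable \<sigma>" if C: "C \<in> sets (M \<Otimes>\<^sub>M N)" for C
  proof (rule borel_measurable_LIMSEQ_order)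
    show "h (C \<inter> R i) \<in> borel_measurable \<sigma>" for i by (rule hm_R[OF C])
    fix p assume "p \<in> space \<sigma>"
    show "(\<lambda>i. h (C \<inter> R i) p) \<longlonglongrightarrow> h C p"
    proof (cases "p \<in> G")
      case True
      have "(\<lambda>i. emeasure (fst p \<Otimes>\<^sub>M snd p) (C \<inter> R i)) \<longlonglongrightarrow> emeasure (fst p \<Otimes>\<^sub>M snd p) (\<Union>i. C \<inter> R i)"
      proof (rule Lim_emeasure_incseq)
        show "range (\<lambda>i. C \<inter> R i) \<subseteq> sets (fst p \<Otimes>\<^sub>M snd p)" using C Rs Gs(1)[OF True] by auto
        show "incseq (\<lambda>i. C \<inter> R i)" using Rinc by (auto simp: incseq_def)
      qed
      moreover have "(\<Union>i. C \<inter> R i) = C"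
        using RU sets.sets_into_space[OF C] by (auto simp: space_pair_measure)
      ultimately show ?thesis using True by (simp add: h_def)
    qed (simp add: h_def)
  qed
  define K where "K = measure_of (space (M \<Otimes>\<^sub>M N)) (sets (M \<Otimes>\<^sub>M N)) (\<lambda>C. \<integral>\<^sup>+p. h C p \<partial>\<sigma>)"
  have "countably_additive (sets (M \<Otimes>\<^sub>M N)) (\<lambda>C. \<integral>\<^sup>+p. h C p \<partial>\<sigma>)"
    unfolding countably_additive_def
  proof safe
    fix C :: "nat \<Rightarrow> _" assume C: "range C \<subseteq> sets (M \<Otimes>\<^sub>M N)" "disjoint_family C"
    have "(\<Sum>j. \<integral>\<^sup>+p. h (C j) p \<partial>\<sigma>) = (\<integral>\<^sup>+p. (\<Sum>j. h (C j) p) \<partial>\<sigma>)"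
      using C(1) by (intro nn_integral_suminf[symmetric] hm) auto
    also have "\<dots> = (\<integral>\<^sup>+p. h (\<Union>(range C)) p \<partial>\<sigma>)"
    proof (rule nn_integral_cong)
      fix p
      show "(\<Sum>j. h (C j) p) = h (\<Union>(range C)) p"
        using suminf_emeasure[of C "fst p \<Otimes>\<^sub>M snd p"] C Gs(1)[of p]
        by (cases "p \<in> G") (auto simp: h_def)
    qed
    finally show "(\<Sum>j. \<integral>\<^sup>+p. h (C j) p \<partial>\<sigma>) = (\<integral>\<^sup>+p. h (\<Union>(range C)) p \<partial>\<sigma>)" .
  qed
  moreover have "h {} = (\<lambda>_. 0)" by (auto simp: h_def)
  ultimately have Ke: "emeasure K C = (\<integral>\<^sup>+p. h C p \<partial>\<sigma>)" if "C \<in> sets (M \<Otimes>\<^sub>M N)" for C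
    unfolding K_def using that
    by (intro emeasure_measure_of_sigma sets.sigma_algebra_axioms) (simp_all add: positive_def)
  show ?thesis
  proof (rule that[of K])
    show "sets K = sets (M \<Otimes>\<^sub>M N)" by (simp add: K_def)
    fix A B assume AB: "A \<in> sets M" "B \<in> sets N"
    show "emeasure K (A \<times> B) = mixed_moment \<sigma> A B"
      unfolding Ke[OF pair_measureI[OF AB]]
    proof (rule nn_integral_cong_AE)
      show "AE p in \<sigma>. h (A \<times> B) p = emeasure (fst p) A * emeasure (snd p) B"
        using AEG by eventually_elim (simp add: h_def rect AB)
    qed
  qed
qed

section \<open>Dominated and invariant measures\<close>

text \<open>
  The difference is taken on densities: \<open>L\<close> has a density with respect to \<open>K\<close>, which is at most \<open>1\<close> almost
  everywhere. For sigma-finite measures this replaces the subtraction of possibly infinite values.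
\<close>

lemma measure_difference:
  assumes K: "sigma_finite_measure K" and s: "sets L = sets K"
    and le: "\<And>C. C \<in> sets K \<Longrightarrow> emeasure L C \<le> emeasure K C"
  obtains J where "sets J = sets K" "\<And>C. C \<in> sets K \<Longrightarrow> emeasure J C + emeasure L C = emeasure K C"
proof -
  interpret sigma_finite_measure K by fact
  have "absolutely_continuous K L"
    unfolding absolutely_continuous_def
  proof
    fix C assume "C \<in> null_sets K"
    then show "C \<in> null_sets L" using le[of C] s by (auto simp: null_sets_def)
  qed
  then have L: "density K (RN_deriv K L) = L" using s by (intro density_RN_deriv) auto
  define f where "f = RN_deriv K L"
  have f [measurable]: "f \<in> borel_measurable K" by (simp add: f_def)
  have L: "density K f = L" using L by (simp add: f_def)
  obtain X :: "nat \<Rightarrow> _" where X: "range X \<subseteq> sets K" "(\<Union>i. X i) = space K" "\<And>i. emeasure K (X i) \<noteq> \<infinity>"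
    using sigma_finite by metis
  have "AE x in K. \<forall>i. x \<in> X i \<longrightarrow> f x \<le> 1"
    unfolding AE_all_countable
  proof
    fix i
    define D where "D = {x \<in> space K. 1 < f x} \<inter> X i"
    have [measurable]: "X i \<in> sets K" using X(1) by auto
    have D [measurable]: "D \<in> sets K" unfolding D_def by measurable
    have "emeasure K D \<le> emeasure K (X i)" using X(1) by (intro emeasure_mono) (auto simp: D_def)
    then have fin: "emeasure K D \<noteq> \<infinity>" using X(3)[of i] by (auto simp: top_unique)
    have "(\<integral>\<^sup>+x. (f x - 1) * indicator D x \<partial>K) = (\<integral>\<^sup>+x. f x * indicator D x - indicator D x \<partial>K)"
      by (intro nn_integral_cong) (auto simp: indicator_def)
    also have "\<dots> = (\<integral>\<^sup>+x. f x * indicator D x \<partial>K) - emeasure K D"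
      using fin by (subst nn_integral_diff) (auto simp: D_def indicator_def)
    also have "(\<integral>\<^sup>+x. f x * indicator D x \<partial>K) = emeasure L D"
      by (simp add: L[symmetric] emeasure_density)
    also have "emeasure L D - emeasure K D = 0"
      using le[OF D] fin by (auto simp: diff_eq_0_iff_ennreal less_top[symmetric] top_unique)
    finally have "AE x in K. (f x - 1) * indicator D x = 0"
      by (subst (asm) nn_integral_0_iff_AE) auto
    then show "AE x in K. x \<in> X i \<longrightarrow> f x \<le> 1"
      using AE_space
    proof eventually_elim
      case (elim x)
      then show ?case by (auto simp: D_def indicator_def diff_eq_0_iff_ennreal split: if_splits)
    qed
  qed
  then have f1: "AE x in K. f x \<le> 1"
    using AE_space by eventually_elim (use X(2) in auto)
  show ?thesis
  proof (rule that[of "density K (\<lambda>x. 1 - f x)"])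
    fix C assume C [measurable]: "C \<in> sets K"
    have "emeasure (density K (\<lambda>x. 1 - f x)) C + emeasure L C
        = (\<integral>\<^sup>+x. (1 - f x) * indicator C x + f x * indicator C x \<partial>K)"
      unfolding L[symmetric] by (simp add: emeasure_density nn_integral_add)
    also have "\<dots> = (\<integral>\<^sup>+x. indicator C x \<partial>K)"
      using f1 by (intro nn_integral_cong_AE, eventually_elim)
        (simp add: diff_add_cancel_ennreal flip: distrib_right)
    finally show "emeasure (density K (\<lambda>x. 1 - f x)) C + emeasure L C = emeasure K C" by simp
  qed simp
qed

text \<open>
  Ergodicity speaks of strictly invariant sets. The set of points whose orbit enters \<open>{g > t}\<close> infinitely
  often is strictly invariant and agrees with \<open>{g > t}\<close> almost everywhere, so for every \<open>t\<close> almost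
  everywhere \<open>g \<le> t\<close>, or almost everywhere \<open>g > t\<close>.
\<close>

lemma ergodic_AE_invariant_constant:
  fixes g :: "'a \<Rightarrow> ennreal"
  assumes T: "T \<in> measurable M M" "distr M M T = M" and erg: "ergodic M T"
    and g [measurable]: "g \<in> borel_measurable M" and inv: "AE x in M. g (T x) = g x"
  obtains c where "AE x in M. g x = c"
proof -
  have Tk [measurable]: "T ^^ k \<in> measurable M M" for k
    by (induction k) (use T(1) in \<open>auto simp: comp_def intro: measurable_compose\<close>)
  have dk: "distr M M (T ^^ k) = M" for k
  proof (induction k)
    case 0
    then show ?case by (simp add: distr_id[unfolded id_def] id_def)
  next
    case (Suc k)
    have "distr (distr M M (T ^^ k)) M T = distr M M (T \<circ> T ^^ k)"
      by (rule distr_distr[OF T(1) Tk])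
    then show ?case using Suc T(2) by (simp add: comp_def)
  qed
  have "AE x in M. g ((T ^^ k) x) = g x" for k
  proof (induction k)
    case (Suc k)
    have "AE x in distr M M (T ^^ k). g (T x) = g x" unfolding dk by (rule inv)
    then have "AE x in M. g (T ((T ^^ k) x)) = g ((T ^^ k) x)"
      by (rule AE_distrD[OF Tk])
    then show ?case using Suc by eventually_elim simp
  qed simp
  then have all: "AE x in M. \<forall>k. g ((T ^^ k) x) = g x" by (simp add: AE_all_countable)
  have dich: "(AE x in M. g x \<le> t) \<or> (AE x in M. t < g x)" for t
  proof -
    define B where "B = {x \<in> space M. \<forall>n. \<exists>k\<ge>n. t < g ((T ^^ k) x)}"
    have B: "B \<in> sets M" unfolding B_def by measurable
    have "T -` B \<inter> space M = B"
    proof -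
      have "(\<forall>n. \<exists>k\<ge>n. t < g ((T ^^ k) (T x))) \<longleftrightarrow> (\<forall>n. \<exists>k\<ge>n. t < g ((T ^^ k) x))" for x
      proof
        assume *: "\<forall>n. \<exists>k\<ge>n. t < g ((T ^^ k) (T x))"
        show "\<forall>n. \<exists>k\<ge>n. t < g ((T ^^ k) x)"
        proof
          fix n
          obtain k where "k \<ge> n" "t < g ((T ^^ k) (T x))" using * by blast
          then show "\<exists>k\<ge>n. t < g ((T ^^ k) x)"
            by (intro exI[of _ "Suc k"]) (simp add: funpow_swap1)
        qed
      next
        assume *: "\<forall>n. \<exists>k\<ge>n. t < g ((T ^^ k) x)"
        show "\<forall>n. \<exists>k\<ge>n. t < g ((T ^^ k) (T x))"
        proof
          fix n
          obtain k where "k \<ge> Suc n" "t < g ((T ^^ k) x)" using * by blast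
          then show "\<exists>k\<ge>n. t < g ((T ^^ k) (T x))"
            by (intro exI[of _ "k - 1"]) (cases k, simp_all add: funpow_swap1)
        qed
      qed
      then show ?thesis using measurable_space[OF T(1)] by (auto simp: B_def)
    qed
    then have "emeasure M B = 0 \<or> emeasure M (space M - B) = 0"
      using erg B by (auto simp: ergodic_def)
    then show ?thesis
    proof
      assume "emeasure M B = 0"
      then have "AE x in M. x \<notin> B" using B by (intro AE_not_in null_setsI)
      then have "AE x in M. g x \<le> t"
        using all AE_space by eventually_elim (auto simp: B_def not_less)
      then show ?thesis ..
    next
      assume "emeasure M (space M - B) = 0"
      then have "AE x in M. x \<notin> space M - B" using B by (intro AE_not_in null_setsI) auto
      then have "AE x in M. t < g x"
        using all AE_space by eventually_elim (auto simp: B_def)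
      then show ?thesis ..
    qed
  qed
  define c where "c = Inf {t. AE x in M. g x \<le> t}"
  have "AE x in M. \<forall>q\<in>\<rat>. (ennreal q < c \<longrightarrow> ennreal q < g x) \<and> (c < ennreal q \<longrightarrow> g x \<le> ennreal q)"
  proof (rule AE_ball_countable'[OF _ countable_rat])
    fix q :: real
    consider "ennreal q < c" | "c < ennreal q" | "c = ennreal q" by (metis linorder_cases)
    then show "AE x in M. (ennreal q < c \<longrightarrow> ennreal q < g x) \<and> (c < ennreal q \<longrightarrow> g x \<le> ennreal q)"
    proof cases
      case 1
      then have "\<not> (AE x in M. g x \<le> ennreal q)"
        unfolding c_def using Inf_lower[of "ennreal q" "{t. AE x in M. g x \<le> t}"] by auto
      then have "AE x in M. ennreal q < g x" using dich by blast
      then show ?thesis by eventually_elim (use 1 in auto)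
    next
      case 2
      then obtain s where "AE x in M. g x \<le> s" "s < ennreal q"
        unfolding c_def Inf_less_iff by auto
      then show ?thesis using 2 by (auto elim!: eventually_mono)
    qed simp
  qed
  then have "AE x in M. g x = c"
  proof eventually_elim
    case (elim x)
    show ?case
    proof (rule antisym)
      show "g x \<le> c"
      proof (rule ccontr)
        assume "\<not> g x \<le> c"
        then obtain q where "c < ennreal (real_of_rat q)" "ennreal (real_of_rat q) < g x"
          using ennreal_rat_dense[of c "g x"] by (auto simp: not_le)
        then show False using elim[rule_format, of "real_of_rat q"] by auto
      qed
      show "c \<le> g x"
      proof (rule ccontr)
        assume "\<not> c \<le> g x"
        then obtain q where "g x < ennreal (real_of_rat q)" "ennreal (real_of_rat q) < c"
          using ennreal_rat_dense[of "g x" c] by (auto simp: not_le)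
        then show False using elim[rule_format, of "real_of_rat q"] by auto
      qed
    qed
  qed
  then show ?thesis by (rule that)
qed

text \<open>
  The density of \<open>\<mu>\<close> is invariant along \<open>T\<close>. As \<open>T\<close> is invertible, every measurable set is a preimage
  under \<open>T\<close>, so that the densities \<open>g\<close> and \<open>g \<circ> T\<close> can be compared on all sets.
\<close>

lemma ergodic_dominated_invariant_measure:
  assumes M: "sigma_finite_measure M" and aut: "automorphism M T" and erg: "ergodic M T"
    and s: "sets \<mu> = sets M" and inv: "distr \<mu> M T = \<mu>"
    and le: "\<And>A. A \<in> sets M \<Longrightarrow> emeasure \<mu> A \<le> emeasure M A" and ne: "emeasure M (space M) \<noteq> 0"
  obtains c :: real where "0 \<le> c" "\<mu> = scale_measure (ennreal c) M"
proof -
  interpret sigma_finite_measure M by fact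
  have T: "T \<in> measurable M M" "distr M M T = M" and bij: "bij_betw T (space M) (space M)"
    and Ti: "inv_into (space M) T \<in> measurable M M"
    using aut by (auto simp: automorphism_def)
  have "absolutely_continuous M \<mu>"
    unfolding absolutely_continuous_def
  proof
    fix C assume "C \<in> null_sets M"
    then show "C \<in> null_sets \<mu>" using le[of C] s by (auto simp: null_sets_def)
  qed
  then have "density M (RN_deriv M \<mu>) = \<mu>" using s by (intro density_RN_deriv) auto
  moreover define g where "g = RN_deriv M \<mu>"
  ultimately have \<mu>: "density M g = \<mu>" by simp
  have g [measurable]: "g \<in> borel_measurable M" by (simp add: g_def)
  have gT [measurable]: "(\<lambda>x. g (T x)) \<in> borel_measurable M" using measurable_compose[OF T(1) g] .
  have "density M (\<lambda>x. g (T x)) = density M g"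
  proof (rule measure_eqI)
    fix C assume "C \<in> sets (density M (\<lambda>x. g (T x)))"
    then have C [measurable]: "C \<in> sets M" by simp
    define C' where "C' = inv_into (space M) T -` C \<inter> space M"
    have C' [measurable]: "C' \<in> sets M" unfolding C'_def using measurable_sets[OF Ti C] .
    have TC: "T x \<in> C' \<longleftrightarrow> x \<in> C" if "x \<in> space M" for x
      using that bij_betw_inv_into_left[OF bij that] bij_betwE[OF bij] by (simp add: C'_def)
    then have TC': "indicator C' (T x) = (indicator C x :: ennreal)" if "x \<in> space M" for x
      using that by (simp add: indicator_def)
    have T': "T \<in> measurable \<mu> M" using T(1) s by (rule measurable_domain_cong)
    have "emeasure (density M (\<lambda>x. g (T x))) C = (\<integral>\<^sup>+x. g (T x) * indicator C' (T x) \<partial>M)"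
      by (simp add: emeasure_density TC' cong: nn_integral_cong)
    also have "\<dots> = (\<integral>\<^sup>+x. g x * indicator C' x \<partial>distr M M T)"
      using T(1) by (subst nn_integral_distr) auto
    also have "\<dots> = emeasure (density M g) C'"
      by (simp add: T(2) emeasure_density)
    also have "\<dots> = emeasure (distr \<mu> M T) C'"
      by (simp only: \<mu> inv)
    also have "\<dots> = emeasure \<mu> (T -` C' \<inter> space M)"
      using sets_eq_imp_space_eq[OF s] by (simp add: emeasure_distr[OF T' C'])
    also have "T -` C' \<inter> space M = C"
      using TC sets.sets_into_space[OF C] by blast
    finally show "emeasure (density M (\<lambda>x. g (T x))) C = emeasure (density M g) C" by (simp add: \<mu>)
  qed simp
  then have "AE x in M. g (T x) = g x" by (intro density_unique) auto
  then obtain c where c: "AE x in M. g x = c"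
    by (rule ergodic_AE_invariant_constant[OF T erg g])
  have \<mu>c: "emeasure \<mu> C = c * emeasure M C" if [measurable]: "C \<in> sets M" for C
  proof -
    have "emeasure \<mu> C = (\<integral>\<^sup>+x. g x * indicator C x \<partial>M)" by (simp add: emeasure_density flip: \<mu>)
    also have "\<dots> = (\<integral>\<^sup>+x. c * indicator C x \<partial>M)"
      using c by (intro nn_integral_cong_AE, eventually_elim) simp
    finally show ?thesis by (simp add: nn_integral_cmult)
  qed
  have "c \<noteq> top"
  proof
    assume top: "c = top"
    obtain X :: "nat \<Rightarrow> _" where X: "range X \<subseteq> sets M" "(\<Union>i. X i) = space M" "\<And>i. emeasure M (X i) \<noteq> \<infinity>"
      using sigma_finite by metis
    have "emeasure M (X i) = 0" for i
      using le[of "X i"] \<mu>c[of "X i"] X(1) X(3)[of i] top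
      by (cases "emeasure M (X i) = 0") (auto simp: ennreal_top_mult top_unique)
    then have "(\<Union>i. X i) \<in> null_sets M" using X(1) by (intro null_sets_UN) (auto intro!: null_setsI)
    then show False using X(2) ne by auto
  qed
  then obtain r where r: "0 \<le> r" "c = ennreal r" by (cases c) auto
  have "\<mu> = scale_measure (ennreal r) M"
    by (rule measure_eqI) (use s \<mu>c r in auto)
  then show ?thesis using r(1) by (intro that)
qed

section \<open>The covariance measure of a Poissonian joining\<close>

lemma finite_sets_vimage:
  assumes T: "T \<in> measurable M M" "distr M M T = M" and A: "A \<in> finite_sets M"
  shows "T -` A \<inter> space M \<in> finite_sets M"
  using A measurable_sets[OF T(1), of A] emeasure_distr[OF T(1), of A] by (simp add: finite_sets_def T(2))

lemma poisson_not_AE_pos: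
  assumes P: "poisson_measure M P" and A: "A \<in> finite_sets M"
  shows "\<not> (AE \<xi> in P. emeasure \<xi> A \<noteq> 0)"
proof
  interpret prob_space P by (rule poisson_prob[OF P])
  assume "AE \<xi> in P. emeasure \<xi> A \<noteq> 0"
  moreover have "{\<xi> \<in> space P. emeasure \<xi> A = of_nat 0} \<in> sets P"
    using poisson_measurable_emeasure[OF P finite_setsD(1)[OF A]] by measurable
  ultimately have "prob {\<xi> \<in> space P. emeasure \<xi> A = of_nat 0} = 0"
    by (subst prob_eq_0) (auto elim!: eventually_mono)
  moreover have "prob {\<xi> \<in> space P. emeasure \<xi> A = of_nat 0} = exp (- measure M A)"
    using P A unfolding poisson_measure_def finite_sets_def by (auto simp del: of_nat_0)
  ultimately show False by simp
qed

lemma poisson_factor: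
  assumes P: "poisson_measure M P" and \<pi>: "\<pi> \<in> measurable \<rho> P" "distr \<rho> P \<pi> = P" and A: "A \<in> finite_sets M"
  shows "(\<integral>\<^sup>+p. emeasure (\<pi> p) A \<partial>\<rho>) = emeasure M A"
    and "(\<integral>\<^sup>+p. emeasure (\<pi> p) A * emeasure (\<pi> p) A \<partial>\<rho>) = emeasure M A + emeasure M A * emeasure M A"
    and "AE p in \<rho>. \<exists>k. emeasure (\<pi> p) A = of_nat k"
    and "\<not> (AE p in \<rho>. emeasure (\<pi> p) A \<noteq> 0)"
proof -
  note m [measurable] = poisson_measurable_emeasure[OF P finite_setsD(1)[OF A]]
  show "(\<integral>\<^sup>+p. emeasure (\<pi> p) A \<partial>\<rho>) = emeasure M A"
    using nn_integral_distr[OF \<pi>(1), of "\<lambda>\<xi>. emeasure \<xi> A"] poisson_mean[OF P A] by (simp add: \<pi>(2))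
  show "(\<integral>\<^sup>+p. emeasure (\<pi> p) A * emeasure (\<pi> p) A \<partial>\<rho>) = emeasure M A + emeasure M A * emeasure M A"
    using nn_integral_distr[OF \<pi>(1), of "\<lambda>\<xi>. emeasure \<xi> A * emeasure \<xi> A"] poisson_second_moment[OF P A]
    by (simp add: \<pi>(2))
  have "AE \<xi> in distr \<rho> P \<pi>. \<exists>k. emeasure \<xi> A = of_nat k"
    unfolding \<pi>(2) by (rule poisson_AE_nat[OF P A])
  then show "AE p in \<rho>. \<exists>k. emeasure (\<pi> p) A = of_nat k" by (rule AE_distrD[OF \<pi>(1)])
  have "{\<xi> \<in> space P. emeasure \<xi> A \<noteq> 0} \<in> sets P" by measurable
  then show "\<not> (AE p in \<rho>. emeasure (\<pi> p) A \<noteq> 0)"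
    using AE_distr_iff[OF \<pi>(1), of "\<lambda>\<xi>. emeasure \<xi> A \<noteq> 0", unfolded \<pi>(2)] poisson_not_AE_pos[OF P A] by simp
qed

context
  fixes M :: "'a measure" and N :: "'b measure" and T S P Q \<rho>
  assumes M: "dynamical_system M T" and N: "dynamical_system N S"
    and P: "poisson_measure M P" and Q: "poisson_measure N Q"
    and \<rho>: "poissonian_joining M T P N S Q \<rho>"
begin

lemma joining_sets: "sets \<rho> = sets (pair_star M N)"
  using \<rho> poisson_product_sets[OF P Q] by (simp add: poissonian_joining_def joining_def)

lemma joining_ID: "infinitely_divisible M N \<rho>"
  using \<rho> by (simp add: poissonian_joining_def)

lemma joining_projections: "fst \<in> measurable \<rho> P" "snd \<in> measurable \<rho> Q"
proof -
  have "sets \<rho> = sets (P \<Otimes>\<^sub>M Q)" using joining_sets poisson_product_sets[OF P Q] by simp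
  then show "fst \<in> measurable \<rho> P" "snd \<in> measurable \<rho> Q"
    by (auto intro: measurable_domain_cong)
qed

lemma joining_marginals: "distr \<rho> P fst = P" "distr \<rho> Q snd = Q"
  using \<rho> by (auto simp: poissonian_joining_def joining_def)

lemma joining_prob: "prob_space \<rho>"
proof -
  have "prob_space (distr \<rho> P fst)" using poisson_prob[OF P] by (simp add: joining_marginals)
  then show ?thesis by (rule prob_space_distrD[OF joining_projections(1)])
qed

lemma joining_fst_integral:
  assumes "f \<in> borel_measurable P"
  shows "(\<integral>\<^sup>+p. f (fst p) \<partial>\<rho>) = (\<integral>\<^sup>+\<xi>. f \<xi> \<partial>P)"
  using nn_integral_distr[OF joining_projections(1), of f] assms by (simp add: joining_marginals)

lemma joining_snd_integral:
  assumes "f \<in> borel_measurable Q"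
  shows "(\<integral>\<^sup>+p. f (snd p) \<partial>\<rho>) = (\<integral>\<^sup>+\<xi>. f \<xi> \<partial>Q)"
  using nn_integral_distr[OF joining_projections(2), of f] assms by (simp add: joining_marginals)

lemmas fst_poisson = poisson_factor[OF P joining_projections(1) joining_marginals(1)]
  and snd_poisson = poisson_factor[OF Q joining_projections(2) joining_marginals(2)]

lemma borel_measurable_counts:
  assumes "sets \<sigma> = sets (pair_star M N)"
  shows "A \<in> sets M \<Longrightarrow> (\<lambda>p. emeasure (fst p) A) \<in> borel_measurable \<sigma>"
    and "B \<in> sets N \<Longrightarrow> (\<lambda>p. emeasure (snd p) B) \<in> borel_measurable \<sigma>"
  using measurable_domain_cong[OF measurable_mass2[of "[A]" M "[]" N] assms]
    measurable_domain_cong[OF measurable_mass2[of "[]" M "[B]" N] assms]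
  by (simp_all add: mass2_def[abs_def])

lemma counts_finite_AE:
  assumes \<sigma>: "sets \<sigma> = sets (pair_star M N)"
    and mean: "\<And>A. A \<in> finite_sets M \<Longrightarrow> mean_fst \<sigma> A < \<infinity>" "\<And>B. B \<in> finite_sets N \<Longrightarrow> mean_snd \<sigma> B < \<infinity>"
  shows "\<forall>A\<in>finite_sets M. AE p in \<sigma>. emeasure (fst p) A < \<infinity>"
    and "\<forall>B\<in>finite_sets N. AE p in \<sigma>. emeasure (snd p) B < \<infinity>"
  using nn_integral_noteq_infinite[OF borel_measurable_counts(1)[OF \<sigma> finite_setsD(1)]]
    nn_integral_noteq_infinite[OF borel_measurable_counts(2)[OF \<sigma> finite_setsD(1)]] mean
  by (auto simp: less_top)

lemma joining_root_moments:
  assumes \<sigma>: "prob_space \<sigma>" "sets \<sigma> = sets (pair_star M N)" and n: "1 \<le> n"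
    and \<rho>\<sigma>: "\<rho> = conv_power M N \<sigma> n"
    and A: "A \<in> finite_sets M" and B: "B \<in> finite_sets N"
  shows "mean_fst \<sigma> A < \<infinity>" "mean_snd \<sigma> B < \<infinity>"
    and "mixed_moment \<rho> A B = of_nat n * mixed_moment \<sigma> A B + ennreal (1 - 1 / real n) * (emeasure M A * emeasure N B)"
proof -
  have s: "A \<in> sets M" "B \<in> sets N" using A B by (auto dest: finite_setsD)
  have mean: "of_nat n * mean_fst \<sigma> A = emeasure M A" "of_nat n * mean_snd \<sigma> B = emeasure N B"
    using mean_conv_power[OF \<sigma>, of "[A]" "[]" "[A]" "[]" n] mean_conv_power[OF \<sigma>, of "[]" "[B]" "[]" "[B]" n]
      fst_poisson(1)[OF A] snd_poisson(1)[OF B] s by (simp_all add: mass2_def[abs_def] \<rho>\<sigma>)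
  have fin: "x < \<infinity>" if "of_nat n * x = y" "y < \<infinity>" for x y :: ennreal
    using that n by (cases "x = \<infinity>") (auto simp: ennreal_mult_top less_top)
  show "mean_fst \<sigma> A < \<infinity>" "mean_snd \<sigma> B < \<infinity>"
    using fin[OF mean(1)] fin[OF mean(2)] A B by (auto simp: finite_sets_def)
  have "of_nat (n * (n - 1)) = ennreal (1 - 1 / real n) * (of_nat n * of_nat n)"
    using n by (simp add: ennreal_of_nat_eq_real_of_nat of_nat_diff field_simps flip: ennreal_mult)
  then have "of_nat (n * (n - 1)) * (mean_fst \<sigma> A * mean_snd \<sigma> B)
      = ennreal (1 - 1 / real n) * ((of_nat n * mean_fst \<sigma> A) * (of_nat n * mean_snd \<sigma> B))"
    by (simp only: ac_simps)
  then show "mixed_moment \<rho> A B = of_nat n * mixed_moment \<sigma> A B + ennreal (1 - 1 / real n) * (emeasure M A * emeasure N B)"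
    using moments_conv_power(2)[OF \<sigma>, of "[A]" "[]" "[]" "[B]" n] s
    by (simp add: mass2_def[abs_def] \<rho>\<sigma> mean)
qed

lemma joining_mixed_moment_finite:
  assumes A: "A \<in> finite_sets M" and B: "B \<in> finite_sets N"
  shows "mixed_moment \<rho> A B < \<infinity>"
proof -
  note [measurable] = borel_measurable_counts(1)[OF joining_sets finite_setsD(1)[OF A]]
    borel_measurable_counts(2)[OF joining_sets finite_setsD(1)[OF B]]
  have xy: "x * y \<le> x * x + y * y" for x y :: ennreal
  proof (cases "x \<le> y")
    case True
    then have "x * y \<le> y * y" by (rule mult_right_mono) simp
    then show ?thesis by (rule add_increasing[rotated]) simp
  next
    case False
    then have "x * y \<le> x * x" by (intro mult_left_mono) auto
    then show ?thesis by (rule add_increasing2[rotated]) simp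
  qed
  have "mixed_moment \<rho> A B
      \<le> (\<integral>\<^sup>+p. emeasure (fst p) A * emeasure (fst p) A + emeasure (snd p) B * emeasure (snd p) B \<partial>\<rho>)"
    by (intro nn_integral_mono xy)
  also have "\<dots> = emeasure M A + emeasure M A * emeasure M A + (emeasure N B + emeasure N B * emeasure N B)"
    by (simp add: nn_integral_add fst_poisson[OF A] snd_poisson[OF B])
  also have "\<dots> < \<infinity>"
    using A B by (auto simp: finite_sets_def ennreal_mult_less_top)
  finally show ?thesis .
qed

text \<open>
  The number \<open>c\<close> is the covariance; the two bounds are \<open>covariance_bounds\<close> with the roles of the coordinates
  exchanged.
\<close>

lemma covariance_le:
  assumes A: "A \<in> finite_sets M" and B: "B \<in> finite_sets N"
    and c: "mixed_moment \<rho> A B = c + emeasure M A * emeasure N B"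
  shows "c \<le> emeasure M A" "c \<le> emeasure N B"
proof -
  define a where "a = measure M A"
  define b where "b = measure N B"
  have a: "emeasure M A = ennreal a" "0 \<le> a" and b: "emeasure N B = ennreal b" "0 \<le> b"
    using A B by (auto simp: finite_sets_def a_def b_def emeasure_eq_ennreal_measure less_top[symmetric])
  note mom = fst_poisson[OF A, unfolded a(1)] snd_poisson[OF B, unfolded b(1)]
  have "c + emeasure M A * emeasure N B < top"
    using joining_mixed_moment_finite[OF A B] by (simp add: c)
  then obtain r where r: "c = ennreal r" "0 \<le> r" by (cases c) auto
  have \<kappa>: "mixed_moment \<rho> A B = ennreal (r + a * b)"
    using r a b by (simp add: c ennreal_mult)
  have AB: "set [A] \<subseteq> sets M" "set [B] \<subseteq> sets N" "set [] \<subseteq> sets M" "set [] \<subseteq> sets N"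
    using A B by (auto dest: finite_setsD)
  have "r + a * b - a * b \<le> a"
    by (rule covariance_bounds[OF joining_ID AB(1,4) AB(3,2), of a b "r + a * b"])
      (use a b r mom \<kappa> in \<open>simp_all add: mass2_def[abs_def] ennreal_mult\<close>)
  then show "c \<le> emeasure M A" using r a by simp
  have "r + a * b - b * a \<le> b"
    by (rule covariance_bounds[OF joining_ID AB(3,2) AB(1,4), of b a "r + a * b"])
      (use a b r mom \<kappa> in \<open>simp_all add: mass2_def[abs_def] ennreal_mult mult.commute\<close>)
  then show "c \<le> emeasure N B" using r b by (simp add: mult.commute)
qed

text \<open>
  For an \<open>n\<close>-th root \<open>\<sigma>\<close> the measures \<open>K\<close> and \<open>n K' + (1 - 1 / n) (M \<Otimes> N)\<close> agree on rectangles, where \<open>K'\<close> belongs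
  to \<open>\<sigma>\<close>, and therefore everywhere. Positivity of the covariance is thus obtained for all measurable sets
  at once, although only rectangles have a probabilistic meaning.
\<close>

lemma exists_mixed_moment_measure:
  obtains K where "sets K = sets (M \<Otimes>\<^sub>M N)"
    "\<And>A B. A \<in> sets M \<Longrightarrow> B \<in> sets N \<Longrightarrow> emeasure K (A \<times> B) = mixed_moment \<rho> A B"
    "\<And>C. C \<in> sets (M \<Otimes>\<^sub>M N) \<Longrightarrow> emeasure (M \<Otimes>\<^sub>M N) C \<le> emeasure K C"
proof -
  note Md = dynamical_systemD[OF M] and Nd = dynamical_systemD[OF N]
  interpret N: sigma_finite_measure N by (rule Nd(1))
  note \<rho>p = joining_prob and \<rho>s = joining_sets
  have fA: "mean_fst \<rho> A < \<infinity>" if "A \<in> finite_sets M" for A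
    using fst_poisson(1)[OF that] finite_setsD(2)[OF that] by simp
  have fB: "mean_snd \<rho> B < \<infinity>" if "B \<in> finite_sets N" for B
    using snd_poisson(1)[OF that] finite_setsD(2)[OF that] by simp
  have fin: "\<forall>A\<in>finite_sets M. AE p in \<rho>. emeasure (fst p) A < \<infinity>"
    "\<forall>B\<in>finite_sets N. AE p in \<rho>. emeasure (snd p) B < \<infinity>"
    by (rule counts_finite_AE[OF \<rho>s]; (erule fA | erule fB))+
  obtain K where K: "sets K = sets (M \<Otimes>\<^sub>M N)"
    "\<And>A B. A \<in> sets M \<Longrightarrow> B \<in> sets N \<Longrightarrow> emeasure K (A \<times> B) = mixed_moment \<rho> A B"
    by (rule exists_mean_product_measure[OF Md(1) Nd(1) \<rho>p \<rho>s fin], rule that)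
  have ge: "ennreal (1 - 1 / real n) * emeasure (M \<Otimes>\<^sub>M N) C \<le> emeasure K C"
    if n: "1 \<le> n" and C: "C \<in> sets (M \<Otimes>\<^sub>M N)" for n C
  proof -
    obtain \<sigma> where \<sigma>: "prob_space \<sigma>" "sets \<sigma> = sets (pair_star M N)" and \<rho>\<sigma>: "\<rho> = conv_power M N \<sigma> n"
      using joining_ID n unfolding infinitely_divisible_def by blast
    note root = joining_root_moments[OF \<sigma> n \<rho>\<sigma>]
    have fin\<sigma>: "\<forall>A\<in>finite_sets M. AE p in \<sigma>. emeasure (fst p) A < \<infinity>"
      "\<forall>B\<in>finite_sets N. AE p in \<sigma>. emeasure (snd p) B < \<infinity>"
      by (rule counts_finite_AE[OF \<sigma>(2)]; (erule root(1)[OF _ empty_finite_sets] | erule root(2)[OF empty_finite_sets]))+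
    obtain K' where K': "sets K' = sets (M \<Otimes>\<^sub>M N)"
      "\<And>A B. A \<in> sets M \<Longrightarrow> B \<in> sets N \<Longrightarrow> emeasure K' (A \<times> B) = mixed_moment \<sigma> A B"
      by (rule exists_mean_product_measure[OF Md(1) Nd(1) \<sigma> fin\<sigma>], rule that)
    define L where "L = measure_add (M \<Otimes>\<^sub>M N) (scale_measure (of_nat n) K') (scale_measure (ennreal (1 - 1 / real n)) (M \<Otimes>\<^sub>M N))"
    have Le: "emeasure L D = of_nat n * emeasure K' D + ennreal (1 - 1 / real n) * emeasure (M \<Otimes>\<^sub>M N) D"
      if "D \<in> sets (M \<Otimes>\<^sub>M N)" for D
      unfolding L_def using K'(1) that by (subst emeasure_measure_add) auto
    have "K = L"
    proof (rule measure_eqI_finite_rectangles[OF Md(1) Nd(1) K(1)])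
      show "sets L = sets (M \<Otimes>\<^sub>M N)" by (simp add: L_def)
      fix A B assume A: "A \<in> finite_sets M" and B: "B \<in> finite_sets N"
      have AB: "A \<in> sets M" "B \<in> sets N" using A B by (auto dest: finite_setsD)
      show "emeasure K (A \<times> B) \<noteq> \<infinity>"
        using joining_mixed_moment_finite[OF A B] by (simp add: K(2)[OF AB] less_top)
      show "emeasure K (A \<times> B) = emeasure L (A \<times> B)"
        using AB by (simp add: K(2)[OF AB] root(3)[OF A B] Le K'(2)[OF AB] N.emeasure_pair_measure_Times)
    qed
    then show ?thesis using Le[OF C] by simp
  qed
  have "emeasure (M \<Otimes>\<^sub>M N) C \<le> emeasure K C" if C: "C \<in> sets (M \<Otimes>\<^sub>M N)" for C
  proof -
    have "(\<lambda>n. ennreal (1 - 1 / real n)) \<longlonglongrightarrow> ennreal (1 - 0)"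
      by (intro tendsto_ennrealI tendsto_intros lim_const_over_n)
    then have "(\<lambda>n. ennreal (1 - 1 / real n) * emeasure (M \<Otimes>\<^sub>M N) C) \<longlonglongrightarrow> ennreal (1 - 0) * emeasure (M \<Otimes>\<^sub>M N) C"
      by (intro tendsto_mult_ennreal tendsto_const) auto
    then have "ennreal (1 - 0) * emeasure (M \<Otimes>\<^sub>M N) C \<le> emeasure K C"
      by (rule tendsto_upperbound) (auto intro!: eventually_sequentiallyI[of 1] ge C)
    then show ?thesis by simp
  qed
  then show ?thesis using K by (intro that[of K])
qed

lemma joining_covariance_measure:
  obtains J where "sets J = sets (M \<Otimes>\<^sub>M N)"
    "\<And>A B. A \<in> finite_sets M \<Longrightarrow> B \<in> finite_sets N \<Longrightarrow>
      mixed_moment \<rho> A B = emeasure J (A \<times> B) + emeasure M A * emeasure N B"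
proof -
  note Md = dynamical_systemD[OF M] and Nd = dynamical_systemD[OF N]
  interpret N: sigma_finite_measure N by (rule Nd(1))
  obtain K where K: "sets K = sets (M \<Otimes>\<^sub>M N)"
    "\<And>A B. A \<in> sets M \<Longrightarrow> B \<in> sets N \<Longrightarrow> emeasure K (A \<times> B) = mixed_moment \<rho> A B"
    "\<And>C. C \<in> sets (M \<Otimes>\<^sub>M N) \<Longrightarrow> emeasure (M \<Otimes>\<^sub>M N) C \<le> emeasure K C"
    by (rule exists_mixed_moment_measure, rule that)
  have "sigma_finite_measure K"
  proof -
    obtain X :: "nat \<Rightarrow> _" and Y :: "nat \<Rightarrow> _" where XY: "\<And>i. X i \<in> finite_sets M" "\<And>i. Y i \<in> finite_sets N"
      and RU: "(\<Union>i. X i \<times> Y i) = space M \<times> space N"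
      by (rule finite_rectangle_exhaustion[OF Md(1) Nd(1)], rule that)
    have "X i \<times> Y i \<in> sets K" for i
      unfolding K(1) using XY by (intro pair_measureI finite_setsD)
    moreover have "emeasure K (X i \<times> Y i) \<noteq> \<infinity>" for i
      using joining_mixed_moment_finite[OF XY(1)[of i] XY(2)[of i]]
      by (simp add: K(2)[OF finite_setsD(1)[OF XY(1)] finite_setsD(1)[OF XY(2)]] less_top)
    moreover have "space K = space M \<times> space N"
      using sets_eq_imp_space_eq[OF K(1)] by (simp add: space_pair_measure)
    ultimately show ?thesis
      unfolding sigma_finite_measure_def using RU by (intro exI[of _ "range (\<lambda>i. X i \<times> Y i)"]) auto
  qed
  then obtain J where J: "sets J = sets K" "\<And>C. C \<in> sets K \<Longrightarrow> emeasure J C + emeasure (M \<Otimes>\<^sub>M N) C = emeasure K C"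
    by (rule measure_difference[where L="M \<Otimes>\<^sub>M N"]) (simp_all add: K)
  show ?thesis
  proof (rule that[of J])
    show "sets J = sets (M \<Otimes>\<^sub>M N)" using J K by simp
    fix A B assume "A \<in> finite_sets M" "B \<in> finite_sets N"
    then have "A \<in> sets M" "B \<in> sets N" by (auto dest: finite_setsD)
    then show "mixed_moment \<rho> A B = emeasure J (A \<times> B) + emeasure M A * emeasure N B"
      using J(2)[of "A \<times> B"] by (simp add: K N.emeasure_pair_measure_Times)
  qed
qed

lemma joining_mixed_moment_invariant:
  assumes A: "A \<in> sets M" and B: "B \<in> sets N"
  shows "mixed_moment \<rho> (T -` A \<inter> space M) (S -` B \<inter> space N)
    = mixed_moment \<rho> A B"
proof -
  note Md = dynamical_systemD[OF M] and Nd = dynamical_systemD[OF N]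
  note \<rho>s = joining_sets
  let ?TS = "map_prod (map_star M T) (map_star N S)"
  have inv: "distr \<rho> (P \<Otimes>\<^sub>M Q) ?TS = \<rho>"
    using \<rho> by (simp add: poissonian_joining_def joining_def)
  have sp: "space \<rho> = {\<xi>. sets \<xi> = sets M} \<times> {\<eta>. sets \<eta> = sets N}"
    using sets_eq_imp_space_eq[OF \<rho>s] by (simp add: space_pair_star)
  have m: "?TS \<in> measurable \<rho> (P \<Otimes>\<^sub>M Q)"
  proof -
    note [measurable] = measurable_map_star[OF Md(2)] measurable_map_star[OF Nd(2)]
    have "?TS \<in> measurable (pair_star M N) (pair_star M N)"
      unfolding map_prod_def split_beta' pair_star_def by measurable
    then show ?thesis unfolding measurable_cong_sets[OF \<rho>s poisson_product_sets[OF P Q]] .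
  qed
  have star: "emeasure (map_star M' T' \<xi>) A' = emeasure \<xi> (T' -` A' \<inter> space M')"
    if "T' \<in> measurable M' M'" "sets \<xi> = sets M'" "A' \<in> sets M'" for M' :: "'c measure" and T' \<xi> A'
    using emeasure_distr[OF measurable_domain_cong[OF that(1,2)] that(3)] sets_eq_imp_space_eq[OF that(2)]
    by (simp add: map_star_def)
  have "mixed_moment \<rho> A B
      = (\<integral>\<^sup>+p. emeasure (fst p) A * emeasure (snd p) B \<partial>distr \<rho> (P \<Otimes>\<^sub>M Q) ?TS)"
    by (simp only: inv)
  also have "\<dots> = (\<integral>\<^sup>+p. emeasure (fst (?TS p)) A * emeasure (snd (?TS p)) B \<partial>\<rho>)"
  proof (rule nn_integral_distr[OF m])
    show "(\<lambda>p. emeasure (fst p) A * emeasure (snd p) B) \<in> borel_measurable (distr \<rho> (P \<Otimes>\<^sub>M Q) ?TS)"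
      unfolding inv using borel_measurable_counts(1)[OF \<rho>s A] borel_measurable_counts(2)[OF \<rho>s B] by measurable
  qed
  also have "\<dots> = mixed_moment \<rho> (T -` A \<inter> space M) (S -` B \<inter> space N)"
    by (intro nn_integral_cong) (auto simp: sp star[OF Md(2) _ A] star[OF Nd(2) _ B])
  finally show ?thesis ..
qed

lemma joining_mean_mass:
  shows "set As \<subseteq> finite_sets M \<Longrightarrow> (\<integral>\<^sup>+p. mass As (fst p) \<partial>\<rho>) = mass As M"
    and "set Bs \<subseteq> finite_sets N \<Longrightarrow> (\<integral>\<^sup>+p. mass Bs (snd p) \<partial>\<rho>) = mass Bs N"
proof -
  note \<rho>s = joining_sets
  show "(\<integral>\<^sup>+p. mass As (fst p) \<partial>\<rho>) = mass As M" if "set As \<subseteq> finite_sets M"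
    using that
  proof (induction As)
    case (Cons A As)
    have A: "A \<in> finite_sets M" and As: "set As \<subseteq> sets M" using Cons.prems finite_sets_subset by auto
    have "(\<lambda>p. mass As (fst p)) \<in> borel_measurable \<rho>"
      using measurable_domain_cong[OF measurable_mass2[OF As, of "[]" N] \<rho>s] by (simp add: mass2_def[abs_def])
    then show ?case
      using Cons borel_measurable_counts(1)[OF \<rho>s finite_setsD(1)[OF A]]
      by (simp add: nn_integral_add fst_poisson(1)[OF A])
  qed simp
  show "(\<integral>\<^sup>+p. mass Bs (snd p) \<partial>\<rho>) = mass Bs N" if "set Bs \<subseteq> finite_sets N"
    using that
  proof (induction Bs)
    case (Cons B Bs)
    have B: "B \<in> finite_sets N" and Bs: "set Bs \<subseteq> sets N" using Cons.prems finite_sets_subset by auto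
    have "(\<lambda>p. mass Bs (snd p)) \<in> borel_measurable \<rho>"
      using measurable_domain_cong[OF measurable_mass2[of "[]" M, OF _ Bs] \<rho>s] by (simp add: mass2_def[abs_def])
    then show ?case
      using Cons borel_measurable_counts(2)[OF \<rho>s finite_setsD(1)[OF B]]
      by (simp add: nn_integral_add snd_poisson(1)[OF B])
  qed simp
qed

lemma joining_mean_mixed_mass:
  assumes uncorr: "\<And>A B. A \<in> finite_sets M \<Longrightarrow> B \<in> finite_sets N \<Longrightarrow>
      mixed_moment \<rho> A B = emeasure M A * emeasure N B"
    and As: "set As \<subseteq> finite_sets M" and Bs: "set Bs \<subseteq> finite_sets N"
  shows "(\<integral>\<^sup>+p. mass As (fst p) * mass Bs (snd p) \<partial>\<rho>) = mass As M * mass Bs N"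
proof -
  note \<rho>s = joining_sets
  have mB: "(\<lambda>p. mass Bs (snd p)) \<in> borel_measurable \<rho>" if "set Bs \<subseteq> finite_sets N" for Bs
    using measurable_domain_cong[OF measurable_mass2[of "[]" M Bs N] \<rho>s] that finite_sets_subset[of N]
    by (auto simp: mass2_def[abs_def])
  have inner: "(\<integral>\<^sup>+p. emeasure (fst p) A * mass Bs (snd p) \<partial>\<rho>) = emeasure M A * mass Bs N"
    if A: "A \<in> finite_sets M" for A
    using Bs
  proof (induction Bs)
    case (Cons B Bs)
    then show ?case
      using uncorr[OF A, of B] mB[of Bs] borel_measurable_counts(1)[OF \<rho>s finite_setsD(1)[OF A]]
        borel_measurable_counts(2)[OF \<rho>s finite_setsD(1)[of B N]]
      by (simp add: distrib_left nn_integral_add)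
  qed simp
  show ?thesis
    using As
  proof (induction As)
    case (Cons A As)
    have "(\<lambda>p. mass As (fst p)) \<in> borel_measurable \<rho>"
      using measurable_domain_cong[OF measurable_mass2[of As M "[]" N] \<rho>s] Cons.prems finite_sets_subset[of M]
      by (auto simp: mass2_def[abs_def])
    then show ?case
      using Cons inner[of A] borel_measurable_counts(1)[OF \<rho>s finite_setsD(1)[of A M]] mB[OF Bs]
      by (simp add: distrib_right nn_integral_add)
  qed simp
qed

text \<open>
  Uncorrelated counts under \<open>\<rho>\<close> are uncorrelated under every \<open>n\<close>-th root, with mixed moment of order \<open>1 / n\<^sup>2\<close>. By
  \<open>laplace_defect_le\<close> the Laplace functional of the root factorizes up to an error of order \<open>1 / n\<^sup>2\<close>,
  and passing to the \<open>n\<close>-th power multiplies the error by at most \<open>n\<close>.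
\<close>

lemma uncorrelated_joining_is_product:
  assumes uncorr: "\<And>A B. A \<in> finite_sets M \<Longrightarrow> B \<in> finite_sets N \<Longrightarrow>
      mixed_moment \<rho> A B = emeasure M A * emeasure N B"
  shows "\<rho> = P \<Otimes>\<^sub>M Q"
proof (rule pair_star_eqI[OF dynamical_systemD(1)[OF M] dynamical_systemD(1)[OF N] joining_prob
    poisson_product_prob[OF P Q] joining_sets poisson_product_sets[OF P Q]])
  fix As Bs assume As: "set As \<subseteq> finite_sets M" and Bs: "set Bs \<subseteq> finite_sets N"
  have AB: "set As \<subseteq> sets M" "set Bs \<subseteq> sets N" "set [] \<subseteq> sets M" "set [] \<subseteq> sets N"
    using As Bs finite_sets_subset by auto
  have massfin: "mass As M < top" if "set As \<subseteq> finite_sets M" for As and M :: "'c measure"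
    using that by (induction As) (auto simp: finite_sets_def)
  obtain f where f: "0 \<le> f" "mass As M = ennreal f"
    using massfin[OF As] by (cases "mass As M") auto
  obtain g where g: "0 \<le> g" "mass Bs N = ennreal g"
    using massfin[OF Bs] by (cases "mass Bs N") auto
  let ?r = "\<lambda>As Bs. enn2real (laplace As Bs \<rho>)"
  have step: "\<bar>?r As Bs - ?r As [] * ?r [] Bs\<bar> \<le> f * g / real n" if n: "1 \<le> n" for n
  proof -
    obtain \<sigma> where \<sigma>: "prob_space \<sigma>" "sets \<sigma> = sets (pair_star M N)" "\<rho> = conv_power M N \<sigma> n"
      using joining_ID n unfolding infinitely_divisible_def by blast
    note root = \<sigma>(1,2) n
    have F: "nn_integral (conv_power M N \<sigma> n) (mass2 As []) = ennreal f"
      and G: "nn_integral (conv_power M N \<sigma> n) (mass2 [] Bs) = ennreal g"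
      and FG: "(\<integral>\<^sup>+p. mass2 As [] p * mass2 [] Bs p \<partial>conv_power M N \<sigma> n) = ennreal (f * g)"
      using joining_mean_mass(1)[OF As] joining_mean_mass(2)[OF Bs] joining_mean_mixed_mass[OF uncorr As Bs] f g
      unfolding \<sigma>(3)[symmetric] by (simp_all add: mass2_def[abs_def] ennreal_mult)
    obtain z where z: "0 \<le> z" "(\<integral>\<^sup>+p. mass2 As [] p * mass2 [] Bs p \<partial>\<sigma>) = ennreal z"
        "real n * z = f * g - real (n - 1) / real n * (f * g)"
      by (rule convolution_root_mixed_moment[OF root AB(1,4,3,2) f(1) F g(1) G mult_nonneg_nonneg[OF f(1) g(1)] FG])
    have "real n * z = f * g / real n" unfolding z(3) using n by (simp add: of_nat_diff field_simps)
    then have z': "z = f / n * (g / n)" using n by (simp add: field_simps)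
    let ?s = "\<lambda>As Bs. enn2real (laplace As Bs \<sigma>)"
    have "laplace As Bs \<sigma> = (\<integral>\<^sup>+p. nexp (mass2 As [] p + mass2 [] Bs p) \<partial>\<sigma>)"
      by (simp add: laplace_def mass2_def)
    then have "\<bar>?s As Bs - ?s As [] * ?s [] Bs\<bar> \<le> f / n * (g / n)"
      using laplace_defect_le[OF \<sigma>(1) measurable_domain_cong[OF measurable_mass2[OF AB(1,4)] \<sigma>(2)]
          measurable_domain_cong[OF measurable_mass2[OF AB(3,2)] \<sigma>(2)]
          _ _ convolution_root_mean[OF root AB(1,4) f(1) F] convolution_root_mean[OF root AB(3,2) g(1) G] z(2)[unfolded z']] f g
      by (simp add: laplace_def)
    then have "real n * \<bar>?s As Bs - ?s As [] * ?s [] Bs\<bar> \<le> real n * (f / n * (g / n))"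
      by (rule mult_left_mono) simp
    moreover have s01: "0 \<le> ?s As Bs" "?s As Bs \<le> 1" for As Bs
      using enn2real_mono[OF laplace_le_1[OF \<sigma>(1), of As Bs]] by simp_all
    then have "\<bar>?s As Bs ^ n - (?s As [] * ?s [] Bs) ^ n\<bar> \<le> real n * \<bar>?s As Bs - ?s As [] * ?s [] Bs\<bar>"
      using norm_power_diff[of "?s As Bs" "?s As [] * ?s [] Bs" n] by (simp add: abs_mult mult_le_one)
    moreover have "?r As Bs = ?s As Bs ^ n" "?r As [] = ?s As [] ^ n" "?r [] Bs = ?s [] Bs ^ n"
      unfolding \<sigma>(3) using AB by (simp_all add: laplace_conv_power[OF \<sigma>(1,2)] enn2real_power)
    ultimately show ?thesis using n by (simp add: power_mult_distrib)
  qed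
  have "(\<lambda>n. f * g / real n) \<longlonglongrightarrow> 0" by (rule lim_const_over_n)
  then have "\<bar>?r As Bs - ?r As [] * ?r [] Bs\<bar> \<le> 0"
    by (rule tendsto_lowerbound) (auto intro!: eventually_sequentiallyI[of 1] step)
  then have real: "?r As Bs = enn2real (laplace As [] \<rho> * laplace [] Bs \<rho>)"
    by (simp add: enn2real_mult)
  have fin: "laplace As Bs \<rho> < top" for As Bs
    by (rule order_le_less_trans[OF laplace_le_1[OF joining_prob]]) simp
  have "ennreal (?r As Bs) = ennreal (enn2real (laplace As [] \<rho> * laplace [] Bs \<rho>))"
    by (simp only: real)
  then have "laplace As Bs \<rho> = laplace As [] \<rho> * laplace [] Bs \<rho>"
    using fin by (simp add: ennreal_mult_less_top)
  also have "laplace As [] \<rho> = (\<integral>\<^sup>+\<xi>. nexp (mass As \<xi>) \<partial>P)"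
    using joining_fst_integral[of "\<lambda>\<xi>. nexp (mass As \<xi>)"] poisson_measurable_mass[OF P AB(1)]
    by (simp add: laplace_def mass2_def)
  also have "laplace [] Bs \<rho> = (\<integral>\<^sup>+\<xi>. nexp (mass Bs \<xi>) \<partial>Q)"
    using joining_snd_integral[of "\<lambda>\<xi>. nexp (mass Bs \<xi>)"] poisson_measurable_mass[OF Q AB(2)]
    by (simp add: laplace_def mass2_def)
  finally show "laplace As Bs \<rho> = laplace As Bs (P \<Otimes>\<^sub>M Q)"
    using laplace_pair_measure[OF poisson_prob[OF Q] poisson_sets[OF P] poisson_sets[OF Q] AB(1,2)] by simp
qed

end

section \<open>Strong disjointness and ID-disjointness\<close>

text \<open>
  Stated for a factor map \<open>f\<close> so that it applies to both coordinates. The domination is only known on the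
  pieces \<open>C i\<close> of an exhaustion and passes to the limit.
\<close>

lemma dominated_ergodic_factor:
  assumes M: "dynamical_system M T" and erg: "ergodic M T"
    and f: "f \<in> measurable J M" and R: "R \<in> measurable J L" "distr J L R = J" and fR: "f \<circ> R = T \<circ> f"
    and C: "range C \<subseteq> sets J" "incseq C" "(\<Union>i. C i) = space J"
    and le: "\<And>A i. A \<in> finite_sets M \<Longrightarrow> emeasure J (f -` A \<inter> C i) \<le> emeasure M A"
  obtains c :: real where "0 \<le> c" "distr J M f = scale_measure (ennreal c) M"
proof -
  note Md = dynamical_systemD[OF M]
  have fL: "f \<in> measurable L M"
    using f sets_distr[of J L R] unfolding R(2) by (rule measurable_domain_cong[OF _ sym])
  have "distr (distr J M f) M T = distr J M (f \<circ> R)"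
    unfolding fR by (rule distr_distr[OF Md(2) f])
  also have "\<dots> = distr (distr J L R) M f"
    by (rule distr_distr[symmetric, OF fL R(1)])
  finally have inv: "distr (distr J M f) M T = distr J M f" by (simp only: R(2))
  show ?thesis
  proof (rule ergodic_dominated_invariant_measure[OF Md(1) _ erg sets_distr inv])
    show "automorphism M T" using M by (simp add: dynamical_system_def)
    show "emeasure M (space M) \<noteq> 0" using Md(4) by simp
    fix A assume A: "A \<in> sets M"
    show "emeasure (distr J M f) A \<le> emeasure M A"
    proof (cases "emeasure M A = top")
      case False
      then have Af: "A \<in> finite_sets M" using A by (simp add: finite_sets_def less_top)
      have fA: "f -` A \<inter> C i \<in> sets J" for i
      proof -
        have "f -` A \<inter> C i = (f -` A \<inter> space J) \<inter> C i" using C(3) by auto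
        then show ?thesis using measurable_sets[OF f A] C(1) by auto
      qed
      have "(\<lambda>i. emeasure J (f -` A \<inter> C i)) \<longlonglongrightarrow> emeasure J (\<Union>i. f -` A \<inter> C i)"
        by (rule Lim_emeasure_incseq) (use C(2) fA in \<open>auto simp: incseq_def\<close>)
      moreover have "(\<Union>i. f -` A \<inter> C i) = f -` A \<inter> space J" using C(3) by auto
      ultimately have "(\<lambda>i. emeasure J (f -` A \<inter> C i)) \<longlonglongrightarrow> emeasure (distr J M f) A"
        by (simp add: emeasure_distr[OF f A])
      then show ?thesis
        by (rule tendsto_upperbound) (auto intro!: always_eventually le Af)
    qed simp
  qed (rule that)
qed

text \<open>
  The covariance measure of \<open>\<rho>\<close> has marginals \<open>c1 M\<close> and \<open>c2 N\<close>. If both constants were positive it would be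
  a joining excluded by strong disjointness; if one of them is \<open>0\<close>, the covariance measure is zero.
\<close>

theorem strongly_disjoint_imp_product:
  fixes M :: "'a measure" and N :: "'b measure"
  assumes M: "dynamical_system M T" and N: "dynamical_system N S"
    and P: "poisson_measure M P" and Q: "poisson_measure N Q"
    and erg: "ergodic M T" "ergodic N S" and disj: "strongly_disjoint M T N S"
    and \<rho>: "poissonian_joining M T P N S Q \<rho>"
  shows "\<rho> = P \<Otimes>\<^sub>M Q"
proof -
  note Md = dynamical_systemD[OF M] and Nd = dynamical_systemD[OF N]
  obtain J where J: "sets J = sets (M \<Otimes>\<^sub>M N)"
    "\<And>A B. A \<in> finite_sets M \<Longrightarrow> B \<in> finite_sets N \<Longrightarrow>
      mixed_moment \<rho> A B = emeasure J (A \<times> B) + emeasure M A * emeasure N B"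
    by (rule joining_covariance_measure[OF M N P Q \<rho>], rule that)
  have le: "emeasure J (A \<times> B) \<le> emeasure M A" "emeasure J (A \<times> B) \<le> emeasure N B"
    if "A \<in> finite_sets M" "B \<in> finite_sets N" for A B
    using covariance_le[OF M N P Q \<rho> that J(2)[OF that]] .
  have fin: "emeasure J (A \<times> B) \<noteq> \<infinity>" if "A \<in> finite_sets M" "B \<in> finite_sets N" for A B
    using le(1)[OF that] that by (auto simp: finite_sets_def top_unique)
  have f: "fst \<in> measurable J M" "snd \<in> measurable J N"
    by (rule measurable_domain_cong[OF measurable_fst J(1)], rule measurable_domain_cong[OF measurable_snd J(1)])
  have TS: "map_prod T S \<in> measurable J (M \<Otimes>\<^sub>M N)"
    by (rule measurable_domain_cong[OF _ J(1)]) (use Md(2) Nd(2) in \<open>simp add: map_prod_def split_beta'\<close>)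
  have spJ: "space J = space M \<times> space N"
    using sets_eq_imp_space_eq[OF J(1)] by (simp add: space_pair_measure)
  have inv: "distr J (M \<Otimes>\<^sub>M N) (map_prod T S) = J"
  proof (rule sym, rule measure_eqI_finite_rectangles[OF Md(1) Nd(1) J(1) _ _ fin])
    fix A B assume A: "A \<in> finite_sets M" and B: "B \<in> finite_sets N"
    have AB: "A \<in> sets M" "B \<in> sets N" using A B by (auto dest: finite_setsD)
    let ?A = "T -` A \<inter> space M" and ?B = "S -` B \<inter> space N"
    have A': "?A \<in> finite_sets M" "emeasure M ?A = emeasure M A"
      using finite_sets_vimage[OF Md(2,3) A] emeasure_distr[OF Md(2) AB(1)] by (simp_all add: Md(3))
    have B': "?B \<in> finite_sets N" "emeasure N ?B = emeasure N B"
      using finite_sets_vimage[OF Nd(2,3) B] emeasure_distr[OF Nd(2) AB(2)] by (simp_all add: Nd(3))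
    have "emeasure M A * emeasure N B + emeasure J (?A \<times> ?B) = emeasure M A * emeasure N B + emeasure J (A \<times> B)"
      using J(2)[OF A B] J(2)[OF A'(1) B'(1)] joining_mixed_moment_invariant[OF M N P Q \<rho> AB]
      by (auto simp: A'(2) B'(2) add.commute)
    moreover have "emeasure M A * emeasure N B \<noteq> top"
      using A B by (auto simp: finite_sets_def ennreal_mult_eq_top_iff)
    ultimately have "emeasure J (?A \<times> ?B) = emeasure J (A \<times> B)"
      by (simp add: ennreal_add_left_cancel)
    moreover have "map_prod T S -` (A \<times> B) \<inter> space J = ?A \<times> ?B" by (auto simp: spJ)
    ultimately show "emeasure J (A \<times> B) = emeasure (distr J (M \<Otimes>\<^sub>M N) (map_prod T S)) (A \<times> B)"
      using emeasure_distr[OF TS pair_measureI[OF AB]] by simp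
  qed simp_all
  obtain X :: "nat \<Rightarrow> _" and Y :: "nat \<Rightarrow> _" where XY: "\<And>i. X i \<in> finite_sets M" "\<And>i. Y i \<in> finite_sets N"
    and inc: "incseq (\<lambda>i. X i \<times> Y i)" and RU: "(\<Union>i. X i \<times> Y i) = space M \<times> space N"
    by (rule finite_rectangle_exhaustion[OF Md(1) Nd(1)], rule that)
  have C: "range (\<lambda>i. X i \<times> Y i) \<subseteq> sets J" "(\<Union>i. X i \<times> Y i) = space J"
    unfolding J(1) spJ RU using pair_measureI[OF finite_setsD(1)[OF XY(1)] finite_setsD(1)[OF XY(2)]] by auto
  have leM: "emeasure J (fst -` A \<inter> X i \<times> Y i) \<le> emeasure M A" if A: "A \<in> finite_sets M" for A i
  proof -
    have "fst -` A \<inter> X i \<times> Y i \<subseteq> A \<times> Y i" by auto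
    moreover have "A \<times> Y i \<in> sets J" unfolding J(1) using A XY by (intro pair_measureI finite_setsD)
    ultimately show ?thesis by (rule order_trans[OF emeasure_mono le(1)[OF A XY(2)]])
  qed
  have leN: "emeasure J (snd -` B \<inter> X i \<times> Y i) \<le> emeasure N B" if B: "B \<in> finite_sets N" for B i
  proof -
    have "snd -` B \<inter> X i \<times> Y i \<subseteq> X i \<times> B" by auto
    moreover have "X i \<times> B \<in> sets J" unfolding J(1) using B XY by (intro pair_measureI finite_setsD)
    ultimately show ?thesis by (rule order_trans[OF emeasure_mono le(2)[OF XY(1) B]])
  qed
  have equi: "fst \<circ> map_prod T S = T \<circ> fst" "snd \<circ> map_prod T S = S \<circ> snd" by auto
  obtain c1 :: real where c1: "0 \<le> c1" "distr J M fst = scale_measure (ennreal c1) M"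
    by (rule dominated_ergodic_factor[OF M erg(1) f(1) TS inv equi(1) C(1) inc C(2) leM])
  obtain c2 :: real where c2: "0 \<le> c2" "distr J N snd = scale_measure (ennreal c2) N"
    by (rule dominated_ergodic_factor[OF N erg(2) f(2) TS inv equi(2) C(1) inc C(2) leN])
  have "\<not> (0 < c1 \<and> 0 < c2)"
  proof
    assume "0 < c1 \<and> 0 < c2"
    moreover have "joining (scale_measure (ennreal c1) M) T (scale_measure (ennreal c2) N) S J"
      unfolding joining_def
    proof (intro conjI)
      have s: "sets (scale_measure (ennreal c1) M \<Otimes>\<^sub>M scale_measure (ennreal c2) N) = sets (M \<Otimes>\<^sub>M N)"
        by (intro sets_pair_measure_cong) simp_all
      show "sets J = sets (scale_measure (ennreal c1) M \<Otimes>\<^sub>M scale_measure (ennreal c2) N)"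
        unfolding s by (rule J(1))
      show "distr J (scale_measure (ennreal c1) M) fst = scale_measure (ennreal c1) M"
        by (subst c1(2)[symmetric], rule distr_cong) simp_all
      show "distr J (scale_measure (ennreal c2) N) snd = scale_measure (ennreal c2) N"
        by (subst c2(2)[symmetric], rule distr_cong) simp_all
      show "distr J (scale_measure (ennreal c1) M \<Otimes>\<^sub>M scale_measure (ennreal c2) N) (map_prod T S) = J"
        by (subst (2) inv[symmetric], rule distr_cong[OF refl s]) simp
    qed
    ultimately show False using disj unfolding strongly_disjoint_def by blast
  qed
  then have J0: "emeasure J (space J) = 0"
  proof -
    have "emeasure (distr J M fst) (space M) = emeasure J (space J)"
      using emeasure_distr[OF f(1) sets.top] measurable_space[OF f(1)] by (auto intro: arg_cong[where f="emeasure J"])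
    moreover have "emeasure (distr J N snd) (space N) = emeasure J (space J)"
      using emeasure_distr[OF f(2) sets.top] measurable_space[OF f(2)] by (auto intro: arg_cong[where f="emeasure J"])
    ultimately show ?thesis
      using c1 c2 \<open>\<not> (0 < c1 \<and> 0 < c2)\<close> by (cases "c1 = 0") auto
  qed
  have "emeasure J C = 0" for C
    using emeasure_space[of J C] J0 by simp
  then show ?thesis
    using J(2) by (intro uncorrelated_joining_is_product[OF M N P Q \<rho>]) simp
qed

theorem theorem4p8:
  fixes M :: "'a measure" and T :: "'a \<Rightarrow> 'a" and P :: "'a measure measure"
    and N :: "'b measure" and S :: "'b \<Rightarrow> 'b" and Q :: "'b measure measure"
  assumes "dynamical_system M T" and "dynamical_system N S"
    and "poisson_measure M P" and "poisson_measure N Q"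
  shows "(ID_disjoint M T P N S Q \<longrightarrow> strongly_disjoint M T N S) \<and>
         (ergodic M T \<and> ergodic N S \<longrightarrow>
            (strongly_disjoint M T N S \<longleftrightarrow> ID_disjoint M T P N S Q))"
  using ID_disjoint_imp_strongly_disjoint[OF assms] strongly_disjoint_imp_product[OF assms]
    product_poissonian_joining[OF assms] unfolding ID_disjoint_def by blast

end
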